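(* Let $\mathsf{Z}\colon\mathbb{C}\to\{0,1,2,\dots\}\cup\{+\infty\}$ be a distribution of points on $\mathbb{C}$ such that $\mathsf{Z}^{\mathfrak r}(r)<+\infty$ for each $r\ge 0$ and $\mathsf{Z}(0)=0$. Then for each real number $p\ge 1$ there is an entire function $f\neq 0$ (not identically zero) such that $f(\mathsf{Z})=0$ and $$M(r;f)\le\exp\int_0^{+\infty}N_{\mathsf{Z}}(rt)\,\frac{p^2t^{p-1}\,dt}{(1+t^p)^2}\quad\text{for all } r\ge 0,$$ but there is no entire function $f\neq 0$ such that $f(\mathsf{Z})=0$ and $$\liminf_{r\to+\infty}\frac{M(r;f)}{\exp N_{\mathsf{Z}}(r)}=0.$$
   Context: A distribution of points on $\mathbb{C}$ is an arbitrary function $\mathsf{Z}\colon\mathbb{C}\to\{0,1,2,\dots\}\cup\{+\infty\}$; $\mathsf{Z}(z)$ is the multiplicity of $\mathsf{Z}$ at $z$. Its radial counting function is $\mathsf{Z}^{\mathfrak r}(r):=\sum_{|z|\le r}\mathsf{Z}(z)$, $r\ge 0$. When $\mathsf{Z}(0)=0$, its radial integral counting function is $N_{\mathsf{Z}}(r):=\int_0^r\frac{\mathsf{Z}^{\mathfrak r}(t)}{t}\,dt$, $r\ge 0$. For an entire function $f$, $\mathsf{Zero}_f(z)$ denotes the multiplicity of the zero of $f$ at $z$ ($0$ if $f(z)\ne0$; $+\infty$ everywhere if $f\equiv 0$). One writes $f(\mathsf{Z})=0$ ($f$ vanishes on $\mathsf{Z}$) if $\mathsf{Zero}_f(z)\ge\mathsf{Z}(z)$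 for all $z\in\mathbb{C}$. $M(r;f):=\max_{|z|=r}|f(z)|$ for $r\ge 0$. The integral in the bound takes values in $[0,+\infty]$, with $\exp(+\infty)=+\infty$. *)

theory Defs
  imports "HOL-Complex_Analysis.Complex_Analysis"
begin

text \<open>
  A distribution of points on the plane is a function \<open>Z :: complex \<Rightarrow> enat\<close>.
\<close>

(* Every family in enat is summable (nonneg_summable_on_complete), so the default
   value 0 of infsum never occurs here. *)
definition radial_count :: "(complex \<Rightarrow> enat) \<Rightarrow> real \<Rightarrow> enat" where
  "radial_count Z r = (\<Sum>\<^sub>\<infinity>z\<in>cball 0 r. Z z)"

(* radial_count Z is monotone, hence measurable.  The endpoint t = 0 is a null set
   and is left out only to avoid the division by zero. *)
definition radial_integral_count :: "(complex \<Rightarrow> enat) \<Rightarrow> real \<Rightarrow> ennreal" where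
  "radial_integral_count Z r =
     (\<integral>\<^sup>+t\<in>{0<..r}. ennreal_of_enat (radial_count Z t) / ennreal t \<partial>lborel)"

(* For an entire f that is not identically zero and z with f z = 0, zorder f z is the
   positive multiplicity of the zero; zorder is meaningless for the zero function. *)
definition zero_mult :: "(complex \<Rightarrow> complex) \<Rightarrow> complex \<Rightarrow> enat" where
  "zero_mult f z =
     (if \<forall>w. f w = 0 then \<infinity>
      else if f z \<noteq> 0 then 0
      else enat (nat (zorder f z)))"

definition vanishes_on :: "(complex \<Rightarrow> complex) \<Rightarrow> (complex \<Rightarrow> enat) \<Rightarrow> bool" where
  "vanishes_on f Z \<longleftrightarrow> (\<forall>z. Z z \<le> zero_mult f z)"

(* For continuous f and r \<ge> 0 the sphere is compact and nonempty, so this supremum is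
   an attained maximum. *)
definition max_modulus :: "(complex \<Rightarrow> complex) \<Rightarrow> real \<Rightarrow> real" where
  "max_modulus f r = (SUP z\<in>sphere 0 r. cmod (f z))"

definition exp_ennreal :: "ennreal \<Rightarrow> ennreal" where
  "exp_ennreal x = (if x = \<infinity> then \<infinity> else ennreal (exp (enn2real x)))"

end

theory Submission
  imports Defs "HOL-Real_Asymp.Real_Asymp" "HOL-Library.Diagonal_Subsequence"
begin

text \<open>
  The second part is Jensen's inequality. For the first part the integral is rewritten as the sum of
  \<open>ln (1 + (r / \<bar>w\<bar>) powr p)\<close> over the points \<open>w\<close>; if it is finite, then the sum of \<open>\<bar>w\<bar> powr - p\<close> is
  finite, and otherwise any Weierstrass product will do.

  For an integer \<open>p\<close> the product of the polynomials \<open>1 - (z / w)\<^sup>p\<close> works. For \<open>q < p < q + 1\<close> the plane is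
  cut along two rays which bound a sector of opening \<open>2 h = \<pi> (p - q) / p\<close>. Inside and outside of this
  sector one takes products of different branches of \<open>1 + c (z / w)\<^sup>p\<close>; they vanish at the points,
  are bounded by \<open>1 + (\<bar>z\<bar> / \<bar>w\<bar>) powr p\<close>, and have equal moduli on the two rays, no matter what the
  arguments of the points are, as long as these lie in a window of width \<open>2 h\<close>. On each ray the
  quotient of the two products is \<open>exp (2 \<pi> \<i> m)\<close> with an increasing function \<open>m\<close>. Multiplication
  by the exponential of the Cauchy integral of \<open>m - \<lfloor>m\<rfloor>\<close> along the ray glues the products to a
  holomorphic function, because this integral jumps by \<open>2 \<pi> \<i> m\<close> modulo \<open>2 \<pi> \<i>\<close>. Since
  \<open>0 \<le> m - \<lfloor>m\<rfloor> \<le> 1\<close>, the new factor is bounded by the reciprocal of the sine of the angle to the ray.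

  The resulting loss is a power of \<open>1 + \<bar>z\<bar>\<close> depending on \<open>p\<close> only. It is compensated by treating
  finitely many points with linear factors, which grow slower than \<open>1 + (\<bar>z\<bar> / \<bar>w\<bar>) powr p\<close> as \<open>p > 1\<close>.
  All this is done for finitely many points on a disc; Montel's theorem yields the entire function.
\<close>

section \<open>Counting functions\<close>

text \<open>The exponent of the required bound carries no spare constant, and the exponential parts
  of the primary factors of a canonical product are too large for it. A point \<open>w\<close> may
  cost just 1 + (|z|/|w|)^p; beyond that only a factor independent of z is harmless, since f can be
  divided by it. For noninteger p the function (z/w)^p is not single-valued, hence the two branches.

  Their moduli agree on the rays because the inner branch is formed with - z and the conjugate of
  the point. At argument \<pi> - h the outer phase is p (\<pi> - h - arg w) - q \<pi>, the inner
  phase is - p (h - arg w), and \<open>2 * p * h = pi * (p - real q)\<close> makes them opposite for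
  every arg w. If |arg w| \<le> h, the outer phase lies between 0 and 2 p h < \<pi>; for such phases
  the argument of 1 + y e^(i phase) increases with y > 0, which is the monotonicity of
  \<open>m\<close>.

  Removing the integer part of \<open>m\<close> makes the loss independent of the number of points.
  Noninteger p means p > 1; this is also what makes m(s)/s continuous at 0, so that the Cauchy
  integral can start at the origin.\<close>

definition local_support :: "(complex \<Rightarrow> enat) \<Rightarrow> real \<Rightarrow> complex set" where
  "local_support Z r = {w \<in> cball 0 r. Z w \<noteq> 0}"

text \<open>Every nonzero multiplicity is at least 1, so an infinite support would have finite
  subsums of any size.\<close>

lemma local_support_facts:
  assumes "radial_count Z r < \<infinity>"
  shows "finite (local_support Z r)"
    and "w \<in> cball 0 r \<Longrightarrow> Z w < \<infinity>"
    and "radial_count Z r = (\<Sum>w\<in>local_support Z r. Z w)"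
proof -
  have S: "Z summable_on A" for A
    by (rule nonneg_summable_on_complete) simp
  have le: "(\<Sum>w\<in>F. Z w) \<le> radial_count Z r" if "finite F" "F \<subseteq> cball 0 r" for F
  proof -
    have "infsum Z F \<le> infsum Z (cball 0 r)" using that by (intro infsum_mono_neutral S) auto
    then show ?thesis using that by (simp add: radial_count_def)
  qed
  show fin: "finite (local_support Z r)"
  proof (rule ccontr)
    assume inf: "infinite (local_support Z r)"
    obtain n where n: "radial_count Z r = enat n" using assms by (cases "radial_count Z r") auto
    obtain F where F: "F \<subseteq> local_support Z r" "finite F" "card F = Suc n"
      using infinite_arbitrarily_large[OF inf] by metis
    have "enat (Suc n) = (\<Sum>w\<in>F. 1)" using F by (simp add: of_nat_eq_enat)
    also have "\<dots> \<le> (\<Sum>w\<in>F. Z w)"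
      using F by (intro sum_mono) (auto simp: local_support_def one_eSuc ileI1 zero_less_iff_neq_zero)
    also have "\<dots> \<le> enat n" using le[of F] F n unfolding local_support_def by (metis (no_types, lifting) Collect_subset subset_trans Collect_mem_eq mem_Collect_eq subset_iff)
    finally show False by simp
  qed
  show "Z w < \<infinity>" if "w \<in> cball 0 r" using le[of "{w}"] that le_less_trans[OF _ assms] by auto
  have "radial_count Z r = infsum Z (local_support Z r)"
    unfolding radial_count_def by (rule infsum_cong_neutral) (auto simp: local_support_def)
  then show "radial_count Z r = (\<Sum>w\<in>local_support Z r. Z w)" using fin by simp
qed

text \<open>One finite index set serves all t \<le> R; this later turns the integral of the counting
  function into a finite sum of integrals.\<close>

lemma radial_count_finite_sum:
  assumes fin: "radial_count Z R < \<infinity>" and t: "t \<le> R"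
  shows "radial_count Z t =
    enat (\<Sum>w\<in>local_support Z R. if cmod w \<le> t then the_enat (Z w) else 0)"
proof -
  have S: "Z summable_on A" for A
    by (rule nonneg_summable_on_complete) simp
  have "radial_count Z t \<le> radial_count Z R"
    unfolding radial_count_def using t by (intro infsum_mono_neutral S) auto
  then have fint: "radial_count Z t < \<infinity>" using fin by (rule le_less_trans)
  have "radial_count Z t = (\<Sum>w\<in>local_support Z t. Z w)" by (rule local_support_facts(3)[OF fint])
  also have "\<dots> = (\<Sum>w\<in>local_support Z R. enat (if cmod w \<le> t then the_enat (Z w) else 0))"
  proof (rule sum.mono_neutral_cong_left)
    show "Z w = enat (if cmod w \<le> t then the_enat (Z w) else 0)" if "w \<in> local_support Z t" for w
      using that local_support_facts(2)[OF fint, of w] by (auto simp: local_support_def)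
  qed (use t local_support_facts[OF fin] in \<open>auto simp: local_support_def zero_enat_def\<close>)
  also have "\<dots> = enat (\<Sum>w\<in>local_support Z R. if cmod w \<le> t then the_enat (Z w) else 0)"
    by (simp flip: of_nat_eq_enat)
  finally show ?thesis .
qed

lemma nn_integral_inverse_Icc:
  assumes "0 < a"
  shows "(\<integral>\<^sup>+t. ennreal ((if a \<le> t then 1 else 0) / t) * indicator {0<..r} t \<partial>lborel) = ennreal (ln (max a r / a))"
proof (cases "a \<le> r")
  case True
  have "(\<integral>\<^sup>+t. ennreal ((if a \<le> t then 1 else 0) / t) * indicator {0<..r} t \<partial>lborel)
      = (\<integral>\<^sup>+t. ennreal ((if a \<le> t then 1 else 0) / t) * indicator {a..r} t \<partial>lborel)"
    using assms by (intro nn_integral_cong) (auto simp: indicator_def)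
  also have "\<dots> = (\<integral>\<^sup>+t. ennreal (1 / t) * indicator {a..r} t \<partial>lborel)"
    by (intro nn_integral_cong) (auto simp: indicator_def)
  also have "\<dots> = ennreal (ln r - ln a)"
    by (rule nn_integral_FTC_Icc)
       (use assms True in \<open>auto intro!: derivative_eq_intros simp: field_simps\<close>)
  finally show ?thesis using assms True by (simp add: ln_div max_def)
next
  case False
  then have "(\<integral>\<^sup>+t. ennreal ((if a \<le> t then 1 else 0) / t) * indicator {0<..r} t \<partial>lborel) = (\<integral>\<^sup>+t. 0 \<partial>(lborel :: real measure))"
    by (intro nn_integral_cong) (auto simp: indicator_def)
  then show ?thesis using assms False by (simp add: max_def)
qed

text \<open>Each point contributes the integral of 1/t from |w| to r, which is the positive part of
  ln (r/|w|). Written with \<open>max\<close>, points beyond r contribute ln 1 = 0, so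
  \<open>R\<close> can be fixed independently of r.\<close>

lemma radial_integral_count_eq:
  assumes fin: "radial_count Z R < \<infinity>" and Z0: "Z 0 = 0" and r: "r \<le> R"
  shows "radial_integral_count Z r =
    ennreal (\<Sum>w\<in>local_support Z R. real (the_enat (Z w)) * ln (max (cmod w) r / cmod w))"
proof -
  let ?A = "local_support Z R" and ?m = "\<lambda>w. the_enat (Z w)"
  have nz: "cmod w > 0" if "w \<in> ?A" for w using that Z0 by (auto simp: local_support_def)
  have "radial_integral_count Z r =
    (\<integral>\<^sup>+t. (\<Sum>w\<in>?A. ennreal (?m w) * (ennreal ((if cmod w \<le> t then 1 else 0) / t) * indicator {0<..r} t)) \<partial>lborel)"
    unfolding radial_integral_count_def
  proof (intro nn_integral_cong)
    fix t :: real
    show "ennreal_of_enat (radial_count Z t) / ennreal t * indicator {0<..r} t =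
      (\<Sum>w\<in>?A. ennreal (?m w) * (ennreal ((if cmod w \<le> t then 1 else 0) / t) * indicator {0<..r} t))"
    proof (cases "t \<in> {0<..r}")
      case True
      then have t: "0 < t" "t \<le> R" using r by auto
      have "real (\<Sum>w\<in>?A. if cmod w \<le> t then ?m w else 0) = (\<Sum>w\<in>?A. if cmod w \<le> t then real (?m w) else 0)"
        unfolding of_nat_sum by (intro sum.cong) auto
      then have "ennreal_of_enat (radial_count Z t) = ennreal (\<Sum>w\<in>?A. if cmod w \<le> t then real (?m w) else 0)"
        using radial_count_finite_sum[OF fin t(2)]
        by (simp only: ennreal_of_enat_enat ennreal_of_nat_eq_real_of_nat)
      then have "ennreal_of_enat (radial_count Z t) / ennreal t
          = ennreal ((\<Sum>w\<in>?A. if cmod w \<le> t then real (?m w) else 0) / t)"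
        using t by (simp add: divide_ennreal sum_nonneg)
      also have "\<dots> = (\<Sum>w\<in>?A. ennreal (real (?m w) * ((if cmod w \<le> t then 1 else 0) / t)))"
        using t by (subst sum_ennreal) (auto simp: sum_divide_distrib intro!: arg_cong[where f = ennreal] sum.cong)
      also have "\<dots> = (\<Sum>w\<in>?A. ennreal (?m w) * ennreal ((if cmod w \<le> t then 1 else 0) / t))"
        using t by (intro sum.cong refl ennreal_mult'') auto
      finally show ?thesis using True by simp
    qed auto
  qed
  also have "\<dots> = (\<Sum>w\<in>?A. ennreal (?m w) * ennreal (ln (max (cmod w) r / cmod w)))"
    by (subst nn_integral_sum; simp add: nn_integral_cmult)
       (intro sum.cong refl arg_cong2[where f = "(*)"] nn_integral_inverse_Icc nz)
  also have "\<dots> = ennreal (\<Sum>w\<in>?A. real (?m w) * ln (max (cmod w) r / cmod w))"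
    using nz by (subst sum_ennreal[symmetric])
      (auto simp: ennreal_mult'' intro!: mult_nonneg_nonneg ln_ge_zero)
  finally show ?thesis .
qed

text \<open>The kernel is the derivative of - p / (1 + t^p). With b = a/r, integration by parts
  against ln (t/b) leaves the integral of p / (t (1 + t^p)) over t > b, and this is ln (1 +
  b^(-p)).\<close>

lemma growth_kernel_integral:
  assumes p: "(p::real) \<ge> 1" and a: "0 < a" and r: "0 < r"
  shows "(\<integral>\<^sup>+t. ennreal (ln (max a (r * t) / a) * (p\<^sup>2 * t powr (p - 1) / (1 + t powr p)\<^sup>2)) * indicator {0<..} t \<partial>lborel)
    = ennreal (ln (1 + (r / a) powr p))"
proof -
  define b where "b = a / r"
  have b: "b > 0" using a r by (simp add: b_def)
  \<comment> \<open>The antiderivative produced by this integration by parts, normalised to tend to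
    0 at infinity.\<close>
  define G where "G = (\<lambda>t. - (p * ln (t / b) / (1 + t powr p)) + p * ln t - ln (1 + t powr p))"
  define f where "f = (\<lambda>t. if b \<le> t then ln (t / b) * (p\<^sup>2 * t powr (p - 1) / (1 + t powr p)\<^sup>2) else 0)"
  have "(\<integral>\<^sup>+t. ennreal (ln (max a (r * t) / a) * (p\<^sup>2 * t powr (p - 1) / (1 + t powr p)\<^sup>2)) * indicator {0<..} t \<partial>lborel)
     = (\<integral>\<^sup>+t. ennreal (f t) * indicator {b..} t \<partial>lborel)"
  proof (intro nn_integral_cong)
    fix t :: real
    show "ennreal (ln (max a (r * t) / a) * (p\<^sup>2 * t powr (p - 1) / (1 + t powr p)\<^sup>2)) * indicator {0<..} t
      = ennreal (f t) * indicator {b..} t"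
    proof (cases "b \<le> t")
      case True
      then have t: "0 < t" using b by simp
      have "max a (r * t) / a = t / b" using True a r by (auto simp: b_def field_simps max_def)
      then show ?thesis using True t by (simp add: f_def)
    next
      case False
      then have "max a (r * t) = a" using a r by (auto simp: b_def field_simps max_def)
      then show ?thesis using False a by simp
    qed
  qed
  also have "\<dots> = ennreal (0 - G b)"
  proof (rule nn_integral_FTC_atLeast)
    show "f \<in> borel_measurable borel" unfolding f_def by measurable
    show "0 \<le> f t" if "b \<le> t" for t using that b by (auto simp: f_def)
    show "DERIV G t :> f t" if "b \<le> t" for t
    proof -
      have t: "0 < t" using b that by simp
      have pos: "1 + t powr p > 0" by (simp add: add_pos_nonneg)
      have e: "t powr p = t * t powr (p - 1)" using t by (simp add: powr_diff)
      have "DERIV G t :> - ((p * (1/t) * (1 + t powr p) - p * ln (t/b) * (p * t powr (p-1))) / (1 + t powr p)\<^sup>2)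
         + p / t - (p * t powr (p-1)) / (1 + t powr p)"
        unfolding G_def using t b pos
        by (auto intro!: derivative_eq_intros simp: power2_eq_square field_simps)
      also have "- ((p * (1/t) * (1 + t powr p) - p * ln (t/b) * (p * t powr (p-1))) / (1 + t powr p)\<^sup>2)
         + p / t - (p * t powr (p-1)) / (1 + t powr p) = f t"
      proof -
        define u where "u = t powr (p-1)"
        have u: "1 + t * u \<noteq> 0" using pos by (simp add: u_def e)
        show ?thesis using t u that unfolding f_def e u_def[symmetric]
          by (simp add: divide_simps power2_eq_square) (simp add: algebra_simps)
      qed
      finally show ?thesis .
    qed
    have "((\<lambda>t. - (p * (ln t - ln b) / (1 + t powr p)) + p * ln t - ln (1 + t powr p)) \<longlongrightarrow> 0) at_top"
      using p by real_asymp
    then show "(G \<longlongrightarrow> 0) at_top"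
      by (rule Lim_transform_eventually)
         (rule eventually_mono[OF eventually_gt_at_top[of 0]], use b in \<open>simp add: G_def ln_div\<close>)
  qed
  also have "0 - G b = ln (1 + b powr p) - ln (b powr p)"
    using b by (simp add: G_def ln_powr)
  also have "\<dots> = ln ((1 + b powr p) / b powr p)"
    using b add_pos_nonneg[of 1 "b powr p"] by (subst ln_div) auto
  also have "(1 + b powr p) / b powr p = 1 + (r / a) powr p"
    using a r by (simp add: b_def powr_divide field_simps)
  finally show ?thesis .
qed

text \<open>This direction is the one that matters: an upper bound for the integral has to control
  all finite partial sums, and the entire function will be estimated by any common bound of these
  sums.\<close>

lemma growth_integral_lower_bound:
  assumes p: "(p::real) \<ge> 1" and fin: "\<And>r. r \<ge> 0 \<Longrightarrow> radial_count Z r < \<infinity>" and Z0: "Z 0 = 0"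
    and r: "0 < r"
  shows "ennreal (\<Sum>w\<in>local_support Z R. real (the_enat (Z w)) * ln (1 + (r / cmod w) powr p))
    \<le> (\<integral>\<^sup>+t\<in>{0<..}. radial_integral_count Z (r * t) * ennreal (p\<^sup>2 * t powr (p - 1) / (1 + t powr p)\<^sup>2) \<partial>lborel)"
proof -
  let ?A = "local_support Z R" and ?m = "\<lambda>w. the_enat (Z w)"
  let ?k = "\<lambda>t. p\<^sup>2 * t powr (p - 1) / (1 + t powr p)\<^sup>2"
  have nz: "cmod w > 0" if "w \<in> ?A" for w using that Z0 by (auto simp: local_support_def)
  have "ennreal (\<Sum>w\<in>?A. real (?m w) * ln (1 + (r / cmod w) powr p))
     = (\<Sum>w\<in>?A. ennreal (?m w) * ennreal (ln (1 + (r / cmod w) powr p)))"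
    by (subst sum_ennreal[symmetric]) (auto simp: ennreal_mult'' intro!: mult_nonneg_nonneg ln_ge_zero)
  also have "\<dots> = (\<Sum>w\<in>?A. \<integral>\<^sup>+t. ennreal (?m w) * (ennreal (ln (max (cmod w) (r * t) / cmod w) * ?k t) * indicator {0<..} t) \<partial>lborel)"
    using growth_kernel_integral[OF p nz r] by (intro sum.cong refl) (simp add: nn_integral_cmult)
  also have "\<dots> = (\<integral>\<^sup>+t. (\<Sum>w\<in>?A. ennreal (?m w) * (ennreal (ln (max (cmod w) (r * t) / cmod w) * ?k t) * indicator {0<..} t)) \<partial>lborel)"
    by (subst nn_integral_sum) auto
  also have "\<dots> \<le> (\<integral>\<^sup>+t\<in>{0<..}. radial_integral_count Z (r * t) * ennreal (?k t) \<partial>lborel)"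
  proof (intro nn_integral_mono)
    fix t :: real
    show "(\<Sum>w\<in>?A. ennreal (?m w) * (ennreal (ln (max (cmod w) (r * t) / cmod w) * ?k t) * indicator {0<..} t))
      \<le> radial_integral_count Z (r * t) * ennreal (?k t) * indicator {0<..} t"
    proof (cases "t > 0")
      case True
      \<comment> \<open>Large enough for the given points and for those counted up to radius r * t;
        the points added contribute nonnegative terms.\<close>
      define R' where "R' = max R (r * t)"
      have R': "R \<le> R'" "r * t \<le> R'" "0 \<le> R'" using True r by (auto simp: R'_def le_max_iff_disj)
      have ln0: "0 \<le> ln (max (cmod w) (r * t) / cmod w)" if "cmod w > 0" for w
        using that by (intro ln_ge_zero) (auto simp: field_simps)
      have "(\<Sum>w\<in>?A. ennreal (?m w) * (ennreal (ln (max (cmod w) (r * t) / cmod w) * ?k t)))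
         = (\<Sum>w\<in>?A. ennreal (real (?m w) * ln (max (cmod w) (r * t) / cmod w))) * ennreal (?k t)"
        unfolding sum_distrib_right
      proof (intro sum.cong refl)
        fix w assume "w \<in> ?A"
        then show "ennreal (?m w) * ennreal (ln (max (cmod w) (r * t) / cmod w) * ?k t)
          = ennreal (real (?m w) * ln (max (cmod w) (r * t) / cmod w)) * ennreal (?k t)"
          using ln0[OF nz] by (simp only: ennreal_mult' ennreal_mult'' of_nat_0_le_iff mult.assoc)
      qed
      also have "(\<Sum>w\<in>?A. ennreal (real (?m w) * ln (max (cmod w) (r * t) / cmod w)))
          = ennreal (\<Sum>w\<in>?A. real (?m w) * ln (max (cmod w) (r * t) / cmod w))"
        using ln0 nz by (intro sum_ennreal) auto
      also have "\<dots> \<le> ennreal (\<Sum>w\<in>local_support Z R'. real (?m w) * ln (max (cmod w) (r * t) / cmod w))"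
      proof (intro ennreal_leI sum_mono2)
        show "finite (local_support Z R')" using local_support_facts(1) fin R' by blast
        show "?A \<subseteq> local_support Z R'" using R' by (auto simp: local_support_def)
        show "0 \<le> real (?m w) * ln (max (cmod w) (r * t) / cmod w)" if "w \<in> local_support Z R' - ?A" for w
          using that Z0 by (intro mult_nonneg_nonneg ln0) (auto simp: local_support_def)
      qed
      also have "\<dots> = radial_integral_count Z (r * t)"
        using radial_integral_count_eq[of Z R' "r * t"] fin R' Z0 by simp
      finally show ?thesis using True by (simp add: mult_right_mono)
    qed auto
  qed
  finally show ?thesis .
qed

text \<open>A lower bound for the multiplicity, stated as a growth condition. The filter
  \<open>nhds\<close> includes the point itself, so that m > 0 forces f w = 0, while m = 0 says that
  f is bounded near w. In this form the notion passes to products, rotations and locally bounded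
  limits without any assumption that f is not identically zero.\<close>

definition has_zero :: "(complex \<Rightarrow> complex) \<Rightarrow> complex \<Rightarrow> nat \<Rightarrow> bool" where
  "has_zero f w m \<longleftrightarrow> f \<in> O[nhds w](\<lambda>z. (z - w) ^ m)"

section \<open>Zeros and Jensen's inequality\<close>

lemma holomorphic_on_imp_isCont:
  assumes "f holomorphic_on S" "w \<in> interior S"
  shows "isCont f w"
  using continuous_on_interior[OF holomorphic_on_imp_continuous_on] assms by blast

lemma has_zero_0: "isCont f w \<Longrightarrow> has_zero f w 0"
  unfolding has_zero_def
  by (auto intro!: bigoI_tendsto simp: isCont_def tendsto_nhds_iff)

lemma has_zero_mult:
  assumes "has_zero f w m" "has_zero g w n"
  shows "has_zero (\<lambda>z. f z * g z) w (m + n)"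
  using landau_o.big_mult[OF assms[unfolded has_zero_def]] by (simp add: has_zero_def power_add)

lemma has_zero_prod:
  assumes "\<And>i. i \<in> I \<Longrightarrow> has_zero (f i) w (m i)"
  shows "has_zero (\<lambda>z. \<Prod>i\<in>I. f i z) w (\<Sum>i\<in>I. m i)"
  using assms by (induction I rule: infinite_finite_induct)
    (auto intro: has_zero_mult has_zero_0 continuous_const)

lemma has_zero_mono:
  assumes "has_zero f w m" "n \<le> m"
  shows "has_zero f w n"
proof -
  have "(\<lambda>z. (z - w) ^ m) = (\<lambda>z. (z - w) ^ (m - n) * (z - w) ^ n)"
    using assms(2) by (simp flip: power_add)
  moreover have "(\<lambda>z. (z - w) ^ (m - n)) \<in> O[nhds w](\<lambda>_. 1)"
    by (intro bigoI_tendsto[where c = "0 ^ (m - n)"]) (auto intro!: tendsto_eq_intros filterlim_ident)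
  ultimately have "(\<lambda>z. (z - w) ^ m) \<in> O[nhds w](\<lambda>z. (z - w) ^ n)"
    using landau_o.big_mult[of "\<lambda>z. (z - w) ^ (m - n)" "nhds w" "\<lambda>_. 1" "\<lambda>z. (z - w) ^ n" "\<lambda>z. (z - w) ^ n"]
    by simp
  then show ?thesis using assms(1) landau_o.big_trans unfolding has_zero_def by blast
qed

lemma has_zero_cong:
  assumes "\<forall>\<^sub>F z in nhds w. f z = g z"
  shows "has_zero f w m \<longleftrightarrow> has_zero g w m"
  unfolding has_zero_def by (rule landau_o.big.in_cong) fact

lemma has_zero_1:
  assumes "f analytic_on {w}" "f w = 0"
  shows "has_zero f w 1"
proof -
  have "f field_differentiable at w" using assms analytic_on_imp_differentiable_at by blast
  then obtain D where "(f has_field_derivative D) (at w)" by (auto simp: field_differentiable_def)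
  then have "((\<lambda>z. f z / (z - w)) \<longlongrightarrow> D) (at w)"
    using assms(2) by (simp add: has_field_derivative_iff)
  then have "f \<in> O[at w](\<lambda>z. z - w)"
    by (rule bigoI_tendsto) (auto simp: eventually_at intro!: exI[of _ 1])
  then obtain c where c: "c > 0" "\<forall>\<^sub>F z in at w. norm (f z) \<le> c * norm (z - w)"
    by (elim landau_o.bigE)
  then have "\<forall>\<^sub>F z in nhds w. z \<noteq> w \<longrightarrow> norm (f z) \<le> c * norm (z - w)"
    by (simp add: eventually_at_filter)
  then have "\<forall>\<^sub>F z in nhds w. norm (f z) \<le> c * norm (z - w)"
    by eventually_elim (use assms(2) in auto)
  then show ?thesis unfolding has_zero_def by (intro bigoI[of _ c]) simp
qed

text \<open>Induction on m: the quotient obtained so far is O(z - w), hence vanishes at w, and its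
  difference quotient, completed by the derivative at w, is the next quotient.\<close>

lemma has_zero_factor:
  assumes "f holomorphic_on S" "open S" "w \<in> S" "has_zero f w m"
  shows "\<exists>g. g holomorphic_on S \<and> (\<forall>z\<in>S. f z = (z - w) ^ m * g z)"
  using assms(4)
proof (induction m)
  case 0
  then show ?case using assms(1) by auto
next
  case (Suc m)
  then obtain g where g: "g holomorphic_on S" "\<And>z. z \<in> S \<Longrightarrow> f z = (z - w) ^ m * g z"
    using has_zero_mono[of f w "Suc m" m] by auto
  from Suc.prems obtain c where c: "c > 0" "\<forall>\<^sub>F z in nhds w. norm (f z) \<le> c * norm ((z - w) ^ Suc m)"
    unfolding has_zero_def by (elim landau_o.bigE)
  have "\<forall>\<^sub>F z in at w. norm (g z) \<le> norm (of_real c * (z - w))"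
  proof -
    have "\<forall>\<^sub>F z in at w. norm (f z) \<le> c * norm ((z - w) ^ Suc m)"
      using c(2) by (simp add: eventually_at_filter eventually_mono)
    moreover have "\<forall>\<^sub>F z in at w. z \<in> S" using assms(2,3) by (simp add: eventually_at_in_open')
    moreover have "\<forall>\<^sub>F z in at w. z \<noteq> w" by (simp add: eventually_at_filter)
    ultimately show ?thesis
    proof eventually_elim
      case (elim z)
      then show ?case using g(2)[of z] c(1) by (simp add: norm_mult norm_power mult_ac)
    qed
  qed
  moreover have "((\<lambda>z. norm (of_real c * (z - w))) \<longlongrightarrow> 0) (at w)" by (auto intro!: tendsto_eq_intros)
  ultimately have "(g \<longlongrightarrow> 0) (at w)" by (rule Lim_null_comparison)
  moreover have "(g \<longlongrightarrow> g w) (at w)"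
    by (rule isContD[OF holomorphic_on_imp_isCont[OF g(1)]]) (use assms(2,3) in \<open>simp add: interior_open\<close>)
  ultimately have g0: "g w = 0" using LIM_unique by blast
  let ?h = "\<lambda>z. if z = w then deriv g w else (g z - g w) / (z - w)"
  have "?h holomorphic_on S" using pole_lemma[OF g(1)] assms(2,3) by (simp add: interior_open)
  moreover have "f z = (z - w) ^ Suc m * ?h z" if "z \<in> S" for z
    using g(2)[OF that] g0 by auto
  ultimately show ?case by blast
qed

text \<open>Link between the growth condition and \<open>zorder\<close>. If m exceeded the order n,
  the zero-free cofactor would be (z - w)^(m - n) times a holomorphic function near w and so would
  vanish at w.\<close>

lemma zero_mult_ge_iff:
  assumes f: "f holomorphic_on UNIV" and nz: "\<exists>z. f z \<noteq> 0"
  shows "enat m \<le> zero_mult f w \<longleftrightarrow> has_zero f w m"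
proof -
  obtain r where r: "r > 0" "if f w = 0 then zorder f w > 0 else zorder f w = 0"
     "zor_poly f w holomorphic_on cball w r"
     "\<And>z. z \<in> cball w r \<Longrightarrow> f z = zor_poly f w z * (z - w) ^ nat (zorder f w) \<and> zor_poly f w z \<noteq> 0"
    using zorder_exist_zero[OF f open_UNIV connected_UNIV, where z = w] nz by blast
  define h n where "h = zor_poly f w" and "n = nat (zorder f w)"
  have ev: "\<forall>\<^sub>F z in nhds w. z \<in> ball w r" using r(1) eventually_nhds_in_open by force
  have conth: "isCont h w"
    unfolding h_def by (rule holomorphic_on_imp_isCont[OF r(3)]) (use r(1) in simp)
  have hw: "h w \<noteq> 0" using r(1) r(4)[of w] by (simp add: h_def)
  have fh: "\<forall>\<^sub>F z in nhds w. f z = h z * (z - w) ^ n"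
    using ev by eventually_elim (use r(4) h_def n_def in auto)
  have zm: "zero_mult f w = enat n"
    using nz r(2) by (auto simp: zero_mult_def n_def zero_enat_def)
  show ?thesis
  proof
    assume "enat m \<le> zero_mult f w"
    then have "m \<le> n" by (simp add: zm)
    moreover have "has_zero (\<lambda>z. (z - w) ^ n) w n" by (simp add: has_zero_def)
    then have "has_zero (\<lambda>z. h z * (z - w) ^ n) w (0 + n)"
      using conth by (intro has_zero_mult has_zero_0)
    then have "has_zero f w n" using has_zero_cong[OF fh] by simp
    ultimately show "has_zero f w m" by (rule has_zero_mono[rotated])
  next
    assume "has_zero f w m"
    then obtain g where g: "g holomorphic_on UNIV" "\<And>z. f z = (z - w) ^ m * g z"
      using has_zero_factor[OF f open_UNIV UNIV_I, of w m] by blast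
    show "enat m \<le> zero_mult f w"
    proof (rule ccontr)
      assume "\<not> ?thesis"
      then have nm: "n < m" by (simp add: zm)
      have "\<forall>\<^sub>F z in at w. h z = (z - w) ^ (m - n) * g z"
        unfolding eventually_at_filter using fh
      proof eventually_elim
        case (elim z)
        show ?case
        proof (intro impI)
          assume "z \<noteq> w"
          have e: "(z - w) ^ m = (z - w) ^ n * (z - w) ^ (m - n)" using nm by (simp flip: power_add)
          have "h z * (z - w) ^ n = f z" using elim by simp
          also have "\<dots> = (z - w) ^ n * ((z - w) ^ (m - n) * g z)"
            using g(2)[of z] by (simp only: e mult.assoc)
          finally have "h z * (z - w) ^ n = (z - w) ^ n * ((z - w) ^ (m - n) * g z)" .
          then show "h z = (z - w) ^ (m - n) * g z" using \<open>z \<noteq> w\<close> by simp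
        qed
      qed
      moreover have "((\<lambda>z. (z - w) ^ (m - n) * g z) \<longlongrightarrow> 0 ^ (m - n) * g w) (at w)"
      proof -
        have "(g \<longlongrightarrow> g w) (at w)"
          by (rule isContD[OF holomorphic_on_imp_isCont[OF g(1)]]) simp
        then show ?thesis by (auto intro!: tendsto_eq_intros)
      qed
      ultimately have "(h \<longlongrightarrow> 0) (at w)"
        using nm by (simp add: tendsto_cong power_0_left)
      moreover have "(h \<longlongrightarrow> h w) (at w)" using conth isContD by blast
      ultimately show False using hw LIM_unique by blast
    qed
  qed
qed

lemma has_zero_divide:
  assumes "has_zero (\<lambda>z. q z * g z) w m" "isCont q w" "q w \<noteq> 0"
  shows "has_zero g w m"
proof -
  have "has_zero (\<lambda>z. inverse (q z)) w 0" using assms(2,3) by (intro has_zero_0) (auto intro: continuous_intros)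
  then have "has_zero (\<lambda>z. inverse (q z) * (q z * g z)) w (0 + m)"
    using assms(1) by (rule has_zero_mult)
  moreover have "\<forall>\<^sub>F z in nhds w. q z \<noteq> 0"
    using assms(2,3) by (intro tendsto_imp_eventually_ne) (auto simp: isCont_def tendsto_at_iff_tendsto_nhds)
  then have "\<forall>\<^sub>F z in nhds w. inverse (q z) * (q z * g z) = g z" by eventually_elim simp
  then have "has_zero (\<lambda>z. inverse (q z) * (q z * g z)) w m \<longleftrightarrow> has_zero g w m"
    by (rule has_zero_cong)
  ultimately show ?thesis by simp
qed

text \<open>The zeros are divided out one by one; the factors already removed do not vanish at the
  next point.\<close>

lemma has_zero_factor_prod:
  assumes f: "f holomorphic_on UNIV" and "finite A" and "\<And>w. w \<in> A \<Longrightarrow> has_zero f w (m w)"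
  shows "\<exists>g. g holomorphic_on UNIV \<and> (\<forall>z. f z = (\<Prod>w\<in>A. (z - w) ^ m w) * g z)"
  using assms(2,3)
proof (induction A rule: finite_induct)
  case empty
  then show ?case using f by auto
next
  case (insert w A)
  then obtain g where g: "g holomorphic_on UNIV" "\<And>z. f z = (\<Prod>w\<in>A. (z - w) ^ m w) * g z"
    by auto
  have "has_zero g w (m w)"
  proof (rule has_zero_divide)
    show "has_zero (\<lambda>z. (\<Prod>w\<in>A. (z - w) ^ m w) * g z) w (m w)"
      using insert.prems[of w] unfolding g(2)[symmetric] by simp
    show "isCont (\<lambda>z. \<Prod>w\<in>A. (z - w) ^ m w) w" by (intro continuous_intros)
    show "(\<Prod>v\<in>A. (w - v) ^ m v) \<noteq> 0" using insert.hyps by auto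
  qed
  then obtain h where h: "h holomorphic_on UNIV" "\<And>z. g z = (z - w) ^ m w * h z"
    using has_zero_factor[OF g(1) open_UNIV UNIV_I, of w "m w"] by blast
  show ?case using insert.hyps g h by (intro exI[of _ h]) (auto simp: mult_ac)
qed

section \<open>Maximum modulus, Jensen's inequality and the lower growth bound\<close>

lemma max_modulus_upper:
  assumes "continuous_on UNIV f" "cmod z = r"
  shows "cmod (f z) \<le> max_modulus f r"
proof -
  have "compact ((\<lambda>z. cmod (f z)) ` sphere 0 r)"
    using assms(1) by (intro compact_continuous_image continuous_intros) (auto intro: continuous_on_subset)
  then have "bdd_above ((\<lambda>z. cmod (f z)) ` sphere 0 r)"
    by (intro bounded_imp_bdd_above compact_imp_bounded)
  then show ?thesis unfolding max_modulus_def using assms(2) by (intro cSUP_upper) auto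
qed

lemma max_modulus_least:
  assumes "r \<ge> 0" "\<And>z. cmod z = r \<Longrightarrow> cmod (f z) \<le> B"
  shows "max_modulus f r \<le> B"
  unfolding max_modulus_def
proof (rule cSUP_least)
  have "complex_of_real r \<in> sphere 0 r" using assms(1) by simp
  then show "sphere (0::complex) r \<noteq> {}" by blast
qed (use assms(2) in auto)

text \<open>Each factor z - w is replaced by r^2 - cnj w * z, whose modulus on |z| = r is r |z - w|.
  Thus the modulus on the circle only gains a constant, while at 0 the factor - w becomes r^2; the
  maximum principle compares the two. This is Jensen's inequality in multiplicative form.\<close>

lemma jensen_max_modulus:
  assumes f: "f holomorphic_on UNIV" and A: "finite A" "A \<subseteq> cball 0 r - {0}" and r: "r > 0"
    and z: "\<And>w. w \<in> A \<Longrightarrow> has_zero f w (m w)"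
  shows "cmod (f 0) * (\<Prod>w\<in>A. (r / cmod w) ^ m w) \<le> max_modulus f r"
proof -
  obtain g where g: "g holomorphic_on UNIV" "\<And>z. f z = (\<Prod>w\<in>A. (z - w) ^ m w) * g z"
    using has_zero_factor_prod[of f A m] f A z by blast
  define B where "B = (\<lambda>z. (\<Prod>w\<in>A. (of_real (r\<^sup>2) - cnj w * z) ^ m w) * g z)"
  have holB: "B holomorphic_on S" for S
    unfolding B_def by (intro holomorphic_intros holomorphic_on_subset[OF g(1)]) auto
  have bd: "cmod (B z) \<le> (\<Prod>w\<in>A. r ^ m w) * max_modulus f r" if z: "cmod z = r" for z
  proof -
    have "cmod (of_real (r\<^sup>2) - cnj w * z) = r * cmod (z - w)" for w
    proof -
      have "of_real (r\<^sup>2) - cnj w * z = z * cnj (z - w)"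
        using z complex_norm_square[of z] by (simp add: algebra_simps)
      then show ?thesis using z by (simp add: norm_mult flip: complex_cnj_diff)
    qed
    then have "cmod (B z) = (\<Prod>w\<in>A. r ^ m w) * cmod (f z)"
      by (simp add: B_def g(2) norm_mult norm_power prod_norm[symmetric] power_mult_distrib prod.distrib mult_ac)
    also have "\<dots> \<le> (\<Prod>w\<in>A. r ^ m w) * max_modulus f r"
      using r z f by (intro mult_left_mono max_modulus_upper prod_nonneg holomorphic_on_imp_continuous_on) auto
    finally show ?thesis .
  qed
  have "cmod (B 0) \<le> (\<Prod>w\<in>A. r ^ m w) * max_modulus f r"
    using maximum_modulus_frontier[of B "cball 0 r", OF holB holomorphic_on_imp_continuous_on[OF holB], where \<xi> = 0] bd r
    by simp
  then have "(\<Prod>w\<in>A. r ^ m w) * ((\<Prod>w\<in>A. r ^ m w) * cmod (g 0)) \<le> (\<Prod>w\<in>A. r ^ m w) * max_modulus f r"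
    using r by (simp add: B_def norm_mult prod_norm[symmetric] norm_power power2_eq_square power_mult_distrib prod.distrib mult.assoc)
  moreover have pos: "(\<Prod>w\<in>A. r ^ m w) > 0" using r by (intro prod_pos) auto
  ultimately have "(\<Prod>w\<in>A. r ^ m w) * cmod (g 0) \<le> max_modulus f r" by simp
  moreover have "cmod (f 0) * (\<Prod>w\<in>A. (r / cmod w) ^ m w) = (\<Prod>w\<in>A. r ^ m w) * cmod (g 0)"
  proof -
    have "(\<Prod>w\<in>A. cmod w ^ m w) \<noteq> 0" using A by (subst prod_zero_iff) auto
    then show ?thesis
      by (simp add: g(2) norm_mult prod_norm[symmetric] norm_power power_divide prod_dividef)
  qed
  ultimately show ?thesis by simp
qed

text \<open>\<open>f\<close> may vanish at 0 although \<open>Z 0 = 0\<close>, so Jensen's inequality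
  is applied to the quotient g of f by z^k, with k the order of this zero. On circles of radius r
  \<ge> 1 the quotient is not larger than f, and c = |g 0| works.\<close>

lemma max_modulus_lower_bound:
  assumes fin: "\<And>r. r \<ge> 0 \<Longrightarrow> radial_count Z r < \<infinity>" and Z0: "Z 0 = 0"
    and f: "f holomorphic_on UNIV" and nz: "\<exists>z. f z \<noteq> 0" and van: "vanishes_on f Z"
  obtains c where "c > 0"
    "\<And>r. r \<ge> 1 \<Longrightarrow> ennreal c \<le> ennreal (max_modulus f r) / exp_ennreal (radial_integral_count Z r)"
proof -
  define k where "k = nat (zorder f 0)"
  obtain r0 where r0: "r0 > 0" "zor_poly f 0 holomorphic_on cball 0 r0"
     "\<And>z. z \<in> cball 0 r0 \<Longrightarrow> f z = zor_poly f 0 z * z ^ k \<and> zor_poly f 0 z \<noteq> 0"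
    using zorder_exist_zero[OF f open_UNIV connected_UNIV, where z = 0] nz unfolding k_def diff_0_right by blast
  have "has_zero f 0 k"
  proof -
    have "isCont (zor_poly f 0) 0"
      by (rule holomorphic_on_imp_isCont[OF r0(2)]) (use r0(1) in simp)
    moreover have "has_zero (\<lambda>z. z ^ k) 0 k" by (simp add: has_zero_def)
    ultimately have "has_zero (\<lambda>z. zor_poly f 0 z * z ^ k) 0 (0 + k)"
      by (intro has_zero_mult has_zero_0)
    moreover have "\<forall>\<^sub>F z in nhds 0. f z = zor_poly f 0 z * z ^ k"
      using eventually_nhds_in_open[of "ball 0 r0" 0] r0(1) by (auto elim!: eventually_mono intro!: r0(3)[THEN conjunct1])
    ultimately show ?thesis by (simp add: has_zero_cong)
  qed
  then obtain g where g: "g holomorphic_on UNIV" "\<And>z. f z = z ^ k * g z"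
    using has_zero_factor[OF f open_UNIV UNIV_I, of 0 k] unfolding diff_0_right by blast
  have g0: "g 0 \<noteq> 0"
  proof -
    have ev: "\<forall>\<^sub>F z in at 0. z \<in> ball 0 r0 - {0}" using r0(1) eventually_at_in_open[of "ball 0 r0" 0] by auto
    have "\<forall>\<^sub>F z in at 0. g z = zor_poly f 0 z"
      using ev
    proof eventually_elim
      case (elim z)
      then show ?case using r0(3)[of z] g(2)[of z] by auto
    qed
    moreover have "isCont (zor_poly f 0) 0"
      by (rule holomorphic_on_imp_isCont[OF r0(2)]) (use r0(1) in simp)
    ultimately have "(g \<longlongrightarrow> zor_poly f 0 0) (at 0)" by (simp add: isCont_def tendsto_cong)
    moreover have "(g \<longlongrightarrow> g 0) (at 0)" by (rule isContD[OF holomorphic_on_imp_isCont[OF g(1)]]) simp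
    ultimately have "g 0 = zor_poly f 0 0" using LIM_unique by blast
    then show ?thesis using r0(1) r0(3)[of 0] by auto
  qed
  have gz: "has_zero g w (the_enat (Z w))" if "w \<noteq> 0" for w
  proof (rule has_zero_divide)
    have "Z w \<noteq> \<infinity>" using local_support_facts(2)[OF fin[of "cmod w"], of w] by auto
    then have "enat (the_enat (Z w)) \<le> zero_mult f w" using van by (cases "Z w") (auto simp: vanishes_on_def dest: spec[of _ w])
    then show "has_zero (\<lambda>z. z ^ k * g z) w (the_enat (Z w))"
      using zero_mult_ge_iff[OF f nz] unfolding g(2)[symmetric] by simp
  qed (use that in auto)
  show thesis
  proof (rule that)
    show "cmod (g 0) > 0" using g0 by simp
    fix r :: real assume r: "r \<ge> 1"
    let ?A = "local_support Z r"
    have A: "finite ?A" "?A \<subseteq> cball 0 r - {0}"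
      using local_support_facts(1)[OF fin] r Z0 by (auto simp: local_support_def)
    define N where "N = (\<Sum>w\<in>?A. real (the_enat (Z w)) * ln (r / cmod w))"
    have N: "radial_integral_count Z r = ennreal N"
    proof -
      have "(\<Sum>w\<in>?A. real (the_enat (Z w)) * ln (max (cmod w) r / cmod w)) = N"
        unfolding N_def
      proof (intro sum.cong refl)
        fix w assume "w \<in> ?A"
        then have "max (cmod w) r = r" using A(2) by auto
        then show "real (the_enat (Z w)) * ln (max (cmod w) r / cmod w) = real (the_enat (Z w)) * ln (r / cmod w)"
          by simp
      qed
      then show ?thesis using radial_integral_count_eq[of Z r r] fin[of r] r Z0 by simp
    qed
    have "1 \<le> r / cmod w" if "w \<in> ?A" for w
    proof -
      have "0 < cmod w" "cmod w \<le> r" using that A(2) by auto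
      then show ?thesis by simp
    qed
    then have "N \<ge> 0" unfolding N_def by (intro sum_nonneg mult_nonneg_nonneg ln_ge_zero) auto
    have "exp N = (\<Prod>w\<in>?A. exp (real (the_enat (Z w)) * ln (r / cmod w)))"
      unfolding N_def by (rule exp_sum[OF A(1)])
    also have "\<dots> = (\<Prod>w\<in>?A. (r / cmod w) ^ the_enat (Z w))"
    proof (intro prod.cong refl)
      fix w assume "w \<in> ?A"
      then have "w \<noteq> 0" using A(2) by blast
      then have "0 < r / cmod w" using r by simp
      then show "exp (real (the_enat (Z w)) * ln (r / cmod w)) = (r / cmod w) ^ the_enat (Z w)"
        by (simp add: exp_of_nat_mult)
    qed
    finally have expN: "exp N = (\<Prod>w\<in>?A. (r / cmod w) ^ the_enat (Z w))" .
    have "has_zero g w (the_enat (Z w))" if "w \<in> ?A" for w using gz that A(2) by blast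
    then have "cmod (g 0) * exp N \<le> max_modulus g r"
      unfolding expN using r by (intro jensen_max_modulus[OF g(1) A]) auto
    also have "max_modulus g r \<le> max_modulus f r"
    proof (rule max_modulus_least)
      fix z assume z: "cmod z = r"
      have "1 * cmod (g z) \<le> cmod (z ^ k) * cmod (g z)"
        using z r by (intro mult_right_mono) (auto simp: norm_power)
      also have "\<dots> = cmod (f z)" by (simp add: g(2) norm_mult)
      also have "\<dots> \<le> max_modulus f r" using f z by (intro max_modulus_upper holomorphic_on_imp_continuous_on)
      finally show "cmod (g z) \<le> max_modulus f r" by simp
    qed (use r in auto)
    finally have le: "cmod (g 0) * exp N \<le> max_modulus f r" .
    have "ennreal (cmod (g 0)) = ennreal (cmod (g 0) * exp N) / ennreal (exp N)"
      by (subst divide_ennreal) auto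
    also have "\<dots> \<le> ennreal (max_modulus f r) / ennreal (exp N)"
      using le by (intro divide_right_mono_ennreal ennreal_leI)
    also have "ennreal (exp N) = exp_ennreal (radial_integral_count Z r)"
      using \<open>N \<ge> 0\<close> by (simp add: N exp_ennreal_def)
    finally show "ennreal (cmod (g 0)) \<le> ennreal (max_modulus f r) / exp_ennreal (radial_integral_count Z r)" .
  qed
qed

section \<open>Cauchy integrals along a segment\<close>

text \<open>If (t - \<zeta>) / (a - \<zeta>) were some x \<le> 0, then \<zeta> = (t - x a) / (1 - x)
  would be a convex combination of t and a and lie on the segment. So the principal logarithm of
  this quotient is an antiderivative along the whole segment, with value 0 at t = a.\<close>

lemma integral_inverse_diff:
  fixes a b :: real and \<zeta> :: complex
  assumes ab: "a \<le> b" and \<zeta>: "\<zeta> \<notin> complex_of_real ` {a..b}"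
  shows "((\<lambda>t. 1 / (of_real t - \<zeta>)) has_integral Ln ((of_real b - \<zeta>) / (of_real a - \<zeta>))) {a..b}"
proof -
  have nz: "of_real t - \<zeta> \<noteq> 0" if "t \<in> {a..b}" for t using that \<zeta> by auto
  let ?F = "\<lambda>t. Ln ((of_real t - \<zeta>) / (of_real a - \<zeta>))"
  have "((\<lambda>t. 1 / (of_real t - \<zeta>)) has_integral (?F b - ?F a)) {a..b}"
  proof (rule fundamental_theorem_of_calculus[OF ab])
    fix t assume t: "t \<in> {a..b}"
    have "(of_real t - \<zeta>) / (of_real a - \<zeta>) \<notin> \<real>\<^sub>\<le>\<^sub>0"
    proof
      assume "(of_real t - \<zeta>) / (of_real a - \<zeta>) \<in> \<real>\<^sub>\<le>\<^sub>0"
      then obtain x where x: "x \<le> 0" "(of_real t - \<zeta>) / (of_real a - \<zeta>) = of_real x"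
        by (auto simp: nonpos_Reals_def)
      then have "of_real t - \<zeta> = of_real x * (of_real a - \<zeta>)"
        using nz[of a] ab by (simp add: field_simps)
      then have "\<zeta> * of_real (1 - x) = of_real (t - x * a)" by (simp add: algebra_simps)
      then have "\<zeta> = of_real ((t - x * a) / (1 - x))" using x(1)
        by (metis (no_types, opaque_lifting) diff_gt_0_iff_gt less_le_trans nonzero_eq_divide_eq of_real_divide of_real_eq_0_iff zero_less_one order_less_irrefl le_less_trans)
      moreover have "(t - x * a) / (1 - x) \<in> {a..b}"
      proof -
        have "x * b \<le> x * a" using x(1) ab by (simp add: mult_left_mono_neg)
        then show ?thesis using x(1) t by (auto simp: field_simps)
      qed
      ultimately show False using \<zeta> by blast
    qed
    then show "(?F has_vector_derivative 1 / (of_real t - \<zeta>)) (at t within {a..b})"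
      using nz[OF t] nz[of a] ab
      by (auto intro!: derivative_eq_intros has_vector_derivative_real_field simp: divide_simps)
  qed
  moreover have "?F a = 0" using nz[of a] ab by simp
  ultimately show ?thesis by simp
qed

text \<open>Split M(t) into M(t) - M(\<zeta>) and M(\<zeta>). The difference quotient is the mean of
  M' over the segment from \<zeta> to t, so its integral over t is holomorphic in \<zeta> even
  across the path, and the whole singularity sits in the logarithm. Convexity of U keeps these
  segments in U.\<close>

lemma cauchy_integral_segment:
  assumes M: "M holomorphic_on U" and U: "open U" "convex U"
    and ab: "a \<le> b" "complex_of_real ` {a..b} \<subseteq> U"
  obtains \<Phi> where "\<Phi> holomorphic_on U"
    "\<And>\<zeta>. \<zeta> \<in> U \<Longrightarrow> \<zeta> \<notin> complex_of_real ` {a..b} \<Longrightarrow>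
      ((\<lambda>t. M (of_real t) / (of_real t - \<zeta>)) has_integral
        \<Phi> \<zeta> + M \<zeta> * Ln ((of_real b - \<zeta>) / (of_real a - \<zeta>))) {a..b}"
proof -
  let ?B = "cbox (a, 0::real) (b, 1::real)"
  define g where "g = (\<lambda>\<zeta> x. \<zeta> + of_real (snd x) * (of_real (fst x) - \<zeta>) :: complex)"
  define f where "f = (\<lambda>\<zeta> (x :: real \<times> real). deriv M (g \<zeta> x))"
  define f' where "f' = (\<lambda>\<zeta> (x :: real \<times> real). deriv (deriv M) (g \<zeta> x) * (1 - of_real (snd x)))"
  have gU: "g \<zeta> x \<in> U" if "\<zeta> \<in> U" "x \<in> ?B" for \<zeta> x
  proof -
    have x: "fst x \<in> {a..b}" "snd x \<in> {0..1}" using that(2) by (auto simp: cbox_Pair_eq)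
    then have "of_real (fst x) \<in> U" using ab by auto
    moreover have "g \<zeta> x = (1 - snd x) *\<^sub>R \<zeta> + snd x *\<^sub>R of_real (fst x)"
      by (simp add: g_def scaleR_conv_of_real algebra_simps)
    ultimately show ?thesis using convexD_alt[OF U(2) that(1)] x(2) by auto
  qed
  have M': "deriv M holomorphic_on U" "deriv (deriv M) holomorphic_on U"
    using M U(1) by (auto intro: holomorphic_deriv)
  have contf: "continuous_on ?B (f \<zeta>)" if "\<zeta> \<in> U" for \<zeta>
    unfolding f_def
    by (rule continuous_on_compose2[OF holomorphic_on_imp_continuous_on[OF M'(1)]])
       (use gU[OF that] in \<open>auto simp: g_def intro!: continuous_intros\<close>)
  define \<Phi> where "\<Phi> = (\<lambda>\<zeta>. integral ?B (f \<zeta>))"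
  have "\<Phi> holomorphic_on U"
    unfolding \<Phi>_def
  proof (rule leibniz_rule_holomorphic[OF _ _ _ U(2)])
    fix \<zeta> x assume *: "\<zeta> \<in> U" "x \<in> ?B"
    have "(deriv M has_field_derivative deriv (deriv M) (g \<zeta> x)) (at (g \<zeta> x))"
      using M'(1) gU[OF *] U(1) holomorphic_derivI by blast
    moreover have "((\<lambda>\<zeta>. g \<zeta> x) has_field_derivative (1 - of_real (snd x))) (at \<zeta> within U)"
      unfolding g_def by (auto intro!: derivative_eq_intros)
    ultimately show "((\<lambda>\<zeta>. f \<zeta> x) has_field_derivative f' \<zeta> x) (at \<zeta> within U)"
      unfolding f_def f'_def by (rule DERIV_chain2)
  next
    show "f \<zeta> integrable_on ?B" if "\<zeta> \<in> U" for \<zeta> using contf[OF that] by (rule integrable_continuous)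
    have "continuous_on (U \<times> ?B) (\<lambda>y. deriv (deriv M) (g (fst y) (snd y)))"
      by (rule continuous_on_compose2[OF holomorphic_on_imp_continuous_on[OF M'(2)]])
         (use gU in \<open>auto simp: g_def intro!: continuous_intros\<close>)
    then show "continuous_on (U \<times> ?B) (\<lambda>(\<zeta>, x). f' \<zeta> x)"
      unfolding f'_def case_prod_unfold by (intro continuous_intros)
  qed
  moreover have "((\<lambda>t. M (of_real t) / (of_real t - \<zeta>)) has_integral
        \<Phi> \<zeta> + M \<zeta> * Ln ((of_real b - \<zeta>) / (of_real a - \<zeta>))) {a..b}"
    if \<zeta>: "\<zeta> \<in> U" "\<zeta> \<notin> complex_of_real ` {a..b}" for \<zeta>
  proof -
    have nz: "of_real t - \<zeta> \<noteq> 0" if "t \<in> {a..b}" for t using that \<zeta> by auto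
    have inner: "integral (cbox 0 1) (\<lambda>s. f \<zeta> (t, s)) = (M (of_real t) - M \<zeta>) / (of_real t - \<zeta>)"
      if t: "t \<in> {a..b}" for t
    proof -
      have "((\<lambda>s. deriv M (g \<zeta> (t, s)) * (of_real t - \<zeta>)) has_integral M (g \<zeta> (t, 1)) - M (g \<zeta> (t, 0))) {0..1}"
      proof (rule fundamental_theorem_of_calculus)
        fix s :: real assume s: "s \<in> {0..1}"
        have "(M has_field_derivative deriv M (g \<zeta> (t, s))) (at (g \<zeta> (t, s)))"
          using M gU[OF \<zeta>(1), of "(t, s)"] s t U(1) holomorphic_derivI by (auto simp: cbox_Pair_eq)
        moreover have "((\<lambda>s. g \<zeta> (t, s)) has_vector_derivative (of_real t - \<zeta>)) (at s within {0..1})"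
          unfolding g_def by (auto intro!: derivative_eq_intros)
        ultimately show "((\<lambda>s. M (g \<zeta> (t, s))) has_vector_derivative deriv M (g \<zeta> (t, s)) * (of_real t - \<zeta>)) (at s within {0..1})"
          using field_vector_diff_chain_within[of "\<lambda>s. g \<zeta> (t, s)" "of_real t - \<zeta>" s "{0..1}" M "deriv M (g \<zeta> (t, s))"]
          by (simp add: o_def mult.commute has_field_derivative_at_within)
      qed simp
      then have "integral {0..1} (\<lambda>s. deriv M (g \<zeta> (t, s)) * (of_real t - \<zeta>)) = M (g \<zeta> (t, 1)) - M (g \<zeta> (t, 0))"
        by (rule integral_unique)
      moreover have "g \<zeta> (t, 1) = of_real t" "g \<zeta> (t, 0) = \<zeta>" by (simp_all add: g_def)
      ultimately have "integral {0..1} (\<lambda>s. deriv M (g \<zeta> (t, s))) * (of_real t - \<zeta>) = M (of_real t) - M \<zeta>"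
        by (simp only: integral_mult_left)
      then show ?thesis using nz[OF t] by (simp add: f_def divide_simps)
    qed
    have cont2: "continuous_on {a..b} (\<lambda>t. (M (of_real t) - M \<zeta>) / (of_real t - \<zeta>))"
    proof -
      have "continuous_on {a..b} (\<lambda>t. M (of_real t))"
        by (rule continuous_on_compose2[OF holomorphic_on_imp_continuous_on[OF M]])
           (use ab in \<open>auto intro!: continuous_intros\<close>)
      then show ?thesis using nz by (intro continuous_intros) auto
    qed
    have "\<Phi> \<zeta> = integral {a..b} (\<lambda>t. integral (cbox 0 1) (\<lambda>s. f \<zeta> (t, s)))"
      unfolding \<Phi>_def using integral_prod_continuous[OF contf[OF \<zeta>(1)]] by simp
    also have "\<dots> = integral {a..b} (\<lambda>t. (M (of_real t) - M \<zeta>) / (of_real t - \<zeta>))"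
      by (intro integral_cong inner)
    finally have "((\<lambda>t. (M (of_real t) - M \<zeta>) / (of_real t - \<zeta>)) has_integral \<Phi> \<zeta>) {a..b}"
      using integrable_integral[OF integrable_continuous_interval[OF cont2]] by simp
    from has_integral_add[OF this has_integral_mult_right[OF integral_inverse_diff[OF ab(1) \<zeta>(2)], of "M \<zeta>"]]
    show ?thesis by (simp add: diff_divide_distrib)
  qed
  ultimately show ?thesis using that by blast
qed

lemma cauchy_kernel_integrable:
  fixes \<mu> :: "real \<Rightarrow> real" and \<zeta> :: complex
  assumes "continuous_on {a..b} \<mu>" "\<zeta> \<notin> complex_of_real ` {a..b}"
  shows "(\<lambda>t. of_real (\<mu> t) * \<zeta> / (of_real t - \<zeta>)) integrable_on {a..b}"
  using assms by (intro integrable_continuous_interval continuous_intros) auto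

text \<open>For \<mu>(t) = m(t)/t the integrand is m(t) (1/(t - \<zeta>) - 1/t): the Cauchy kernel,
  normalised to vanish at \<zeta> = 0.\<close>

lemma cauchy_kernel_holomorphic:
  fixes \<mu> :: "real \<Rightarrow> real"
  assumes \<mu>: "continuous_on {a..b} \<mu>" and U: "open U" "U \<inter> complex_of_real ` {a..b} = {}"
  shows "(\<lambda>\<zeta>. integral {a..b} (\<lambda>t. of_real (\<mu> t) * \<zeta> / (of_real t - \<zeta>))) holomorphic_on U"
proof -
  have nz: "of_real t - \<zeta> \<noteq> 0" if "t \<in> {a..b}" "\<zeta> \<in> U" for t \<zeta> using that U by auto
  have "(\<lambda>\<zeta>. integral (cbox a b) (\<lambda>t. of_real (\<mu> t) * \<zeta> / (of_real t - \<zeta>))) holomorphic_on ball z e"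
    if sub: "ball z e \<subseteq> U" for z e
  proof (rule leibniz_rule_holomorphic[where
        fx = "\<lambda>\<zeta> t. of_real (\<mu> t) * of_real t / (of_real t - \<zeta>)\<^sup>2"])
    fix \<zeta> t assume "\<zeta> \<in> ball z e" "t \<in> cbox a b"
    then have "\<zeta> \<in> U" "t \<in> {a..b}" using sub by auto
    then have "of_real t - \<zeta> \<noteq> 0" by (intro nz)
    then show "((\<lambda>\<zeta>. of_real (\<mu> t) * \<zeta> / (of_real t - \<zeta>)) has_field_derivative
        of_real (\<mu> t) * of_real t / (of_real t - \<zeta>)\<^sup>2) (at \<zeta> within ball z e)"
      by (auto intro!: derivative_eq_intros simp: divide_simps power2_eq_square algebra_simps)
  next
    fix \<zeta> assume "\<zeta> \<in> ball z e"
    then have "\<zeta> \<in> U" using sub by blast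
    then have "of_real t - \<zeta> \<noteq> 0" if "t \<in> cbox a b" for t using nz[of t \<zeta>] that by simp
    then show "(\<lambda>t. of_real (\<mu> t) * \<zeta> / (of_real t - \<zeta>)) integrable_on cbox a b"
      using \<mu> by (intro integrable_continuous continuous_intros) auto
  next
    have "continuous_on (ball z e \<times> cbox a b) (\<lambda>x. \<mu> (snd x))"
      by (rule continuous_on_compose2[OF \<mu>]) (auto intro!: continuous_intros)
    then show "continuous_on (ball z e \<times> cbox a b) (\<lambda>(\<zeta>, t). of_real (\<mu> t) * of_real t / (of_real t - \<zeta>)\<^sup>2)"
      unfolding case_prod_unfold
    proof (intro continuous_intros ballI)
      fix x assume "x \<in> ball z e \<times> cbox a b"
      then have "fst x \<in> U" "snd x \<in> {a..b}" using sub by auto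
      then show "(of_real (snd x) - fst x)\<^sup>2 \<noteq> 0" using nz by simp
    qed
  qed simp
  then have "(\<lambda>\<zeta>. integral (cbox a b) (\<lambda>t. of_real (\<mu> t) * \<zeta> / (of_real t - \<zeta>))) analytic_on U"
    unfolding analytic_on_def using U(1) open_contains_ball by blast
  then show ?thesis by (simp add: analytic_imp_holomorphic)
qed

text \<open>The step from Ln w to Ln (- w) isolates the jump. The logarithm that remains is analytic
  across the open segment, since (b - t) / (t - a) is positive there.\<close>

lemma Ln_quotient_off_segment:
  assumes "Im \<zeta> \<noteq> 0" "a < b"
  shows "Ln ((of_real b - \<zeta>) / (of_real a - \<zeta>)) =
    Ln ((of_real b - \<zeta>) / (\<zeta> - of_real a)) + (if Im \<zeta> > 0 then \<i> * pi else - \<i> * pi)"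
proof -
  define w where "w = (of_real b - \<zeta>) / (\<zeta> - of_real a)"
  have nz: "\<zeta> - of_real a \<noteq> 0" using assms(1) by (auto simp: complex_eq_iff)
  have e: "w = -1 + of_real (b - a) / (\<zeta> - of_real a)" using nz by (simp add: w_def field_simps)
  have Im0: "Im w = - ((b - a) * Im \<zeta> / (cmod (\<zeta> - of_real a))\<^sup>2)"
    unfolding e by (simp add: Im_divide cmod_power2)
  have Im: "Im w < 0 \<longleftrightarrow> Im \<zeta> > 0" "Im w \<noteq> 0"
  proof -
    define c where "c = (b - a) / (cmod (\<zeta> - of_real a))\<^sup>2"
    have "c > 0" using assms nz by (simp add: c_def)
    moreover have "Im w = - (c * Im \<zeta>)" using Im0 by (simp add: c_def)
    ultimately show "Im w < 0 \<longleftrightarrow> Im \<zeta> > 0" "Im w \<noteq> 0"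
      using assms(1) by (auto simp: zero_less_mult_iff)
  qed
  then have "Ln (- w) = Ln w + (if Im \<zeta> > 0 then \<i> * pi else - \<i> * pi)"
    by (subst Ln_minus) auto
  moreover have "(of_real b - \<zeta>) / (of_real a - \<zeta>) = - w"
    unfolding w_def by (metis minus_diff_eq minus_divide_right)
  ultimately show ?thesis by (simp add: w_def)
qed

lemma Ln_quotient_analytic:
  assumes "a < t" "t < b"
  shows "(\<lambda>\<zeta>. Ln ((of_real b - \<zeta>) / (\<zeta> - of_real a))) analytic_on {of_real t}"
proof -
  have "(of_real b - of_real t) / (of_real t - of_real a) = complex_of_real ((b - t) / (t - a))" by simp
  moreover have "(b - t) / (t - a) > 0" using assms by simp
  ultimately have "(of_real b - of_real t) / (of_real t - of_real a) \<notin> (\<real>\<^sub>\<le>\<^sub>0 :: complex set)"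
    by (metis complex_nonpos_Reals_iff Re_complex_of_real not_le)
  then show ?thesis using assms by (auto intro!: analytic_intros)
qed

text \<open>Plemelj's jump formula for an analytic density. Only the part of the integral over a
  short interval around t is singular near t, and there the density m(s)/s is the restriction of
  M(s)/s; the factor \<zeta> of the kernel cancels the denominator. The two sides differ by 2 \<pi>
  \<i> M.\<close>

lemma cauchy_integral_local:
  fixes m :: "real \<Rightarrow> real"
  assumes T: "0 < t" "t < T" and \<mu>: "continuous_on {0..T} (\<lambda>s. m s / s)"
    and M: "M analytic_on {of_real t}" "\<And>s. 0 < s \<Longrightarrow> s < T \<Longrightarrow> M (of_real s) = of_real (m s)"
  obtains \<rho> \<Psi> where "\<rho> > 0" "\<Psi> holomorphic_on ball (of_real t) \<rho>"
    "\<And>\<zeta>. \<zeta> \<in> ball (of_real t) \<rho> \<Longrightarrow> Im \<zeta> \<noteq> 0 \<Longrightarrow>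
      integral {0..T} (\<lambda>s. of_real (m s / s) * \<zeta> / (of_real s - \<zeta>)) =
      \<Psi> \<zeta> + (if Im \<zeta> > 0 then \<i> * pi else - \<i> * pi) * M \<zeta>"
proof -
  from M(1) obtain e1 where e1: "e1 > 0" "M holomorphic_on ball (of_real t) e1"
    by (auto simp: analytic_on_def)
  \<comment> \<open>The bounds t/2 and (T - t)/2 keep the disc in the right half plane and the
    interval [a, b] inside (0, T).\<close>
  define e where "e = min e1 (min (t / 2) ((T - t) / 2))"
  have e: "e > 0" "e \<le> e1" "e \<le> t / 2" "e \<le> (T - t) / 2"
  proof -
    show "e > 0" using e1(1) T by (simp add: e_def)
    show "e \<le> e1" unfolding e_def by (rule min.cobounded1)
    show "e \<le> t / 2" unfolding e_def by (rule min.coboundedI2[OF min.cobounded1])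
    show "e \<le> (T - t) / 2" unfolding e_def by (rule min.coboundedI2[OF min.cobounded2])
  qed
  define a b where "a = t - e / 2" and "b = t + e / 2"
  have ab: "0 < a" "a < t" "t < b" "b < T" using e T by (auto simp: a_def b_def)
  let ?U = "ball (complex_of_real t) e"
  have "?U \<subseteq> ball (of_real t) e1" using e(2) by auto
  then have holM: "M holomorphic_on ?U" using e1(2) holomorphic_on_subset by blast
  have zU: "Re \<zeta> > 0" if "\<zeta> \<in> ?U" for \<zeta>
  proof -
    have "\<bar>t - Re \<zeta>\<bar> \<le> cmod (of_real t - \<zeta>)" using abs_Re_le_cmod[of "of_real t - \<zeta>"] by simp
    then show ?thesis using that e T by (auto simp: dist_norm)
  qed
  have h1: "(\<lambda>\<zeta>. M \<zeta> / \<zeta>) holomorphic_on ?U"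
    using zU by (intro holomorphic_intros holM) force
  have h2: "complex_of_real ` {a..b} \<subseteq> ?U"
    using e(1) by (auto simp: a_def b_def dist_of_real dist_norm abs_if simp flip: of_real_diff)
  have h3: "a \<le> b" using ab by simp
  obtain \<Phi> where \<Phi>: "\<Phi> holomorphic_on ?U"
    "\<And>\<zeta>. \<zeta> \<in> ?U \<Longrightarrow> \<zeta> \<notin> complex_of_real ` {a..b} \<Longrightarrow>
      ((\<lambda>s. (M (of_real s) / of_real s) / (of_real s - \<zeta>)) has_integral
        \<Phi> \<zeta> + M \<zeta> / \<zeta> * Ln ((of_real b - \<zeta>) / (of_real a - \<zeta>))) {a..b}"
    using cauchy_integral_segment[OF h1 open_ball convex_ball h3 h2] by blast
  let ?k = "\<lambda>(\<zeta>::complex) s. of_real (m s / s) * \<zeta> / (of_real s - \<zeta>)"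
  define \<Omega> where "\<Omega> = (\<lambda>\<zeta>. integral {0..a} (?k \<zeta>) + integral {b..T} (?k \<zeta>))"
  let ?V = "ball (complex_of_real t) (e / 2)"
  have reV: "a < Re \<zeta> \<and> Re \<zeta> < b" if "\<zeta> \<in> ?V" for \<zeta>
  proof -
    have "\<bar>t - Re \<zeta>\<bar> \<le> cmod (of_real t - \<zeta>)" using abs_Re_le_cmod[of "of_real t - \<zeta>"] by simp
    then show ?thesis using that by (auto simp: dist_norm a_def b_def)
  qed
  have "\<Omega> holomorphic_on ?V"
    unfolding \<Omega>_def
    using ab reV by (intro holomorphic_intros cauchy_kernel_holomorphic continuous_on_subset[OF \<mu>]) fastforce+
  moreover have "(\<lambda>\<zeta>. Ln ((of_real b - \<zeta>) / (\<zeta> - of_real a))) analytic_on {of_real t}"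
    using ab by (intro Ln_quotient_analytic) auto
  then obtain e2 where e2: "e2 > 0" "(\<lambda>\<zeta>. Ln ((of_real b - \<zeta>) / (\<zeta> - of_real a))) holomorphic_on ball (of_real t) e2"
    by (auto simp: analytic_on_def)
  define \<rho> where "\<rho> = min e2 (e / 2)"
  have sub: "ball (of_real t) \<rho> \<subseteq> ?V" "ball (of_real t) \<rho> \<subseteq> ball (complex_of_real t) e2"
    "ball (of_real t) \<rho> \<subseteq> ?U" using e(1) by (auto simp: \<rho>_def)
  define \<Psi> where "\<Psi> = (\<lambda>\<zeta>. \<Omega> \<zeta> + \<zeta> * \<Phi> \<zeta> + M \<zeta> * Ln ((of_real b - \<zeta>) / (\<zeta> - of_real a)))"
  show thesis
  proof (rule that)
    show "\<rho> > 0" using e2 e by (simp add: \<rho>_def)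
    show "\<Psi> holomorphic_on ball (of_real t) \<rho>"
      unfolding \<Psi>_def
      by (intro holomorphic_intros holomorphic_on_subset[OF \<open>\<Omega> holomorphic_on ?V\<close> sub(1)]
          holomorphic_on_subset[OF \<Phi>(1) sub(3)] holomorphic_on_subset[OF e2(2) sub(2)]
          holomorphic_on_subset[OF holM sub(3)])
    fix \<zeta> assume \<zeta>: "\<zeta> \<in> ball (of_real t) \<rho>" "Im \<zeta> \<noteq> 0"
    have \<zeta>U: "\<zeta> \<in> ?U" using \<zeta> sub by blast
    have \<zeta>r: "\<zeta> \<notin> complex_of_real ` S" for S using \<zeta>(2) by auto
    have nz: "of_real s - \<zeta> \<noteq> 0" for s using \<zeta>r[of UNIV] by auto
    have int: "?k \<zeta> integrable_on {c..d}" if "0 \<le> c" "d \<le> T" for c d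
      using that by (intro cauchy_kernel_integrable continuous_on_subset[OF \<mu>] \<zeta>r) auto
    have mid: "integral {a..b} (?k \<zeta>) = \<zeta> * (\<Phi> \<zeta> + M \<zeta> / \<zeta> * Ln ((of_real b - \<zeta>) / (of_real a - \<zeta>)))"
    proof -
      have "((\<lambda>s. \<zeta> * ((M (of_real s) / of_real s) / (of_real s - \<zeta>))) has_integral
        \<zeta> * (\<Phi> \<zeta> + M \<zeta> / \<zeta> * Ln ((of_real b - \<zeta>) / (of_real a - \<zeta>)))) {a..b}"
        using \<Phi>(2)[OF \<zeta>U \<zeta>r] by (rule has_integral_mult_right)
      then have "(?k \<zeta> has_integral \<zeta> * (\<Phi> \<zeta> + M \<zeta> / \<zeta> * Ln ((of_real b - \<zeta>) / (of_real a - \<zeta>)))) {a..b}"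
        by (rule has_integral_eq[rotated]) (use ab M(2) in \<open>simp add: mult_ac\<close>)
      then show ?thesis by (rule integral_unique)
    qed
    have "integral {0..T} (?k \<zeta>) = integral {0..a} (?k \<zeta>) + integral {a..b} (?k \<zeta>) + integral {b..T} (?k \<zeta>)"
      using Henstock_Kurzweil_Integration.integral_combine[of 0 b T "?k \<zeta>"]
        Henstock_Kurzweil_Integration.integral_combine[of 0 a b "?k \<zeta>"] int[of 0 T] int[of 0 b] ab
      by auto
    also have "\<dots> = \<Omega> \<zeta> + \<zeta> * \<Phi> \<zeta> + M \<zeta> * Ln ((of_real b - \<zeta>) / (of_real a - \<zeta>))"
      using zU[OF \<zeta>U] unfolding mid \<Omega>_def by (auto simp: algebra_simps)
    also have "\<dots> = \<Psi> \<zeta> + (if Im \<zeta> > 0 then \<i> * pi else - \<i> * pi) * M \<zeta>"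
      using Ln_quotient_off_segment[OF \<zeta>(2), of a b] ab by (simp add: \<Psi>_def algebra_simps)
    finally show "integral {0..T} (?k \<zeta>) = \<Psi> \<zeta> + (if Im \<zeta> > 0 then \<i> * pi else - \<i> * pi) * M \<zeta>" .
  qed
qed

section \<open>The gluing factor on a segment\<close>

text \<open>The points are chosen by the intermediate value theorem with m (\<tau> i) = i. As
  \<open>m\<close> may be constant on intervals, the chosen point can lie beyond t although m t = i;
  the count is then m t - 1, so the upper bound 1 can be attained.\<close>

lemma unit_mass_points:
  fixes m :: "real \<Rightarrow> real"
  assumes T: "T > 0" and mono: "mono_on {0..T} m" and cont: "continuous_on {0..T} m" and m0: "m 0 = 0"
  obtains \<tau> L where "\<And>i. i \<in> {1..L} \<Longrightarrow> 0 < \<tau> i \<and> \<tau> i \<le> T"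
    "\<And>t. t \<in> {0..T} \<Longrightarrow> 0 \<le> m t - (\<Sum>i\<in>{1..L::nat}. if \<tau> i \<le> t then 1 else 0) \<and>
      m t - (\<Sum>i\<in>{1..L}. if \<tau> i \<le> t then 1 else 0) \<le> 1"
proof -
  define L where "L = nat \<lfloor>m T\<rfloor>"
  have "0 \<le> m T" using mono_onD[OF mono, of 0 T] T m0 by simp
  then have L: "i \<in> {1..L} \<longleftrightarrow> 1 \<le> i \<and> real i \<le> m T" for i by (auto simp: L_def le_nat_floor le_nat_iff le_floor_iff)
  have "\<exists>t. 0 \<le> t \<and> t \<le> T \<and> m t = real i" if "i \<in> {1..L}" for i
    using that L m0 T by (intro IVT' cont) auto
  then obtain \<tau> where \<tau>: "\<And>i. i \<in> {1..L} \<Longrightarrow> 0 \<le> \<tau> i \<and> \<tau> i \<le> T \<and> m (\<tau> i) = real i" by metis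
  show thesis
  proof (rule that)
    show "0 < \<tau> i \<and> \<tau> i \<le> T" if "i \<in> {1..L}" for i
      using \<tau>[OF that] that m0 by (cases "\<tau> i = 0") auto
    fix t assume t: "t \<in> {0..T}"
    define S where "S = {i \<in> {1..L}. \<tau> i \<le> t}"
    have "m 0 \<le> m t" "m t \<le> m T" using t T by (auto intro!: mono_onD[OF mono])
    then have "m t \<ge> 0" using m0 by simp
    have card: "(\<Sum>i\<in>{1..L}. if \<tau> i \<le> t then 1 else 0) = real (card S)"
      unfolding S_def using sum.inter_filter[of "{1..L}" "\<lambda>_. 1::real" "\<lambda>i. \<tau> i \<le> t"] by simp
    have "S \<subseteq> {1..nat \<lfloor>m t\<rfloor>}"
    proof
      fix i assume i: "i \<in> S"
      then have "m (\<tau> i) \<le> m t" using \<tau>[of i] t by (intro mono_onD[OF mono]) (auto simp: S_def)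
      then show "i \<in> {1..nat \<lfloor>m t\<rfloor>}" using i \<tau>[of i] by (auto simp: S_def le_nat_floor)
    qed
    then have "card S \<le> card {1..nat \<lfloor>m t\<rfloor>}" by (intro card_mono) auto
    then have 1: "real (card S) \<le> m t" using \<open>m t \<ge> 0\<close> by simp linarith
    \<comment> \<open>These are the indices with i < m t strictly, for which monotonicity forces
      \<tau> i \<le> t.\<close>
    have "{1..nat (\<lceil>m t\<rceil> - 1)} \<subseteq> S"
    proof
      fix i assume i: "i \<in> {1..nat (\<lceil>m t\<rceil> - 1)}"
      have less: "real i < m t"
      proof -
        have "int i < \<lceil>m t\<rceil>" using i by auto
        then show ?thesis by linarith
      qed
      have iL: "i \<in> {1..L}" unfolding L using less i \<open>m t \<le> m T\<close> by simp
      have "\<tau> i \<le> t"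
      proof (rule ccontr)
        assume "\<not> \<tau> i \<le> t"
        then have "m t \<le> m (\<tau> i)" using \<tau>[OF iL] t by (intro mono_onD[OF mono]) auto
        then show False using \<tau>[OF iL] less by simp
      qed
      then show "i \<in> S" using iL by (simp add: S_def)
    qed
    then have "card {1..nat (\<lceil>m t\<rceil> - 1)} \<le> card S" by (intro card_mono) (auto simp: S_def)
    then have 2: "m t - 1 \<le> real (card S)" by simp linarith
    show "0 \<le> m t - (\<Sum>i\<in>{1..L}. if \<tau> i \<le> t then 1 else 0) \<and>
      m t - (\<Sum>i\<in>{1..L}. if \<tau> i \<le> t then 1 else 0) \<le> 1"
      unfolding card using 1 2 by simp
  qed
qed

text \<open>Ln (1 - \<zeta>/s) is an antiderivative in s, and its argument is never real because Im
  \<zeta> \<noteq> 0.\<close>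

lemma has_integral_Re_kernel:
  fixes \<zeta> :: complex
  assumes "Im \<zeta> \<noteq> 0" "0 < c" "c \<le> d"
  shows "((\<lambda>s. Re (\<zeta> / (of_real s * (of_real s - \<zeta>)))) has_integral
    (ln (cmod (1 - \<zeta> / of_real d)) - ln (cmod (1 - \<zeta> / of_real c)))) {c..d}"
proof -
  have "((\<lambda>s. \<zeta> / (of_real s * (of_real s - \<zeta>))) has_integral
     (Ln (1 - \<zeta> / of_real d) - Ln (1 - \<zeta> / of_real c))) {c..d}"
  proof (rule fundamental_theorem_of_calculus[OF assms(3)])
    fix s assume s: "s \<in> {c..d}"
    have s0: "s > 0" using s assms by auto
    have nz: "of_real s - \<zeta> \<noteq> 0" using assms(1) by (auto simp: complex_eq_iff)
    have "1 - \<zeta> / of_real s \<notin> \<real>\<^sub>\<le>\<^sub>0"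
      using s0 assms(1) by (auto simp: complex_nonpos_Reals_iff Im_divide_of_real)
    moreover have "((\<lambda>z. 1 - \<zeta> / z) has_field_derivative \<zeta> / (of_real s)\<^sup>2) (at (of_real s))"
      unfolding divide_inverse using s0 by (auto intro!: derivative_eq_intros simp: power2_eq_square)
    ultimately have "((\<lambda>z. Ln (1 - \<zeta> / z)) has_field_derivative inverse (1 - \<zeta> / of_real s) * (\<zeta> / (of_real s)\<^sup>2)) (at (of_real s))"
      by (intro DERIV_chain2[OF has_field_derivative_Ln])
    also have "inverse (1 - \<zeta> / of_real s) * (\<zeta> / (of_real s)\<^sup>2) = \<zeta> / (of_real s * (of_real s - \<zeta>))"
      using s0 nz by (simp add: divide_simps power2_eq_square)
    finally have "((\<lambda>z. Ln (1 - \<zeta> / z)) has_field_derivative \<zeta> / (of_real s * (of_real s - \<zeta>))) (at (of_real s))" .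
    then show "((\<lambda>s. Ln (1 - \<zeta> / of_real s)) has_vector_derivative \<zeta> / (of_real s * (of_real s - \<zeta>))) (at s within {c..d})"
      by (rule has_vector_derivative_real_field)
  qed
  from has_integral_Re[OF this] show ?thesis
    using assms by (auto simp: complex_eq_iff Im_divide_of_real)
qed

lemma kernel_sign:
  fixes \<zeta> :: complex
  assumes "Im \<zeta> \<noteq> 0" "0 < s"
  shows "Re (\<zeta> / (of_real s * (of_real s - \<zeta>))) = (s * Re \<zeta> - (cmod \<zeta>)\<^sup>2) / (s * (cmod (of_real s - \<zeta>))\<^sup>2)"
proof -
  have nz: "of_real s - \<zeta> \<noteq> 0" using assms(1) by (auto simp: complex_eq_iff)
  have "\<zeta> / (of_real s * (of_real s - \<zeta>)) = \<zeta> * cnj (of_real s - \<zeta>) / of_real (s * (cmod (of_real s - \<zeta>))\<^sup>2)"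
    unfolding of_real_mult complex_norm_square using nz assms(2) by (simp del: complex_cnj_diff)
  moreover have "Re (\<zeta> * cnj (of_real s - \<zeta>)) = s * Re \<zeta> - (cmod \<zeta>)\<^sup>2"
    unfolding cmod_power2 by (simp add: power2_eq_square algebra_simps)
  ultimately show ?thesis by (simp only: Re_divide_of_real)
qed

text \<open>
  Only the part where the kernel is positive counts; the kernel is the derivative of
  \<open>ln (cmod (1 - \<zeta> / s))\<close> with respect to \<open>s\<close>.
\<close>
lemma kernel_integral_bound:
  fixes \<zeta> :: complex
  assumes \<zeta>: "Im \<zeta> \<noteq> 0" and T: "0 < T"
    and D: "\<And>t. t \<in> {0..T} \<Longrightarrow> 0 \<le> D t \<and> D t \<le> 1"
    and int: "((\<lambda>s. D s * Re (\<zeta> / (of_real s * (of_real s - \<zeta>)))) has_integral J) {0..T}"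
  shows "J \<le> ln (cmod \<zeta> / \<bar>Im \<zeta>\<bar>)"
proof -
  let ?K = "\<lambda>s. Re (\<zeta> / (of_real s * (of_real s - \<zeta>)))"
  have z0: "\<zeta> \<noteq> 0" using \<zeta> by auto
  have B: "0 \<le> ln (cmod \<zeta> / \<bar>Im \<zeta>\<bar>)"
    using \<zeta> abs_Im_le_cmod[of \<zeta>] by (intro ln_ge_zero) (simp add: divide_simps)
  \<comment> \<open>For Re \<zeta> > 0 the kernel turns from negative to positive at
    \<open>s0\<close>. This is also where |1 - \<zeta>/s| is smallest on the positive axis, with
    value |Im \<zeta>| / |\<zeta>|. For Re \<zeta> \<le> 0 the kernel is nowhere positive.\<close>
  define s0 where "s0 = (cmod \<zeta>)\<^sup>2 / Re \<zeta>"
  have den: "0 \<le> s * (cmod (of_real s - \<zeta>))\<^sup>2" if "0 < s" for s using that by simp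
  show ?thesis
  proof (cases "Re \<zeta> > 0 \<and> s0 < T")
    case False
    have "?K s \<le> 0" if "s \<in> {0..T}" for s
    proof (cases "s = 0")
      case False
      then have s: "0 < s" using that by simp
      have "s * Re \<zeta> \<le> (cmod \<zeta>)\<^sup>2"
      proof (cases "Re \<zeta> > 0")
        case True
        then have "T \<le> s0" using \<open>\<not> (Re \<zeta> > 0 \<and> s0 < T)\<close> by simp
        then have "s \<le> s0" using that by simp
        then show ?thesis using True by (simp add: s0_def field_simps)
      next
        case False
        then have "s * Re \<zeta> \<le> 0" using s by (simp add: mult_le_0_iff)
        then show ?thesis by (smt (verit) zero_le_power2)
      qed
      then show ?thesis unfolding kernel_sign[OF \<zeta> s] using den[OF s] by (intro divide_nonpos_nonneg) auto
    qed auto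
    then have "J \<le> 0"
      using D by (intro has_integral_le[OF int has_integral_0]) (simp add: mult_nonneg_nonpos)
    then show ?thesis using B by simp
  next
    case True
    have s0: "s0 > 0" using True z0 by (simp add: s0_def)
    let ?F = "\<lambda>s. ln (cmod (1 - \<zeta> / of_real s))"
    have "(?K has_integral (?F T - ?F s0)) {s0..T}"
      using has_integral_Re_kernel[OF \<zeta> s0] True by simp
    then have K: "((\<lambda>s. if s \<in> {s0..T} then ?K s else 0) has_integral (?F T - ?F s0)) {0..T}"
      using s0 by (subst has_integral_restrict) auto
    have "J \<le> ?F T - ?F s0"
    proof (rule has_integral_le[OF int K])
      fix s assume s: "s \<in> {0..T}"
      show "D s * ?K s \<le> (if s \<in> {s0..T} then ?K s else 0)"
      proof (cases "s0 \<le> s")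
        case True
        then have sp: "0 < s" using s0 by simp
        have "(cmod \<zeta>)\<^sup>2 \<le> s * Re \<zeta>"
          using True \<open>Re \<zeta> > 0 \<and> s0 < T\<close> by (simp add: s0_def field_simps)
        then have "0 \<le> ?K s" unfolding kernel_sign[OF \<zeta> sp] using den[OF sp] by simp
        then have "D s * ?K s \<le> 1 * ?K s" using D[OF s] by (intro mult_right_mono) auto
        then show ?thesis using True s by simp
      next
        case False
        have "?K s \<le> 0"
        proof (cases "s = 0")
          case False
          then have sp: "0 < s" using s by simp
          have "s * Re \<zeta> \<le> (cmod \<zeta>)\<^sup>2"
            using \<open>\<not> s0 \<le> s\<close> \<open>Re \<zeta> > 0 \<and> s0 < T\<close> by (simp add: s0_def field_simps)
          then show ?thesis unfolding kernel_sign[OF \<zeta> sp] using den[OF sp] by (intro divide_nonpos_nonneg) auto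
        qed auto
        then show ?thesis using False D[OF s] by (simp add: mult_nonneg_nonpos)
      qed
    qed
    \<comment> \<open>s0 < T places \<zeta> in the disc with centre T and radius T.\<close>
    also have "?F T \<le> 0"
    proof -
      have "(cmod \<zeta>)\<^sup>2 \<le> 2 * (T * Re \<zeta>)"
      proof -
        have "(cmod \<zeta>)\<^sup>2 \<le> T * Re \<zeta>" using True by (auto simp: s0_def pos_divide_less_eq)
        moreover have "0 \<le> T * Re \<zeta>" using T True by simp
        ultimately show ?thesis by simp
      qed
      then have "(cmod (of_real T - \<zeta>))\<^sup>2 \<le> T\<^sup>2"
        unfolding cmod_power2 by (simp add: power2_eq_square algebra_simps)
      then have "cmod (of_real T - \<zeta>) \<le> T" using T by (simp add: power2_le_iff_abs_le)
      moreover have "1 - \<zeta> / of_real T = (of_real T - \<zeta>) / of_real T" using T by (simp add: field_simps)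
      ultimately have "cmod (1 - \<zeta> / of_real T) \<le> 1" using T by (simp add: norm_divide)
      moreover have "0 < cmod (1 - \<zeta> / of_real T)"
        using T \<zeta> by (auto simp: complex_eq_iff Im_divide_of_real)
      ultimately show ?thesis by simp
    qed
    also have "0 - ?F s0 = ln (cmod \<zeta> / \<bar>Im \<zeta>\<bar>)"
    proof -
      have c: "(cmod \<zeta>)\<^sup>2 \<noteq> 0" using z0 by simp
      have "1 - \<zeta> / of_real s0 = (of_real ((cmod \<zeta>)\<^sup>2) - \<zeta> * of_real (Re \<zeta>)) / of_real ((cmod \<zeta>)\<^sup>2)"
        using c True by (simp add: s0_def divide_simps)
      also have "of_real ((cmod \<zeta>)\<^sup>2) - \<zeta> * of_real (Re \<zeta>) = \<zeta> * (- \<i> * of_real (Im \<zeta>))"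
        unfolding cmod_power2 by (simp add: complex_eq_iff power2_eq_square)
      finally have "cmod (1 - \<zeta> / of_real s0) = cmod \<zeta> * \<bar>Im \<zeta>\<bar> / (cmod \<zeta>)\<^sup>2"
        by (simp add: norm_divide norm_mult norm_power)
      also have "\<dots> = \<bar>Im \<zeta>\<bar> / cmod \<zeta>" using z0 by (simp add: power2_eq_square)
      finally show ?thesis using \<zeta> z0 by (simp add: ln_div)
    qed
    finally show ?thesis by simp
  qed
qed

text \<open>
  \<open>E\<close> is the exponential of the Cauchy integral of \<open>m - \<lfloor>m\<rfloor>\<close> over \<open>[0, T]\<close>; the part coming from the
  step function \<open>\<lfloor>m\<rfloor>\<close> is a rational function with zeros at the points where \<open>m\<close> takes integer values.
\<close>
lemma glue_factor:
  fixes m :: "real \<Rightarrow> real"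
  assumes T: "T > 0" and mono: "mono_on {0..T} m" and cont: "continuous_on {0..T} m" and m0: "m 0 = 0"
    and \<mu>: "continuous_on {0..T} (\<lambda>s. m s / s)"
    and Man: "\<And>t. 0 < t \<Longrightarrow> t < T \<Longrightarrow> M analytic_on {of_real t}"
    and Mm: "\<And>t. 0 < t \<Longrightarrow> t < T \<Longrightarrow> M (of_real t) = of_real (m t)"
  obtains E where "E holomorphic_on - complex_of_real ` {0..T}"
    "\<And>\<zeta>. Im \<zeta> \<noteq> 0 \<Longrightarrow> cmod (E \<zeta>) * \<bar>Im \<zeta>\<bar> \<le> cmod \<zeta>"
    "\<And>t. 0 < t \<Longrightarrow> t < T \<Longrightarrow> \<exists>\<rho>>0. \<exists>\<Psi>. \<Psi> holomorphic_on ball (of_real t) \<rho> \<and>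
      (\<forall>\<zeta>\<in>ball (of_real t) \<rho>. Im \<zeta> \<noteq> 0 \<longrightarrow>
        E \<zeta> = \<Psi> \<zeta> * exp ((if Im \<zeta> > 0 then \<i> * pi else - \<i> * pi) * M \<zeta>))"
    "\<And>u. u \<notin> \<real>\<^sub>\<ge>\<^sub>0 \<Longrightarrow> (\<lambda>n. E (of_real (inverse (real (Suc n))) * u)) \<longlonglongrightarrow> 1"
proof -
  obtain \<tau> L where \<tau>: "\<And>i. i \<in> {1..L} \<Longrightarrow> 0 < \<tau> i \<and> \<tau> i \<le> T"
    and D: "\<And>t. t \<in> {0..T} \<Longrightarrow> 0 \<le> m t - (\<Sum>i\<in>{1..L::nat}. if \<tau> i \<le> t then 1 else 0) \<and>
      m t - (\<Sum>i\<in>{1..L}. if \<tau> i \<le> t then 1 else 0) \<le> 1"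
    using unit_mass_points[OF T mono cont m0] by metis
  define k :: "complex \<Rightarrow> real \<Rightarrow> complex" where "k = (\<lambda>\<zeta> s. of_real (m s / s) * \<zeta> / (of_real s - \<zeta>))"
  define I where "I = (\<lambda>\<zeta>. integral {0..T} (k \<zeta>))"
  \<comment> \<open>A unit step at \<tau> i adds Ln (1 - \<zeta>/T) - Ln (1 - \<zeta>/\<tau> i) to
    the integral. Removing all these terms from the exponent amounts to multiplication by this
    rational function; its only possible pole is T, the end of the segment.\<close>
  define R :: "complex \<Rightarrow> complex" where "R = (\<lambda>\<zeta>. \<Prod>i\<in>{1..L}. (1 - \<zeta> / of_real (\<tau> i)) / (1 - \<zeta> / of_real T))"
  define E where "E = (\<lambda>\<zeta>. exp (I \<zeta>) * R \<zeta>)"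
  have holI: "I holomorphic_on - complex_of_real ` {0..T}"
    unfolding I_def k_def
  proof (rule cauchy_kernel_holomorphic[OF \<mu>])
    show "open (- complex_of_real ` {0..T})"
      by (intro open_Compl compact_imp_closed compact_continuous_image continuous_intros) auto
  qed auto
  have holR: "R holomorphic_on - {of_real T}"
    unfolding R_def using \<tau> T by (intro holomorphic_intros) (auto simp: divide_simps)
  have intk: "k \<zeta> integrable_on {0..T}" if "\<zeta> \<notin> complex_of_real ` {0..T}" for \<zeta>
    unfolding k_def using that by (intro cauchy_kernel_integrable \<mu>)
  show thesis
  proof (rule that)
    show "E holomorphic_on - complex_of_real ` {0..T}"
      unfolding E_def using T
      by (intro holomorphic_intros holI holomorphic_on_subset[OF holR]) auto
  next
    fix \<zeta> assume \<zeta>: "Im \<zeta> \<noteq> 0"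
    then have z0: "\<zeta> \<noteq> 0" by auto
    let ?K = "\<lambda>s. Re (\<zeta> / (of_real s * (of_real s - \<zeta>)))"
    let ?F = "\<lambda>s. ln (cmod (1 - \<zeta> / of_real s))"
    have pos: "cmod (1 - \<zeta> / of_real s) > 0" if "s > 0" for s
      using that \<zeta> by (auto simp: complex_eq_iff Im_divide_of_real)
    have "(k \<zeta> has_integral I \<zeta>) {0..T}"
      unfolding I_def using \<zeta> by (intro integrable_integral intk) auto
    from has_integral_Re[OF this]
    have ReI: "((\<lambda>s. m s * ?K s) has_integral Re (I \<zeta>)) {0..T}"
    proof (rule has_integral_eq[rotated])
      fix s assume "s \<in> {0..T}"
      have "k \<zeta> s = of_real (m s) * (\<zeta> / (of_real s * (of_real s - \<zeta>)))" by (simp add: k_def)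
      then show "Re (k \<zeta> s) = m s * ?K s" by (simp only: Re_complex_of_real Im_complex_of_real times_complex.sel)
    qed
    have "((\<lambda>s. if s \<in> {\<tau> i..T} then ?K s else 0) has_integral (?F T - ?F (\<tau> i))) {0..T}" if "i \<in> {1..L}" for i
      using has_integral_Re_kernel[OF \<zeta>, of "\<tau> i" T] \<tau>[OF that] by (subst has_integral_restrict) auto
    then have "((\<lambda>s. \<Sum>i\<in>{1..L}. if s \<in> {\<tau> i..T} then ?K s else 0) has_integral (\<Sum>i\<in>{1..L}. ?F T - ?F (\<tau> i))) {0..T}"
      by (intro has_integral_sum) auto
    from has_integral_diff[OF ReI this]
    have "((\<lambda>s. (m s - (\<Sum>i\<in>{1..L}. if \<tau> i \<le> s then 1 else 0)) * ?K s) has_integral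
        Re (I \<zeta>) - (\<Sum>i\<in>{1..L}. ?F T - ?F (\<tau> i))) {0..T}"
    proof (rule has_integral_eq[rotated])
      fix s assume s: "s \<in> {0..T}"
      have "(\<Sum>i\<in>{1..L}. if s \<in> {\<tau> i..T} then ?K s else 0) = (\<Sum>i\<in>{1..L}. if \<tau> i \<le> s then 1 else 0) * ?K s"
        unfolding sum_distrib_right using s by (intro sum.cong) auto
      then show "m s * ?K s - (\<Sum>i\<in>{1..L}. if s \<in> {\<tau> i..T} then ?K s else 0) =
        (m s - (\<Sum>i\<in>{1..L}. if \<tau> i \<le> s then 1 else 0)) * ?K s" by (simp only: left_diff_distrib)
    qed
    then have le: "Re (I \<zeta>) - (\<Sum>i\<in>{1..L}. ?F T - ?F (\<tau> i)) \<le> ln (cmod \<zeta> / \<bar>Im \<zeta>\<bar>)"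
      using D by (intro kernel_integral_bound[OF \<zeta> T]) auto
    have "cmod (R \<zeta>) = (\<Prod>i\<in>{1..L}. exp (?F (\<tau> i) - ?F T))"
      unfolding R_def prod_norm[symmetric] norm_divide
      using pos T \<tau> by (intro prod.cong refl) (simp add: exp_diff)
    also have "\<dots> = exp (- (\<Sum>i\<in>{1..L}. ?F T - ?F (\<tau> i)))"
      by (simp add: exp_sum flip: sum_negf)
    finally have "cmod (E \<zeta>) = exp (Re (I \<zeta>) - (\<Sum>i\<in>{1..L}. ?F T - ?F (\<tau> i)))"
      by (simp add: E_def norm_mult norm_exp_eq_Re exp_diff exp_minus divide_inverse)
    also have "\<dots> \<le> exp (ln (cmod \<zeta> / \<bar>Im \<zeta>\<bar>))" using le by simp
    also have "\<dots> = cmod \<zeta> / \<bar>Im \<zeta>\<bar>" using \<zeta> z0 by simp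
    finally show "cmod (E \<zeta>) * \<bar>Im \<zeta>\<bar> \<le> cmod \<zeta>" using \<zeta> by (simp add: field_simps)
  next
    fix t assume t: "0 < t" "t < T"
    obtain \<rho> \<Psi> where \<rho>: "\<rho> > 0" and \<Psi>: "\<Psi> holomorphic_on ball (of_real t) \<rho>"
      "\<And>\<zeta>. \<zeta> \<in> ball (of_real t) \<rho> \<Longrightarrow> Im \<zeta> \<noteq> 0 \<Longrightarrow>
        I \<zeta> = \<Psi> \<zeta> + (if Im \<zeta> > 0 then \<i> * pi else - \<i> * pi) * M \<zeta>"
      using cauchy_integral_local[OF t \<mu> Man[OF t] Mm] unfolding I_def k_def by blast
    \<comment> \<open>The smaller disc avoids T, where \<open>R\<close> may have a pole.\<close>
    define \<rho>' where "\<rho>' = min \<rho> (T - t)"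
    have sub: "ball (complex_of_real t) \<rho>' \<subseteq> ball (of_real t) \<rho>" by (auto simp: \<rho>'_def)
    have "dist (of_real t) (complex_of_real T) = T - t" using t by (simp add: dist_of_real dist_real_def)
    then have T': "of_real T \<notin> ball (complex_of_real t) \<rho>'" by (simp add: \<rho>'_def)
    show "\<exists>\<rho>>0. \<exists>\<Psi>. \<Psi> holomorphic_on ball (of_real t) \<rho> \<and>
      (\<forall>\<zeta>\<in>ball (of_real t) \<rho>. Im \<zeta> \<noteq> 0 \<longrightarrow>
        E \<zeta> = \<Psi> \<zeta> * exp ((if Im \<zeta> > 0 then \<i> * pi else - \<i> * pi) * M \<zeta>))"
    proof (intro exI conjI ballI impI)
      show "\<rho>' > 0" using \<rho> t by (simp add: \<rho>'_def)
      show "(\<lambda>\<zeta>. exp (\<Psi> \<zeta>) * R \<zeta>) holomorphic_on ball (of_real t) \<rho>'"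
        using T' by (intro holomorphic_intros holomorphic_on_subset[OF \<Psi>(1) sub] holomorphic_on_subset[OF holR]) auto
      fix \<zeta> assume "\<zeta> \<in> ball (of_real t) \<rho>'" "Im \<zeta> \<noteq> 0"
      then have "I \<zeta> = \<Psi> \<zeta> + (if Im \<zeta> > 0 then \<i> * pi else - \<i> * pi) * M \<zeta>" using \<Psi>(2) sub by blast
      then show "E \<zeta> = exp (\<Psi> \<zeta>) * R \<zeta> * exp ((if Im \<zeta> > 0 then \<i> * pi else - \<i> * pi) * M \<zeta>)"
        by (simp only: E_def exp_add mult_ac)
    qed
  next
    fix u :: complex assume u: "u \<notin> \<real>\<^sub>\<ge>\<^sub>0"
    define a where "a = (\<lambda>n. inverse (real (Suc n)))"
    have a: "a n > 0" for n by (simp add: a_def)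
    have alim: "a \<longlonglongrightarrow> 0" unfolding a_def by (rule LIMSEQ_inverse_real_of_nat)
    have zlim: "(\<lambda>n. of_real (a n) * u) \<longlonglongrightarrow> 0"
      using tendsto_mult_left[OF tendsto_of_real[OF alim], of u] by (simp add: mult.commute)
    have notin: "of_real (a n) * u \<notin> complex_of_real ` {0..}" for n
    proof
      assume "of_real (a n) * u \<in> complex_of_real ` {0..}"
      then obtain x where "x \<ge> 0" "of_real (a n) * u = of_real x" by auto
      then have "u = of_real (x / a n)" using a[of n] by (simp add: field_simps)
      moreover have "x / a n \<ge> 0" using \<open>x \<ge> 0\<close> a[of n] by simp
      ultimately show False using u by (auto simp: nonneg_Reals_def)
    qed
    \<comment> \<open>By scaling, |s - a n * u| = a n |s / a n - u| \<ge> a n * d for s \<ge> 0. The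
      factor a n in the numerator of the kernel cancels, and a constant dominates the
      integrands.\<close>
    obtain d where d: "d > 0" "\<And>x. x \<ge> 0 \<Longrightarrow> d \<le> cmod (of_real x - u)"
    proof -
      have "closed (\<real>\<^sub>\<ge>\<^sub>0 :: complex set)" by (rule closed_nonneg_Reals_complex)
      then obtain d where "d > 0" "\<And>x. x \<in> (\<real>\<^sub>\<ge>\<^sub>0 :: complex set) \<Longrightarrow> d \<le> dist u x"
        using separate_point_closed[OF _ u] by blast
      moreover have "of_real x \<in> (\<real>\<^sub>\<ge>\<^sub>0 :: complex set)" if "x \<ge> 0" for x
        using that by (simp add: complex_nonneg_Reals_iff)
      ultimately show thesis by (intro that[of d]) (auto simp: dist_norm norm_minus_commute[of u])
    qed
    obtain B where B: "B > 0" "\<And>s. s \<in> {0..T} \<Longrightarrow> \<bar>m s / s\<bar> \<le> B"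
    proof -
      have "bounded ((\<lambda>s. m s / s) ` {0..T})"
        using \<mu> by (intro compact_imp_bounded compact_continuous_image) auto
      then show thesis using that by (auto simp: bounded_pos)
    qed
    have "(\<lambda>n. I (of_real (a n) * u)) \<longlonglongrightarrow> integral {0..T} (\<lambda>_. 0)"
      unfolding I_def
    proof (rule dominated_convergence(2))
      fix n
      show "k (of_real (a n) * u) integrable_on {0..T}" using notin[of n] by (intro intk) auto
      show "(\<lambda>_. B * cmod u / d) integrable_on {0..T}" by (rule integrable_const_ivl)
      fix s assume s: "s \<in> {0..T}"
      have "cmod (of_real s - of_real (a n) * u) = a n * cmod (of_real (s / a n) - u)"
      proof -
        have "of_real s - of_real (a n) * u = of_real (a n) * (of_real (s / a n) - u)"
          using a[of n] by (simp add: field_simps)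
        then show ?thesis using a[of n] by (simp add: norm_mult)
      qed
      also have "\<dots> \<ge> a n * d" using a[of n] s by (intro mult_left_mono d) auto
      finally have ge: "a n * d \<le> cmod (of_real s - of_real (a n) * u)" .
      have "cmod (k (of_real (a n) * u) s) = \<bar>m s / s\<bar> * (a n * cmod u) / cmod (of_real s - of_real (a n) * u)"
        using a[of n] by (simp add: k_def norm_mult norm_divide)
      also have "\<dots> \<le> B * (a n * cmod u) / (a n * d)"
        using ge B(2)[OF s] B(1) a[of n] d(1) by (intro frac_le mult_mono) auto
      also have "\<dots> = B * cmod u / d" using a[of n] by simp
      finally show "cmod (k (of_real (a n) * u) s) \<le> B * cmod u / d" .
    next
      fix s assume s: "s \<in> {0..T}"
      show "(\<lambda>n. k (of_real (a n) * u) s) \<longlonglongrightarrow> 0"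
      proof (cases "s = 0")
        case False
        then have "(\<lambda>n. of_real (m s / s) * (of_real (a n) * u) / (of_real s - of_real (a n) * u)) \<longlonglongrightarrow>
          of_real (m s / s) * 0 / (of_real s - 0)"
          by (intro tendsto_intros zlim) auto
        then show ?thesis by (simp add: k_def)
      qed (simp add: k_def)
    qed
    then have I0: "(\<lambda>n. I (of_real (a n) * u)) \<longlonglongrightarrow> 0" by simp
    have "isCont R 0"
      using holR T by (intro continuous_on_interior[OF holomorphic_on_imp_continuous_on[OF holR]])
        (auto simp: interior_open open_Compl)
    then have "(\<lambda>n. R (of_real (a n) * u)) \<longlonglongrightarrow> R 0" using zlim by (rule isCont_tendsto_compose)
    moreover have "R 0 = 1" by (simp add: R_def)
    ultimately have "(\<lambda>n. exp (I (of_real (a n) * u)) * R (of_real (a n) * u)) \<longlonglongrightarrow> exp 0 * 1"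
      using I0 by (intro tendsto_intros) auto
    then show "(\<lambda>n. E (of_real (inverse (real (Suc n))) * u)) \<longlonglongrightarrow> 1"
      by (simp add: E_def a_def)
  qed
qed

section \<open>Gluing along two rays\<close>

lemma one_plus_cis_not_nonpos:
  assumes "0 \<le> \<phi>" "\<phi> < pi" "0 \<le> y"
  shows "1 + of_real y * cis \<phi> \<notin> \<real>\<^sub>\<le>\<^sub>0" "1 + of_real y * cis (- \<phi>) \<notin> \<real>\<^sub>\<le>\<^sub>0"
proof -
  have "1 + y * cos \<phi> > 0" if "y * sin \<phi> = 0"
  proof (cases "\<phi> = 0")
    case False
    then have "sin \<phi> > 0" using assms by (intro sin_gt_zero) auto
    then show ?thesis using that by simp
  qed (use assms in auto)
  then show "1 + of_real y * cis \<phi> \<notin> \<real>\<^sub>\<le>\<^sub>0" "1 + of_real y * cis (- \<phi>) \<notin> \<real>\<^sub>\<le>\<^sub>0"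
    by (auto simp: complex_nonpos_Reals_iff)
qed

text \<open>On a ray the two branches of a factor have this argument and its negative, with y =
  (t/|a|)^p.\<close>

definition sector_arg :: "real \<Rightarrow> real \<Rightarrow> real" where
  "sector_arg \<phi> y = Im (Ln (1 + of_real y * cis \<phi>))"

lemma sector_arg_0 [simp]: "sector_arg \<phi> 0 = 0"
  by (simp add: sector_arg_def)

lemma sector_arg_deriv:
  assumes "0 \<le> \<phi>" "\<phi> < pi" "0 \<le> y"
  shows "(sector_arg \<phi> has_real_derivative sin \<phi> / (cmod (1 + of_real y * cis \<phi>))\<^sup>2) (at y)"
proof -
  define w where "w = 1 + of_real y * cis \<phi>"
  have w: "w \<notin> \<real>\<^sub>\<le>\<^sub>0" unfolding w_def by (rule one_plus_cis_not_nonpos[OF assms])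
  have "((\<lambda>z. Ln (1 + z * cis \<phi>)) has_field_derivative cis \<phi> / w) (at (of_real y))"
    using w by (auto intro!: derivative_eq_intros simp: w_def divide_inverse)
  then have "((\<lambda>y. Ln (1 + of_real y * cis \<phi>)) has_vector_derivative cis \<phi> / w) (at y)"
    by (rule has_vector_derivative_real_field)
  then have "((\<lambda>y. Im (Ln (1 + of_real y * cis \<phi>))) has_vector_derivative Im (cis \<phi> / w)) (at y)"
    by (rule bounded_linear.has_vector_derivative[OF bounded_linear_Im])
  moreover have "Im (cis \<phi> / w) = sin \<phi> / (cmod w)\<^sup>2"
  proof -
    have "Im (cis \<phi> / w) = (sin \<phi> * Re w - cos \<phi> * Im w) / (cmod w)\<^sup>2"
      by (simp add: Im_divide cmod_power2)
    also have "sin \<phi> * Re w - cos \<phi> * Im w = sin \<phi>" by (simp add: w_def algebra_simps)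
    finally show ?thesis .
  qed
  ultimately show ?thesis
    unfolding sector_arg_def has_real_derivative_iff_has_vector_derivative w_def by simp
qed

lemma sector_arg_mono:
  assumes "0 \<le> \<phi>" "\<phi> < pi" "0 \<le> x" "x \<le> y"
  shows "sector_arg \<phi> x \<le> sector_arg \<phi> y"
proof (rule DERIV_nonneg_imp_nondecreasing[OF assms(4)])
  fix z assume "x \<le> z" "z \<le> y"
  then have "(sector_arg \<phi> has_real_derivative sin \<phi> / (cmod (1 + of_real z * cis \<phi>))\<^sup>2) (at z)"
    using assms by (intro sector_arg_deriv) auto
  moreover have "0 \<le> sin \<phi>" using assms by (intro sin_ge_zero) auto
  ultimately show "\<exists>D. (sector_arg \<phi> has_real_derivative D) (at z) \<and> 0 \<le> D" by (meson divide_nonneg_nonneg zero_le_power2)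
qed

text \<open>|1 + y e^(i \<phi>)|^2 = sin^2 \<phi> + (cos \<phi> + y)^2, so the derivative in y is at
  most 1 / sin \<phi>. For \<phi> = 0 the argument vanishes identically.\<close>

lemma sector_arg_linear_bound:
  assumes "0 \<le> \<phi>" "\<phi> < pi"
  obtains C where "C \<ge> 0" "\<And>y. 0 \<le> y \<Longrightarrow> 0 \<le> sector_arg \<phi> y \<and> sector_arg \<phi> y \<le> C * y"
proof (rule that)
  define C where "C = (if \<phi> = 0 then 0 else 1 / sin \<phi>)"
  have s: "sin \<phi> > 0" if "\<phi> \<noteq> 0" using that assms by (intro sin_gt_zero) auto
  show "C \<ge> 0" using s by (auto simp: C_def less_imp_le)
  fix y :: real assume y: "0 \<le> y"
  have "sector_arg \<phi> 0 \<le> sector_arg \<phi> y" using assms y by (intro sector_arg_mono) auto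
  moreover have "sector_arg \<phi> y - C * y \<le> sector_arg \<phi> 0 - C * 0"
  proof (rule DERIV_nonpos_imp_nonincreasing[OF y])
    fix z assume z: "0 \<le> z" "z \<le> y"
    have "((\<lambda>y. sector_arg \<phi> y - C * y) has_real_derivative
        (sin \<phi> / (cmod (1 + of_real z * cis \<phi>))\<^sup>2 - C)) (at z)"
      by (auto intro!: derivative_eq_intros sector_arg_deriv assms z)
    moreover have "sin \<phi> / (cmod (1 + of_real z * cis \<phi>))\<^sup>2 \<le> C"
    proof (cases "\<phi> = 0")
      case False
      have "(sin \<phi>)\<^sup>2 \<le> (sin \<phi>)\<^sup>2 + (cos \<phi> + z)\<^sup>2" by simp
      also have "\<dots> = (cmod (1 + of_real z * cis \<phi>))\<^sup>2"
      proof -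
        have "(cmod (1 + of_real z * cis \<phi>))\<^sup>2 = (1 + z * cos \<phi>)\<^sup>2 + z\<^sup>2 * (1 - (cos \<phi>)\<^sup>2)"
          by (simp add: cmod_power2 power_mult_distrib sin_squared_eq)
        also have "\<dots> = (1 - (cos \<phi>)\<^sup>2) + (cos \<phi> + z)\<^sup>2"
          by (simp add: power2_eq_square algebra_simps)
        finally show ?thesis by (simp add: sin_squared_eq)
      qed
      finally have "sin \<phi> / (cmod (1 + of_real z * cis \<phi>))\<^sup>2 \<le> sin \<phi> / (sin \<phi>)\<^sup>2"
        using s[OF False] by (intro divide_left_mono) (auto simp: zero_less_mult_iff intro!: mult_pos_pos)
      also have "\<dots> = C" using False s[OF False] by (simp add: C_def power2_eq_square)
      finally show ?thesis .
    qed (simp add: C_def)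
    ultimately show "\<exists>D. ((\<lambda>y. sector_arg \<phi> y - C * y) has_real_derivative D) (at z) \<and> D \<le> 0" by force
  qed
  ultimately show "0 \<le> sector_arg \<phi> y \<and> sector_arg \<phi> y \<le> C * y" by simp
qed

lemma sector_arg_continuous:
  assumes "0 \<le> \<phi>" "\<phi> < pi"
  shows "continuous_on {0..} (sector_arg \<phi>)"
  using sector_arg_deriv[OF assms] by (intro continuous_at_imp_continuous_on ballI DERIV_isCont) auto

lemma powr_quotient_continuous:
  assumes "(p::real) > 1" "\<rho> > 0"
  shows "continuous_on {0..} (\<lambda>t. (t / \<rho>) powr p)"
  using assms by (intro continuous_on_powr' continuous_intros) auto

text \<open>Only t = 0 needs care. The linear bound gives O(t^(p - 1)) with p > 1, and the limit 0
  agrees with the value 0 of a division by 0.\<close>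

lemma sector_arg_powr_quotient_continuous:
  assumes \<phi>: "0 \<le> \<phi>" "\<phi> < pi" and p: "(p::real) > 1" and \<rho>: "\<rho> > 0"
  shows "continuous_on {0..} (\<lambda>t. sector_arg \<phi> ((t / \<rho>) powr p) / t)"
proof (subst continuous_on_eq_continuous_within, intro ballI)
  fix x :: real assume x: "x \<in> {0..}"
  have cont: "continuous_on {0..} (\<lambda>t. sector_arg \<phi> ((t / \<rho>) powr p))"
    by (rule continuous_on_compose2[OF sector_arg_continuous[OF \<phi>] powr_quotient_continuous[OF p \<rho>]]) auto
  show "continuous (at x within {0..}) (\<lambda>t. sector_arg \<phi> ((t / \<rho>) powr p) / t)"
  proof (cases "x = 0")
    case False
    then show ?thesis using cont x unfolding continuous_within
      by (intro tendsto_divide tendsto_ident_at) (auto simp: continuous_on_def)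
  next
    case True
    obtain C where C: "C \<ge> 0" "\<And>y. 0 \<le> y \<Longrightarrow> 0 \<le> sector_arg \<phi> y \<and> sector_arg \<phi> y \<le> C * y"
      using sector_arg_linear_bound[OF \<phi>] by blast
    have "((\<lambda>t. sector_arg \<phi> ((t / \<rho>) powr p) / t) \<longlongrightarrow> 0) (at 0 within {0..})"
    proof (rule Lim_null_comparison)
      show "\<forall>\<^sub>F t in at 0 within {0..}. norm (sector_arg \<phi> ((t / \<rho>) powr p) / t) \<le> C / \<rho> powr p * t powr (p - 1)"
        unfolding eventually_at_filter
      proof (intro always_eventually allI impI)
        fix t :: real assume t: "t \<noteq> 0" "t \<in> {0..}"
        then have "norm (sector_arg \<phi> ((t / \<rho>) powr p) / t) = sector_arg \<phi> ((t / \<rho>) powr p) / t"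
          using C(2)[of "(t / \<rho>) powr p"] by simp
        also have "\<dots> \<le> C * (t / \<rho>) powr p / t"
          using t C(2)[of "(t / \<rho>) powr p"] by (intro divide_right_mono) auto
        also have "\<dots> = C / \<rho> powr p * t powr (p - 1)"
          using t \<rho> by (simp add: powr_divide powr_diff)
        finally show "norm (sector_arg \<phi> ((t / \<rho>) powr p) / t) \<le> C / \<rho> powr p * t powr (p - 1)" .
      qed
      have "continuous_on {0..} (\<lambda>t::real. t powr (p - 1))"
        using p by (intro continuous_on_powr' continuous_intros) auto
      then have "((\<lambda>t::real. t powr (p - 1)) \<longlongrightarrow> 0 powr (p - 1)) (at 0 within {0..})"
        unfolding continuous_on_def by (rule bspec) simp
      from tendsto_mult_left[OF this, of "C / \<rho> powr p"]
      show "((\<lambda>t. C / \<rho> powr p * t powr (p - 1)) \<longlongrightarrow> 0) (at 0 within {0..})" using p by simp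
    qed
    then show ?thesis using True by (simp add: continuous_within)
  qed
qed

section \<open>Extension across thin sets and a bound near two lines\<close>

text \<open>Two local extensions agree off \<open>R\<close>, and by continuity on their whole
  overlap, since every point of S is a limit of points outside \<open>R\<close>. Hence the value at
  z can be taken from the extension chosen at z itself.\<close>

lemma holomorphic_extension_across:
  fixes f0 :: "complex \<Rightarrow> complex"
  assumes S: "open S" and R: "\<And>z. z \<in> S \<Longrightarrow> z islimpt - R"
    and loc: "\<And>z. z \<in> S \<Longrightarrow> \<exists>\<rho>>0. \<exists>\<Phi>. \<Phi> holomorphic_on ball z \<rho> \<and> (\<forall>w\<in>ball z \<rho> - R. f0 w = \<Phi> w)"
  obtains f where "f holomorphic_on S" "\<And>z. z \<in> S - R \<Longrightarrow> f z = f0 z"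
proof -
  obtain \<rho> \<Phi> where \<rho>: "\<And>z. z \<in> S \<Longrightarrow> \<rho> z > 0"
    and \<Phi>: "\<And>z. z \<in> S \<Longrightarrow> \<Phi> z holomorphic_on ball z (\<rho> z)"
      "\<And>z w. z \<in> S \<Longrightarrow> w \<in> ball z (\<rho> z) - R \<Longrightarrow> f0 w = \<Phi> z w"
    using loc by metis
  define f where "f = (\<lambda>z. \<Phi> z z)"
  have eq: "f w = \<Phi> z w" if z: "z \<in> S" and w: "w \<in> ball z (\<rho> z)" "w \<in> S" for z w
  proof -
    have F: "at w within - R \<noteq> bot" using R[OF w(2)] by (simp add: trivial_limit_within)
    have "\<forall>\<^sub>F v in nhds w. v \<in> ball z (\<rho> z) \<inter> ball w (\<rho> w)"
      using w \<rho>[OF w(2)] by (intro eventually_nhds_in_open) auto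
    then have ev: "\<forall>\<^sub>F v in at w within - R. \<Phi> z v = \<Phi> w v"
      unfolding eventually_at_filter
    proof eventually_elim
      case (elim v)
      then show ?case using \<Phi>(2)[OF z, of v] \<Phi>(2)[OF w(2), of v] by auto
    qed
    have "isCont (\<Phi> z) w"
      using continuous_on_interior[OF holomorphic_on_imp_continuous_on[OF \<Phi>(1)[OF z]]] w by simp
    then have "(\<Phi> z \<longlongrightarrow> \<Phi> z w) (at w within - R)"
      using continuous_at_imp_continuous_at_within continuous_within by blast
    then have 1: "(\<Phi> w \<longlongrightarrow> \<Phi> z w) (at w within - R)" using ev by (rule Lim_transform_eventually)
    have "isCont (\<Phi> w) w"
      using continuous_on_interior[OF holomorphic_on_imp_continuous_on[OF \<Phi>(1)[OF w(2)]]] \<rho>[OF w(2)] by simp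
    then have "(\<Phi> w \<longlongrightarrow> \<Phi> w w) (at w within - R)"
      using continuous_at_imp_continuous_at_within continuous_within by blast
    then have "\<Phi> z w = \<Phi> w w" by (rule tendsto_unique[OF F 1])
    then show ?thesis by (simp add: f_def)
  qed
  have "f analytic_on S"
    unfolding analytic_on_def
  proof
    fix z assume z: "z \<in> S"
    obtain e where e: "e > 0" "ball z e \<subseteq> S" using S z openE by blast
    define d where "d = min e (\<rho> z)"
    have "\<Phi> z holomorphic_on ball z d" by (rule holomorphic_on_subset[OF \<Phi>(1)[OF z]]) (auto simp: d_def)
    then have "f holomorphic_on ball z d"
      by (rule holomorphic_transform) (use e eq[OF z] in \<open>auto simp: d_def\<close>)
    then show "\<exists>\<epsilon>>0. f holomorphic_on ball z \<epsilon>" using e \<rho>[OF z] by (intro exI[of _ d]) (auto simp: d_def)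
  qed
  moreover have "f z = f0 z" if "z \<in> S - R" for z
    using \<Phi>(2)[of z z] \<rho>[of z] that by (simp add: f_def)
  ultimately show thesis using that analytic_imp_holomorphic by blast
qed

text \<open>
  On the circle \<open>cmod u = \<rho>\<close> one has \<open>cnj u = \<rho>\<^sup>2 / u\<close>, so the distance to a line is the modulus of a
  quadratic polynomial; this trades the singularities along two lines for a factor \<open>\<rho>\<^sup>2\<close>.
\<close>
lemma bound_from_two_lines:
  assumes f: "f holomorphic_on cball z0 \<rho>" and \<rho>: "\<rho> > 0" and v: "cmod v1 = 1" "cmod v2 = 1"
    and bd: "\<And>w. dist z0 w = \<rho> \<Longrightarrow> cmod (f w) * \<bar>Im (w * v1)\<bar> * \<bar>Im (w * v2)\<bar> \<le> B"
  shows "cmod (f z0) \<le> 4 * B / \<rho>\<^sup>2"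
proof -
  define s where "s = (\<lambda>v w. (((w - z0) * v)\<^sup>2 - of_real (\<rho>\<^sup>2) + 2 * \<i> * of_real (Im (z0 * v)) * ((w - z0) * v)) / of_real (2 * \<rho>))"
  have s_circle: "cmod (s v w) = \<bar>Im (w * v)\<bar>" if "cmod v = 1" "dist z0 w = \<rho>" for v w
  proof -
    define x where "x = (w - z0) * v"
    have nx: "cmod x = \<rho>" using that by (simp add: x_def norm_mult dist_norm norm_minus_commute)
    have "of_real (\<rho>\<^sup>2) = x * cnj x" using complex_norm_square[of x] nx by simp
    moreover have "s v w = (x\<^sup>2 - of_real (\<rho>\<^sup>2) + 2 * \<i> * of_real (Im (z0 * v)) * x) / of_real (2 * \<rho>)"
      by (simp only: s_def x_def)
    ultimately have "s v w = x * (x - cnj x + 2 * \<i> * of_real (Im (z0 * v))) / of_real (2 * \<rho>)"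
      by (simp only: power2_eq_square ring_distribs mult_ac)
    moreover define c where "c = Im (w * v)"
    have "x - cnj x + 2 * \<i> * of_real (Im (z0 * v)) = 2 * \<i> * of_real c"
      by (simp add: complex_eq_iff x_def c_def algebra_simps)
    ultimately have "s v w = x * (2 * \<i> * of_real c) / of_real (2 * \<rho>)" by simp
    then have "cmod (s v w) = \<rho> * (2 * \<bar>Im (w * v)\<bar>) / (2 * \<rho>)"
      using \<rho> nx by (simp add: norm_mult norm_divide c_def del: times_complex.sel)
    then show ?thesis using \<rho> by simp
  qed
  \<comment> \<open>Only the constant term of the quadratic polynomial is left at the centre; the
    two factors together give \<rho>^2 / 4.\<close>
  have s_centre: "cmod (s v z0) = \<rho> / 2" for v
    using \<rho> by (simp add: s_def norm_divide norm_mult power2_eq_square flip: of_real_mult)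
  define g where "g = (\<lambda>w. f w * s v1 w * s v2 w)"
  have g: "g holomorphic_on cball z0 \<rho>"
    unfolding g_def s_def using \<rho> by (intro holomorphic_intros f) auto
  have "cmod (g z0) \<le> B"
  proof (rule maximum_modulus_frontier[where f = g and \<xi> = z0])
    show "g holomorphic_on interior (cball z0 \<rho>)"
      using g by (rule holomorphic_on_subset) (rule interior_subset)
    show "continuous_on (closure (cball z0 \<rho>)) g"
      using g by (simp add: holomorphic_on_imp_continuous_on)
    show "cmod (g w) \<le> B" if "w \<in> frontier (cball z0 \<rho>)" for w
      using that bd[of w] s_circle[OF v(1), of w] s_circle[OF v(2), of w] by (simp add: g_def norm_mult)
  qed (use \<rho> in auto)
  then have "cmod (f z0) * \<rho>\<^sup>2 / 4 \<le> B" by (simp add: g_def norm_mult s_centre power2_eq_square)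
  then show ?thesis using \<rho> by (simp add: field_simps)
qed

text \<open>
  Below, \<open>factor_out\<close> and \<open>factor_in\<close> are the two branches of the factor belonging to a point; the
  first one is used outside of the sector of opening \<open>2 h\<close> around the negative real axis. It vanishes
  at the point rotated by \<open>zero_angle\<close>.
\<close>
locale sector_gluing =
  fixes p h :: real and q :: nat
  assumes p: "1 < p" and q: "real q < p" "p < real q + 1" and h: "2 * p * h = pi * (p - real q)"
begin

section \<open>Geometry of the sector and of its two bounding rays\<close>

lemma q_pos: "1 \<le> q"
  using p q by linarith

lemma h_pos: "0 < h"
  using p q h pi_gt_zero zero_less_mult_pos[of "2 * p" h] by simp

text \<open>Keeps the phases p (h - Arg a) below \<pi> for all a with |Arg a| \<le> h.\<close>

lemma two_p_h_less: "2 * p * h < pi"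
  using h q pi_gt_zero mult_strict_left_mono[of "p - real q" 1 pi] by simp

lemma h_less: "h < pi / 2"
proof -
  have "1 * (2 * h) < p * (2 * h)" using p h_pos by (intro mult_strict_right_mono) auto
  also have "\<dots> < pi" using two_p_h_less by (simp add: mult_ac)
  finally show ?thesis by simp
qed

lemma cos_h: "0 < cos h" "cos h < 1"
  using h_pos h_less cos_gt_zero cos_monotone_0_pi[of 0 h] by (auto intro: cos_gt_zero)

definition upper :: complex where "upper = cis (pi - h)"

lemma norm_upper: "cmod upper = 1" by (simp add: upper_def)

lemma upper_eq: "upper = Complex (- cos h) (sin h)"
  by (simp add: upper_def complex_eq_iff)

lemma mult_cnj_upper: "upper * cnj upper = 1"
  using complex_norm_square[of upper] norm_upper by simp

text \<open>The two rays with arguments \<open>\<plusminus> (\<pi> - h)\<close>.\<close>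
definition cut :: "complex set" where "cut = {z. Re z = - cos h * cmod z}"

lemma cut_cases:
  assumes "z \<in> cut"
  shows "z = of_real (cmod z) * upper \<or> z = of_real (cmod z) * cnj upper"
proof -
  have Re: "Re z = - cos h * cmod z" using assms by (simp add: cut_def)
  have "(Im z)\<^sup>2 = (cmod z)\<^sup>2 - (Re z)\<^sup>2" by (simp add: cmod_power2)
  also have "\<dots> = (sin h * cmod z)\<^sup>2"
    unfolding Re by (simp add: power_mult_distrib sin_squared_eq algebra_simps)
  finally have "Im z = sin h * cmod z \<or> Im z = - (sin h * cmod z)" by (simp add: power2_eq_iff)
  then show ?thesis
  proof
    assume Im: "Im z = sin h * cmod z"
    have "z = of_real (cmod z) * upper"
      by (rule complex_eqI) (simp_all add: upper_eq Re Im)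
    then show ?thesis ..
  next
    assume Im: "Im z = - (sin h * cmod z)"
    have "z = of_real (cmod z) * cnj upper"
      by (rule complex_eqI) (simp_all add: upper_eq Re Im)
    then show ?thesis ..
  qed
qed

lemma ray_in_cut:
  assumes "t \<ge> 0"
  shows "of_real t * upper \<in> cut" "of_real t * cnj upper \<in> cut"
  using assms norm_upper by (auto simp: cut_def norm_mult upper_eq)

lemma cnj_in_cut: "cnj z \<in> cut \<longleftrightarrow> z \<in> cut"
  by (simp add: cut_def)

lemma cut_islimpt: "z islimpt - cut"
  unfolding islimpt_approachable
proof (intro allI impI)
  fix e :: real assume e: "e > 0"
  show "\<exists>x'\<in>- cut. x' \<noteq> z \<and> dist x' z < e"
  proof (cases "z \<in> cut")
    case True
    \<comment> \<open>The shift raises Re z by e/2, whereas - cos h |z| rises by at most cos h *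
      e/2, which is less; so the shifted point is off the cut.\<close>
    define w where "w = z + of_real (e / 2)"
    have "cmod z \<le> cmod w + cmod (of_real (e / 2) :: complex)"
      using norm_triangle_ineq4[of w "of_real (e / 2)"] by (simp add: w_def)
    then have "cos h * (cmod z - e / 2) \<le> cos h * cmod w"
      using e cos_h by (intro mult_left_mono) auto
    moreover have "Re w = - cos h * cmod z + e / 2" using True by (simp add: w_def cut_def)
    moreover have "cos h * (e / 2) < e / 2" using e cos_h by simp
    ultimately have "Re w > - cos h * cmod w" by (simp add: algebra_simps)
    then have "w \<in> - cut" by (simp add: cut_def)
    moreover have "w \<noteq> z" "dist w z < e" using e by (auto simp: w_def dist_norm)
    ultimately show ?thesis by blast
  next
    case False
    have "open (- cut)" unfolding cut_def Collect_neg_eq[symmetric] by (intro open_Collect_neq continuous_intros)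
    then obtain d where d: "d > 0" "ball z d \<subseteq> - cut" using False openE by blast
    define w where "w = z + of_real (min (d / 2) (e / 2))"
    have "w \<in> ball z d" "w \<noteq> z" "dist w z < e" using d e by (auto simp: w_def dist_norm)
    then show ?thesis using d by blast
  qed
qed

section \<open>The two branches and the product of the factors\<close>

definition factor_out :: "complex \<Rightarrow> complex \<Rightarrow> complex" where
  "factor_out a z = 1 + (-1) ^ q * exp (of_real p * (Ln z - Ln a))"

definition factor_in :: "complex \<Rightarrow> complex \<Rightarrow> complex" where
  "factor_in a z = 1 + exp (of_real p * (Ln (- z) - Ln (cnj a)))"

definition piecewise_prod :: "'i set \<Rightarrow> ('i \<Rightarrow> complex) \<Rightarrow> complex \<Rightarrow> complex" where
  "piecewise_prod I a z =
    (if Re z > - cos h * cmod z then \<Prod>i\<in>I. factor_out (a i) z else \<Prod>i\<in>I. factor_in (a i) z)"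

lemma norm_exp_Ln_quotient:
  assumes "z \<noteq> 0" "a \<noteq> 0"
  shows "cmod (exp (of_real p * (Ln z - Ln a))) = (cmod z / cmod a) powr p"
  using assms by (simp add: norm_exp_eq_Re powr_def ln_div)

lemma norm_factor_le:
  assumes "z \<noteq> 0" "a \<noteq> 0"
  shows "cmod (factor_out a z) \<le> 1 + (cmod z / cmod a) powr p"
    and "cmod (factor_in a z) \<le> 1 + (cmod z / cmod a) powr p"
proof -
  have "cmod (factor_out a z) \<le> 1 + cmod ((-1) ^ q * exp (of_real p * (Ln z - Ln a)))"
    unfolding factor_out_def by (rule order_trans[OF norm_triangle_ineq]) simp
  then show "cmod (factor_out a z) \<le> 1 + (cmod z / cmod a) powr p"
    using norm_exp_Ln_quotient[OF assms] by (simp add: norm_mult norm_power)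
  have "cmod (factor_in a z) \<le> 1 + cmod (exp (of_real p * (Ln (- z) - Ln (cnj a))))"
    unfolding factor_in_def by (rule order_trans[OF norm_triangle_ineq]) simp
  then show "cmod (factor_in a z) \<le> 1 + (cmod z / cmod a) powr p"
    using norm_exp_Ln_quotient[of "- z" "cnj a"] assms by simp
qed

lemma norm_piecewise_prod_le:
  assumes "z \<noteq> 0" "\<And>i. i \<in> I \<Longrightarrow> a i \<noteq> 0"
  shows "cmod (piecewise_prod I a z) \<le> (\<Prod>i\<in>I. 1 + (cmod z / cmod (a i)) powr p)"
proof -
  have "(\<Prod>i\<in>I. cmod (factor_out (a i) z)) \<le> (\<Prod>i\<in>I. 1 + (cmod z / cmod (a i)) powr p)"
    "(\<Prod>i\<in>I. cmod (factor_in (a i) z)) \<le> (\<Prod>i\<in>I. 1 + (cmod z / cmod (a i)) powr p)"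
    using assms by (auto intro!: prod_mono norm_factor_le)
  then show ?thesis by (simp add: piecewise_prod_def prod_norm)
qed

lemma small_Arg_not_nonpos:
  assumes "\<bar>Arg a\<bar> \<le> h" "a \<noteq> 0"
  shows "a \<notin> \<real>\<^sub>\<le>\<^sub>0"
  using assms h_less pi_gt_zero h_pos Arg_eq_pi[of a] by (auto simp: complex_nonpos_Reals_iff complex_eq_iff)

lemma out_not_nonpos:
  assumes "Re z > - cos h * cmod z"
  shows "z \<notin> \<real>\<^sub>\<le>\<^sub>0"
proof
  assume "z \<in> \<real>\<^sub>\<le>\<^sub>0"
  then have "Re z \<le> 0" "cmod z = - Re z" by (auto simp: complex_nonpos_Reals_iff cmod_eq_Re)
  then have "Re z > Re z * cos h" "Re z \<le> 0" using assms by (auto simp: mult.commute)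
  moreover have "Re z * 1 \<le> Re z * cos h" if "Re z \<le> 0" using that cos_h by (intro mult_left_mono_neg) auto
  ultimately show False by simp
qed

lemma in_not_nonneg:
  assumes "Re z < - cos h * cmod z"
  shows "- z \<notin> \<real>\<^sub>\<le>\<^sub>0"
proof
  assume "- z \<in> \<real>\<^sub>\<le>\<^sub>0"
  then have "Re z \<ge> 0" by (simp add: complex_nonpos_Reals_iff)
  moreover have "- cos h * cmod z \<le> 0" using cos_h by simp
  ultimately show False using assms by simp
qed

lemma cnj_Ln_cnj: "z \<notin> \<real>\<^sub>\<le>\<^sub>0 \<Longrightarrow> cnj (Ln (cnj z)) = Ln z"
  by (metis cnj_Ln complex_cnj_cnj)

text \<open>Reflection in the real axis exchanges the rays and conjugates the points, so only the
  upper ray has to be studied. Off the cut all logarithms involved commute with conjugation.\<close>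

lemma piecewise_prod_cnj:
  assumes "\<And>i. i \<in> I \<Longrightarrow> a i \<noteq> 0 \<and> \<bar>Arg (a i)\<bar> \<le> h" "z \<notin> cut"
  shows "piecewise_prod I a z = cnj (piecewise_prod I (\<lambda>i. cnj (a i)) (cnj z))"
proof (cases "Re z > - cos h * cmod z")
  case True
  have "factor_out (a i) z = cnj (factor_out (cnj (a i)) (cnj z))" if "i \<in> I" for i
    using cnj_Ln_cnj[OF out_not_nonpos[OF True]] cnj_Ln_cnj[OF small_Arg_not_nonpos] assms(1)[OF that]
    by (simp add: factor_out_def exp_cnj)
  then show ?thesis using True by (simp add: piecewise_prod_def)
next
  case False
  then have z: "Re z < - cos h * cmod z" using assms(2) by (simp add: cut_def)
  have "factor_in (a i) z = cnj (factor_in (cnj (a i)) (cnj z))" if "i \<in> I" for i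
    using cnj_Ln_cnj[OF in_not_nonneg[OF z]] cnj_Ln[OF small_Arg_not_nonpos] assms(1)[OF that]
    by (simp add: factor_in_def exp_cnj)
  then show ?thesis using False by (simp add: piecewise_prod_def)
qed

text \<open>In the coordinate \<zeta>, which turns the ray into the positive axis, Ln z = Ln \<zeta>
  + \<i> (\<pi> - h) and Ln (- z) = Ln \<zeta> - \<i> h. The relation between p, q and h, together
  with the sign (-1)^q, turns the constant phases into p (h - Arg a) and its negative.\<close>

lemma factor_near_upper_ray:
  assumes \<zeta>: "\<zeta> \<noteq> 0" "\<bar>Arg \<zeta>\<bar> < h" and a: "a \<noteq> 0" "\<bar>Arg a\<bar> \<le> h"
  shows "factor_out a (\<zeta> * upper) = 1 + exp (of_real p * (Ln \<zeta> - ln (cmod a))) * cis (p * (h - Arg a))"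
    and "factor_in a (\<zeta> * upper) = 1 + exp (of_real p * (Ln \<zeta> - ln (cmod a))) * cis (- (p * (h - Arg a)))"
proof -
  have Lna: "Ln a = of_real (ln (cmod a)) + \<i> * of_real (Arg a)" using a Ln_Arg by auto
  have "a \<notin> \<real>\<^sub>\<le>\<^sub>0" using small_Arg_not_nonpos a by blast
  then have Lnca: "Ln (cnj a) = of_real (ln (cmod a)) - \<i> * of_real (Arg a)"
    using cnj_Ln[of a] by (simp add: Lna)
  have arg: "Im (Ln \<zeta>) = Arg \<zeta>" using \<zeta>(1) by (simp add: Arg_def)
  have u: "upper = exp (\<i> * of_real (pi - h))" by (simp add: upper_def cis_conv_exp)
  have mu: "- upper = exp (- (\<i> * of_real h))"
    by (simp add: upper_def complex_eq_iff cis_conv_exp[symmetric] Re_exp Im_exp)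
  have "Ln (exp (Ln \<zeta> + \<i> * of_real (pi - h))) = Ln \<zeta> + \<i> * of_real (pi - h)"
    using \<zeta>(2) arg h_less h_pos by (intro Ln_exp) auto
  then have 1: "Ln (\<zeta> * upper) = Ln \<zeta> + \<i> * of_real (pi - h)"
    using \<zeta>(1) by (simp add: exp_add u)
  have "Ln (exp (Ln \<zeta> + - (\<i> * of_real h))) = Ln \<zeta> + - (\<i> * of_real h)"
    using \<zeta>(2) arg h_less h_pos by (intro Ln_exp) auto
  then have 2: "Ln (- (\<zeta> * upper)) = Ln \<zeta> - \<i> * of_real h"
    using \<zeta>(1) unfolding exp_add mu[symmetric] by simp
  have sgn: "(-1) ^ q * cis (p * (pi - h) - p * Arg a) = cis (p * (h - Arg a))"
  proof -
    have "(-1) ^ q = cis (- (real q * pi))"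
      using cis_pi DeMoivre[of pi q] by (simp add: complex_eq_iff)
    then have "(-1) ^ q * cis (p * (pi - h) - p * Arg a) = cis (- (real q * pi) + (p * (pi - h) - p * Arg a))"
      by (simp only: cis_mult)
    also have "- (real q * pi) + (p * (pi - h) - p * Arg a) = p * (h - Arg a)"
      using h by (simp add: algebra_simps)
    finally show ?thesis .
  qed
  have "exp (of_real p * (Ln (\<zeta> * upper) - Ln a)) =
    exp (of_real p * (Ln \<zeta> - ln (cmod a))) * cis (p * (pi - h) - p * Arg a)"
    unfolding 1 Lna cis_conv_exp exp_add[symmetric] by (simp add: algebra_simps)
  then show "factor_out a (\<zeta> * upper) = 1 + exp (of_real p * (Ln \<zeta> - ln (cmod a))) * cis (p * (h - Arg a))"
    by (simp add: factor_out_def sgn[symmetric])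
  have "exp (of_real p * (Ln (- (\<zeta> * upper)) - Ln (cnj a))) =
    exp (of_real p * (Ln \<zeta> - ln (cmod a))) * cis (- (p * (h - Arg a)))"
    unfolding 2 Lnca cis_conv_exp exp_add[symmetric] by (simp add: algebra_simps)
  then show "factor_in a (\<zeta> * upper) = 1 + exp (of_real p * (Ln \<zeta> - ln (cmod a))) * cis (- (p * (h - Arg a)))"
    by (simp add: factor_in_def)
qed

text \<open>Comparing Re z with - cos h |z| means comparing the cosine of the argument with cos
  (\<pi> - h), and the cosine decreases on [0, \<pi>]. The side Im \<zeta> > 0 belongs to the sector
  around the negative axis.\<close>

lemma side_of_upper_ray:
  assumes \<zeta>: "\<zeta> \<noteq> 0" "\<bar>Arg \<zeta>\<bar> < h"
  shows "Re (\<zeta> * upper) > - cos h * cmod (\<zeta> * upper) \<longleftrightarrow> Im \<zeta> < 0"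
    and "\<zeta> * upper \<in> cut \<longleftrightarrow> Im \<zeta> = 0"
proof -
  have "\<zeta> * upper = of_real (cmod \<zeta>) * cis (Arg \<zeta> + (pi - h))"
    using rcis_cmod_Arg[of \<zeta>] by (simp add: rcis_def upper_def flip: cis_mult)
  then have Re: "Re (\<zeta> * upper) = cmod \<zeta> * cos (Arg \<zeta> + (pi - h))" by simp
  have c: "cmod \<zeta> > 0" using \<zeta> by simp
  have mono: "cos (Arg \<zeta> + (pi - h)) > cos (pi - h) \<longleftrightarrow> Arg \<zeta> < 0"
    "cos (Arg \<zeta> + (pi - h)) = cos (pi - h) \<longleftrightarrow> Arg \<zeta> = 0"
  proof -
    have r: "0 \<le> Arg \<zeta> + (pi - h)" "Arg \<zeta> + (pi - h) \<le> pi" "0 \<le> pi - h" "pi - h \<le> pi"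
      using \<zeta>(2) h_pos h_less by linarith+
    show "cos (Arg \<zeta> + (pi - h)) > cos (pi - h) \<longleftrightarrow> Arg \<zeta> < 0"
      unfolding cos_mono_less_eq[OF r(3,4,1,2)] by linarith
    show "cos (Arg \<zeta> + (pi - h)) = cos (pi - h) \<longleftrightarrow> Arg \<zeta> = 0"
      using cos_inj_pi[OF r] by auto
  qed
  have Im: "Im \<zeta> < 0 \<longleftrightarrow> Arg \<zeta> < 0" "Im \<zeta> = 0 \<longleftrightarrow> Arg \<zeta> = 0"
  proof -
    have "Im \<zeta> = cmod \<zeta> * sin (Arg \<zeta>)" using rcis_cmod_Arg[of \<zeta>] by (metis Im_rcis)
    moreover have "sin (Arg \<zeta>) < 0 \<longleftrightarrow> Arg \<zeta> < 0" "sin (Arg \<zeta>) = 0 \<longleftrightarrow> Arg \<zeta> = 0"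
    proof -
      have "\<bar>Arg \<zeta>\<bar> < pi" using \<zeta>(2) h_less pi_gt_zero by linarith
      then have "Arg \<zeta> > 0 \<Longrightarrow> sin (Arg \<zeta>) > 0" "Arg \<zeta> < 0 \<Longrightarrow> sin (Arg \<zeta>) < 0"
        using sin_gt_zero[of "Arg \<zeta>"] sin_gt_zero[of "- Arg \<zeta>"] by auto
      then show "sin (Arg \<zeta>) < 0 \<longleftrightarrow> Arg \<zeta> < 0" "sin (Arg \<zeta>) = 0 \<longleftrightarrow> Arg \<zeta> = 0"
        by (cases "Arg \<zeta>" "0::real" rule: linorder_cases; simp)+
    qed
    ultimately show "Im \<zeta> < 0 \<longleftrightarrow> Arg \<zeta> < 0" "Im \<zeta> = 0 \<longleftrightarrow> Arg \<zeta> = 0"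
      using c by (auto simp: mult_less_0_iff)
  qed
  have nu: "cmod (\<zeta> * upper) = cmod \<zeta>" by (simp add: norm_mult norm_upper)
  have ch: "cos (pi - h) = - cos h" by simp
  have "Re (\<zeta> * upper) > - cos h * cmod (\<zeta> * upper) \<longleftrightarrow> cmod \<zeta> * cos (Arg \<zeta> + (pi - h)) > cmod \<zeta> * cos (pi - h)"
    unfolding Re nu ch by (simp only: mult.commute)
  also have "\<dots> \<longleftrightarrow> Im \<zeta> < 0"
    unfolding mult_less_cancel_left_pos[OF c] mono Im ..
  finally show "Re (\<zeta> * upper) > - cos h * cmod (\<zeta> * upper) \<longleftrightarrow> Im \<zeta> < 0" .
  have "\<zeta> * upper \<in> cut \<longleftrightarrow> cmod \<zeta> * cos (Arg \<zeta> + (pi - h)) = cmod \<zeta> * cos (pi - h)"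
    unfolding cut_def mem_Collect_eq Re nu ch by (simp only: mult.commute)
  also have "\<dots> \<longleftrightarrow> cos (Arg \<zeta> + (pi - h)) = cos (pi - h)" using c by (simp only: mult_cancel_left) simp
  also have "\<dots> \<longleftrightarrow> Im \<zeta> = 0" unfolding mono Im ..
  finally show "\<zeta> * upper \<in> cut \<longleftrightarrow> Im \<zeta> = 0" .
qed

text \<open>What is kept of the gluing factor of one ray. Multiplication by \<open>cnj upper\<close>
  turns the ray with argument \<pi> - h into the positive axis, where \<open>E\<close> has its slit.
  The limit is taken along the image of the positive axis and serves to normalise the value at 0;
  the last clause says that \<open>E\<close> mends the product across the ray.\<close>

definition glue_data :: "'i set \<Rightarrow> ('i \<Rightarrow> complex) \<Rightarrow> real \<Rightarrow> (complex \<Rightarrow> complex) \<Rightarrow> bool" where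
  "glue_data I a T E \<longleftrightarrow>
    E holomorphic_on - complex_of_real ` {0..T} \<and>
    (\<forall>\<zeta>. Im \<zeta> \<noteq> 0 \<longrightarrow> cmod (E \<zeta>) * \<bar>Im \<zeta>\<bar> \<le> cmod \<zeta>) \<and>
    (\<lambda>n. E (of_real (inverse (real (Suc n))) * cnj upper)) \<longlonglongrightarrow> 1 \<and>
    (\<forall>t. 0 < t \<and> t < T \<longrightarrow> (\<exists>\<rho>>0. \<exists>\<Phi>. \<Phi> holomorphic_on ball (of_real t * upper) \<rho> \<and>
      (\<forall>z\<in>ball (of_real t * upper) \<rho> - cut. piecewise_prod I a z * E (z * cnj upper) = \<Phi> z)))"

lemma glue_data_exists:
  assumes I: "finite I" and a: "\<And>i. i \<in> I \<Longrightarrow> a i \<noteq> 0 \<and> \<bar>Arg (a i)\<bar> \<le> h" and T: "T > 0"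
  shows "\<exists>E. glue_data I a T E"
proof -
  define \<phi> where "\<phi> = (\<lambda>i. p * (h - Arg (a i)))"
  have \<phi>: "0 \<le> \<phi> i" "\<phi> i < pi" if "i \<in> I" for i
  proof -
    show "0 \<le> \<phi> i" using a[OF that] p by (auto simp: \<phi>_def intro!: mult_nonneg_nonneg)
    have "p * (h - Arg (a i)) \<le> p * (2 * h)" using a[OF that] p by (intro mult_left_mono) auto
    then show "\<phi> i < pi" using two_p_h_less by (simp add: \<phi>_def mult_ac)
  qed
  define s where "s = (\<lambda>i. cmod (a i))"
  have s: "s i > 0" if "i \<in> I" for i using a[OF that] by (simp add: s_def)
  define m where "m = (\<lambda>t. (\<Sum>i\<in>I. sector_arg (\<phi> i) ((t / s i) powr p)) / pi)"
  define y where "y = (\<lambda>i \<zeta>. exp (of_real p * (Ln \<zeta> - ln (s i))))"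
  \<comment> \<open>On the ray the factors of the two products are conjugate to each other, so
    \<open>M\<close> is real there and equals \<open>m\<close>; the quotient of the products is exp
    (2 \<pi> \<i> M).\<close>
  define M where "M = (\<lambda>\<zeta>. (\<Sum>i\<in>I. Ln (1 + y i \<zeta> * cis (\<phi> i)) - Ln (1 + y i \<zeta> * cis (- \<phi> i))) / (2 * of_real pi * \<i>))"
  have y_real: "y i (of_real t) = of_real ((t / s i) powr p)" if "t > 0" "i \<in> I" for t i
    using that s[OF that(2)]
    by (simp add: y_def Ln_of_real powr_def ln_div exp_of_real[symmetric] del: exp_of_real)
  have nonpos: "1 + y i (of_real t) * cis (\<phi> i) \<notin> \<real>\<^sub>\<le>\<^sub>0" "1 + y i (of_real t) * cis (- \<phi> i) \<notin> \<real>\<^sub>\<le>\<^sub>0"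
    if "t > 0" "i \<in> I" for t i
    unfolding y_real[OF that] by (rule one_plus_cis_not_nonpos; use \<phi>[OF that(2)] in simp)+
  have y_an: "y i analytic_on {of_real t}" if "t > 0" for t i
    unfolding y_def using that by (intro analytic_intros) auto
  have mono: "mono_on {0..T} m"
  proof (rule mono_onI)
    fix x t assume "x \<in> {0..T}" "t \<in> {0..T}" "x \<le> t"
    then have "sector_arg (\<phi> i) ((x / s i) powr p) \<le> sector_arg (\<phi> i) ((t / s i) powr p)" if "i \<in> I" for i
      using s[OF that] p by (intro sector_arg_mono \<phi> that powr_mono2 divide_right_mono) auto
    then show "m x \<le> m t" unfolding m_def by (intro divide_right_mono sum_mono) auto
  qed
  have cont: "continuous_on {0..T} m"
  proof -
    have "continuous_on {0..T} (\<lambda>t. sector_arg (\<phi> i) ((t / s i) powr p))" if "i \<in> I" for i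
      by (rule continuous_on_compose2[OF sector_arg_continuous[OF \<phi>[OF that]]
            continuous_on_subset[OF powr_quotient_continuous[OF p s[OF that]]]]) auto
    then show ?thesis unfolding m_def by (intro continuous_intros) auto
  qed
  have m0: "m 0 = 0" using p by (simp add: m_def)
  have \<mu>: "continuous_on {0..T} (\<lambda>t. m t / t)"
  proof -
    have "continuous_on {0..T} (\<lambda>t. sector_arg (\<phi> i) ((t / s i) powr p) / t)" if "i \<in> I" for i
      by (rule continuous_on_subset[OF sector_arg_powr_quotient_continuous[OF \<phi>[OF that] p s[OF that]]]) auto
    then have "continuous_on {0..T} (\<lambda>t. (\<Sum>i\<in>I. sector_arg (\<phi> i) ((t / s i) powr p) / t) / pi)"
      by (rule continuous_on_divide[OF continuous_on_sum continuous_on_const]) auto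
    then show ?thesis by (simp add: m_def sum_divide_distrib mult.commute)
  qed
  have Man: "M analytic_on {of_real t}" if "0 < t" for t
    unfolding M_def using nonpos[OF that] by (intro analytic_intros y_an that) auto
  have Mm: "M (of_real t) = of_real (m t)" if t: "0 < t" for t
  proof -
    have "Ln (1 + y i (of_real t) * cis (\<phi> i)) - Ln (1 + y i (of_real t) * cis (- \<phi> i)) =
      2 * \<i> * of_real (sector_arg (\<phi> i) ((t / s i) powr p))" if i: "i \<in> I" for i
    proof -
      have "Ln (1 + y i (of_real t) * cis (- \<phi> i)) = cnj (Ln (1 + y i (of_real t) * cis (\<phi> i)))"
        using nonpos(1)[OF t i] by (simp add: cnj_Ln y_real[OF t i] cis_cnj)
      then show ?thesis
        by (simp add: complex_diff_cnj sector_arg_def y_real[OF t i])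
    qed
    then have "M (of_real t) = (\<Sum>i\<in>I. 2 * \<i> * of_real (sector_arg (\<phi> i) ((t / s i) powr p))) / (2 * of_real pi * \<i>)"
      unfolding M_def by simp
    also have "\<dots> = of_real (m t)"
      by (simp add: m_def flip: sum_distrib_left)
    finally show ?thesis .
  qed
  obtain E where E: "E holomorphic_on - complex_of_real ` {0..T}"
    "\<And>\<zeta>. Im \<zeta> \<noteq> 0 \<Longrightarrow> cmod (E \<zeta>) * \<bar>Im \<zeta>\<bar> \<le> cmod \<zeta>"
    "\<And>t. 0 < t \<Longrightarrow> t < T \<Longrightarrow> \<exists>\<rho>>0. \<exists>\<Psi>. \<Psi> holomorphic_on ball (of_real t) \<rho> \<and>
      (\<forall>\<zeta>\<in>ball (of_real t) \<rho>. Im \<zeta> \<noteq> 0 \<longrightarrow>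
        E \<zeta> = \<Psi> \<zeta> * exp ((if Im \<zeta> > 0 then \<i> * pi else - \<i> * pi) * M \<zeta>))"
    "\<And>u. u \<notin> \<real>\<^sub>\<ge>\<^sub>0 \<Longrightarrow> (\<lambda>n. E (of_real (inverse (real (Suc n))) * u)) \<longlonglongrightarrow> 1"
    using glue_factor[OF T mono cont m0 \<mu> Man Mm] by blast
  have u: "cnj upper \<notin> \<real>\<^sub>\<ge>\<^sub>0" using cos_h by (auto simp: complex_nonneg_Reals_iff upper_eq)
  have "glue_data I a T E"
    unfolding glue_data_def
  proof (intro conjI allI impI E(1,2) E(4)[OF u])
    fix t assume "0 < t \<and> t < T"
    then have t: "0 < t" "t < T" by auto
    obtain \<rho>1 \<Psi> where \<rho>1: "\<rho>1 > 0" "\<Psi> holomorphic_on ball (of_real t) \<rho>1"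
      "\<And>\<zeta>. \<zeta> \<in> ball (of_real t) \<rho>1 \<Longrightarrow> Im \<zeta> \<noteq> 0 \<Longrightarrow>
        E \<zeta> = \<Psi> \<zeta> * exp ((if Im \<zeta> > 0 then \<i> * pi else - \<i> * pi) * M \<zeta>)"
      using E(3)[OF t] by blast
    define Q where "Q = (\<lambda>\<zeta>. \<Prod>i\<in>I. 1 + y i \<zeta> * cis (- \<phi> i))"
    have Qan: "(\<lambda>\<zeta>. Q \<zeta> * exp (\<i> * pi * M \<zeta>)) analytic_on {of_real t}"
      unfolding Q_def by (intro analytic_intros y_an Man t)
    then obtain \<rho>2 where \<rho>2: "\<rho>2 > 0" "(\<lambda>\<zeta>. Q \<zeta> * exp (\<i> * pi * M \<zeta>)) holomorphic_on ball (of_real t) \<rho>2"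
      by (auto simp: analytic_on_def)
    \<comment> \<open>Near the ray the formulas for both branches hold, and no factor vanishes, so
      that exp undoes the logarithms in \<open>M\<close>.\<close>
    have ev: "\<forall>\<^sub>F \<zeta> in nhds (complex_of_real t). \<zeta> \<noteq> 0 \<and> \<bar>Arg \<zeta>\<bar> < h \<and>
        (\<forall>i\<in>I. 1 + y i \<zeta> * cis (\<phi> i) \<noteq> 0 \<and> 1 + y i \<zeta> * cis (- \<phi> i) \<noteq> 0)"
    proof (intro eventually_conj eventually_ball_finite I ballI)
      show "\<forall>\<^sub>F \<zeta> in nhds (complex_of_real t). \<zeta> \<noteq> 0"
        using t by (intro t1_space_nhds) auto
      have "isCont Arg (complex_of_real t)" using t by (intro continuous_at_Arg) auto
      then have "(Arg \<longlongrightarrow> Arg (complex_of_real t)) (nhds (complex_of_real t))"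
        by (simp only: isCont_def tendsto_at_iff_tendsto_nhds)
      from tendsto_rabs[OF this] have "((\<lambda>\<zeta>. \<bar>Arg \<zeta>\<bar>) \<longlongrightarrow> 0) (nhds (complex_of_real t))"
        using t by (simp add: Arg_of_real)
      then show "\<forall>\<^sub>F \<zeta> in nhds (complex_of_real t). \<bar>Arg \<zeta>\<bar> < h"
        using h_pos by (rule order_tendstoD(2))
      fix i assume i: "i \<in> I"
      have c: "(y i \<longlongrightarrow> y i (of_real t)) (nhds (complex_of_real t))"
        using analytic_at_imp_isCont[OF y_an[OF t(1)]] by (simp add: isCont_def tendsto_at_iff_tendsto_nhds)
      have lim: "((\<lambda>\<zeta>. 1 + y i \<zeta> * k) \<longlongrightarrow> 1 + y i (of_real t) * k) (nhds (complex_of_real t))" for k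
        by (intro tendsto_intros c)
      show "\<forall>\<^sub>F \<zeta> in nhds (complex_of_real t). 1 + y i \<zeta> * cis (\<phi> i) \<noteq> 0"
        by (rule tendsto_imp_eventually_ne[OF lim]) (use nonpos(1)[OF t(1) i] in force)
      show "\<forall>\<^sub>F \<zeta> in nhds (complex_of_real t). 1 + y i \<zeta> * cis (- \<phi> i) \<noteq> 0"
        by (rule tendsto_imp_eventually_ne[OF lim]) (use nonpos(2)[OF t(1) i] in force)
    qed
    then obtain \<rho>3 where \<rho>3: "\<rho>3 > 0" "\<And>\<zeta>. \<zeta> \<in> ball (complex_of_real t) \<rho>3 \<Longrightarrow> \<zeta> \<noteq> 0 \<and> \<bar>Arg \<zeta>\<bar> < h \<and>
        (\<forall>i\<in>I. 1 + y i \<zeta> * cis (\<phi> i) \<noteq> 0 \<and> 1 + y i \<zeta> * cis (- \<phi> i) \<noteq> 0)"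
      unfolding eventually_nhds_metric by (auto simp: dist_commute)
    define \<rho> where "\<rho> = min \<rho>1 (min \<rho>2 \<rho>3)"
    \<comment> \<open>The common value of both sides: \<open>E\<close> contributes exp (\<i> \<pi>
      M) where the product is the inner one, Q, and exp (- \<i> \<pi> M) where it is the outer one,
      Q exp (2 \<pi> \<i> M).\<close>
    define \<Phi> where "\<Phi> = (\<lambda>z. (Q (z * cnj upper) * exp (\<i> * pi * M (z * cnj upper))) * \<Psi> (z * cnj upper))"
    have rot: "z * cnj upper \<in> ball (of_real t) \<rho>" if "z \<in> ball (of_real t * upper) \<rho>" for z
    proof -
      have "of_real t - z * cnj upper = (of_real t * upper - z) * cnj upper"
        using mult_cnj_upper by (simp add: algebra_simps)
      then have "dist (of_real t) (z * cnj upper) = dist (of_real t * upper) z"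
        by (simp add: dist_norm norm_mult norm_upper)
      then show ?thesis using that by simp
    qed
    show "\<exists>\<rho>>0. \<exists>\<Phi>. \<Phi> holomorphic_on ball (of_real t * upper) \<rho> \<and>
      (\<forall>z\<in>ball (of_real t * upper) \<rho> - cut. piecewise_prod I a z * E (z * cnj upper) = \<Phi> z)"
    proof (intro exI conjI ballI)
      show "\<rho> > 0" using \<rho>1 \<rho>2 \<rho>3 by (simp add: \<rho>_def)
      have "(\<lambda>\<zeta>. Q \<zeta> * exp (\<i> * pi * M \<zeta>) * \<Psi> \<zeta>) holomorphic_on ball (of_real t) \<rho>"
        by (intro holomorphic_on_mult holomorphic_on_subset[OF \<rho>2(2)] holomorphic_on_subset[OF \<rho>1(2)]) (auto simp: \<rho>_def)
      then have "(\<lambda>\<zeta>. Q \<zeta> * exp (\<i> * pi * M \<zeta>) * \<Psi> \<zeta>) \<circ> (\<lambda>z. z * cnj upper) holomorphic_on ball (of_real t * upper) \<rho>"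
        using rot by (intro holomorphic_on_compose_gen) (auto intro!: holomorphic_intros)
      then show "\<Phi> holomorphic_on ball (of_real t * upper) \<rho>" by (simp add: \<Phi>_def o_def)
      fix z assume z: "z \<in> ball (of_real t * upper) \<rho> - cut"
      define \<zeta> where "\<zeta> = z * cnj upper"
      have z\<zeta>: "z = \<zeta> * upper" using mult_cnj_upper by (simp add: \<zeta>_def mult.assoc mult.commute[of "cnj upper"])
      have \<zeta>: "\<zeta> \<in> ball (of_real t) \<rho>1" "\<zeta> \<in> ball (complex_of_real t) \<rho>3"
        using rot[of z] z by (auto simp: \<zeta>_def \<rho>_def)
      note \<zeta>3 = \<rho>3(2)[OF \<zeta>(2)]
      have Im: "Im \<zeta> \<noteq> 0" using side_of_upper_ray(2)[of \<zeta>] \<zeta>3 z by (simp add: z\<zeta>)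
      have out: "factor_out (a i) z = 1 + y i \<zeta> * cis (\<phi> i)" and inn: "factor_in (a i) z = 1 + y i \<zeta> * cis (- \<phi> i)"
        if "i \<in> I" for i
        using factor_near_upper_ray[of \<zeta> "a i"] \<zeta>3 a[OF that] by (auto simp: z\<zeta> y_def s_def \<phi>_def)
      have expM: "Q \<zeta> * exp (2 * pi * \<i> * M \<zeta>) = (\<Prod>i\<in>I. 1 + y i \<zeta> * cis (\<phi> i))"
      proof -
        have "2 * pi * \<i> * M \<zeta> = (\<Sum>i\<in>I. Ln (1 + y i \<zeta> * cis (\<phi> i)) - Ln (1 + y i \<zeta> * cis (- \<phi> i)))"
          by (simp add: M_def)
        then have "exp (2 * pi * \<i> * M \<zeta>) = (\<Prod>i\<in>I. (1 + y i \<zeta> * cis (\<phi> i)) / (1 + y i \<zeta> * cis (- \<phi> i)))"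
          using \<zeta>3 by (simp add: exp_sum[OF I] exp_diff)
        moreover have "Q \<zeta> \<noteq> 0" using \<zeta>3 I by (simp add: Q_def)
        ultimately show ?thesis by (simp add: Q_def prod_dividef)
      qed
      show "piecewise_prod I a z * E (z * cnj upper) = \<Phi> z"
      proof (cases "Im \<zeta> > 0")
        case True
        then have "\<not> Re z > - cos h * cmod z" using side_of_upper_ray(1)[of \<zeta>] \<zeta>3 by (simp add: z\<zeta>)
        then have "piecewise_prod I a z = Q \<zeta>" by (simp add: piecewise_prod_def Q_def inn)
        moreover have "E \<zeta> = \<Psi> \<zeta> * exp (\<i> * pi * M \<zeta>)" using \<rho>1(3)[OF \<zeta>(1) Im] True by simp
        ultimately show ?thesis by (simp add: \<Phi>_def flip: \<zeta>_def)
      next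
        case False
        then have "Re z > - cos h * cmod z" using side_of_upper_ray(1)[of \<zeta>] \<zeta>3 Im by (simp add: z\<zeta>)
        then have "piecewise_prod I a z = Q \<zeta> * exp (2 * pi * \<i> * M \<zeta>)"
          unfolding expM by (simp add: piecewise_prod_def out)
        moreover have "E \<zeta> = \<Psi> \<zeta> * exp (- \<i> * pi * M \<zeta>)" using \<rho>1(3)[OF \<zeta>(1) Im] False by simp
        moreover have "exp (2 * pi * \<i> * M \<zeta>) * exp (- \<i> * pi * M \<zeta>) = exp (\<i> * pi * M \<zeta>)"
          unfolding exp_add[symmetric] by (simp add: algebra_simps)
        ultimately show ?thesis by (simp add: \<Phi>_def mult_ac flip: \<zeta>_def)
      qed
    qed
  qed
  then show ?thesis by blast
qed

end

section \<open>The cost of enlarging the radius\<close>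

text \<open>Bernoulli's inequality for real exponents, from ln x \<ge> 1 - 1/x and exp y \<ge> 1 +
  y.\<close>

lemma powr_ge_tangent:
  fixes p x :: real
  assumes "1 \<le> p" "0 \<le> x"
  shows "1 + p * (x - 1) \<le> x powr p"
proof (cases "x = 0")
  case False
  then have x: "0 < x" using assms by simp
  have "ln (1 / x) \<le> 1 / x - 1" using x by (intro ln_le_minus_one) simp
  then have "1 - 1 / x \<le> ln x" using x by (simp add: ln_div)
  then have "(p - 1) * (1 - 1 / x) \<le> (p - 1) * ln x" using assms by (intro mult_left_mono) auto
  also have "\<dots> \<le> exp ((p - 1) * ln x) - 1" using exp_ge_add_one_self[of "(p - 1) * ln x"] by linarith
  finally have "x * (1 + (p - 1) * (1 - 1 / x)) \<le> x * exp ((p - 1) * ln x)"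
    using x by (intro mult_left_mono) auto
  also have "\<dots> = exp (ln x) * exp ((p - 1) * ln x)" using x by simp
  also have "\<dots> = exp (p * ln x)" unfolding exp_add[symmetric] by (simp add: algebra_simps)
  also have "\<dots> = x powr p" using x by (simp add: powr_def)
  also have "x * (1 + (p - 1) * (1 - 1 / x)) = 1 + p * (x - 1)" using x by (simp add: field_simps)
  finally show ?thesis .
qed (use assms in simp)

text \<open>The radius \<rho> is chosen such that (r + \<rho>)^p \<le> r^p + p: Bernoulli's
  inequality leaves the term p \<rho> (r + \<rho>)^(p - 1) \<le> p. A point of modulus s then costs
  a factor of at most 1 + p s^(-p), and the product of these is controlled by the sum of the
  s^(-p).\<close>

lemma powr_shift_bound:
  fixes p r s :: real
  assumes p: "1 < p" and r: "0 \<le> r" and s: "0 < s"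
  defines "\<rho> \<equiv> (1 + r) powr (1 - p)"
  shows "1 + ((r + \<rho>) / s) powr p \<le> (1 + (r / s) powr p) * exp (p * s powr - p)"
proof -
  have "(1 + r) powr (1 - p) \<le> (1 + r) powr 0" using p r by (intro powr_mono) auto
  then have \<rho>: "0 < \<rho>" "\<rho> \<le> 1" using r by (auto simp: \<rho>_def)
  define R where "R = r + \<rho>"
  have R: "0 < R" "R \<le> 1 + r" using \<rho> r by (auto simp: R_def)
  have "R powr p * (1 + p * (r / R - 1)) \<le> R powr p * (r / R) powr p"
    using p r R by (intro mult_left_mono powr_ge_tangent) auto
  also have "\<dots> = r powr p" using r R by (simp flip: powr_mult)
  finally have "R powr p \<le> r powr p + p * (R powr p * ((R - r) / R))"
    using R by (simp add: field_simps)
  also have "R powr p * ((R - r) / R) = \<rho> * R powr (p - 1)"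
    using R by (simp add: R_def powr_diff)
  also have "\<dots> \<le> \<rho> * (1 + r) powr (p - 1)"
    using R \<rho> p by (intro mult_left_mono powr_mono2) auto
  also have "\<dots> = 1" using r by (simp add: \<rho>_def flip: powr_add)
  finally have le: "R powr p \<le> r powr p + p" using p by simp
  have "1 + (R / s) powr p \<le> 1 + (r / s) powr p + p * s powr - p"
  proof -
    have "R powr p / s powr p \<le> (r powr p + p) / s powr p" using le by (intro divide_right_mono) auto
    moreover have "(R / s) powr p = R powr p / s powr p" "(r / s) powr p = r powr p / s powr p"
      using r R s by (auto intro: powr_divide)
    moreover have "p * s powr - p = p / s powr p" by (simp add: powr_minus divide_inverse)
    ultimately show ?thesis by (simp only: add_divide_distrib)
  qed
  also have "\<dots> \<le> (1 + (r / s) powr p) * (1 + p * s powr - p)"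
    using p by (simp add: algebra_simps)
  also have "\<dots> \<le> (1 + (r / s) powr p) * exp (p * s powr - p)"
    by (intro mult_left_mono exp_ge_add_one_self add_nonneg_nonneg) auto
  finally show ?thesis by (simp add: R_def)
qed

section \<open>The glued function and its zeros\<close>

context sector_gluing
begin

lemma cut_closed: "closed cut"
  unfolding cut_def by (intro closed_Collect_eq continuous_intros)

lemma factor_out_holomorphic: "factor_out a holomorphic_on {z. Re z > - cos h * cmod z}"
  unfolding factor_out_def using out_not_nonpos by (intro holomorphic_intros) auto

lemma factor_in_holomorphic: "factor_in a holomorphic_on {z. Re z < - cos h * cmod z}"
  unfolding factor_in_def using in_not_nonneg by (intro holomorphic_intros) auto

lemma open_sides: "open {z. Re z > - cos h * cmod z}" "open {z. Re z < - cos h * cmod z}"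
  by (intro open_Collect_less continuous_intros)+

lemma piecewise_prod_holomorphic: "piecewise_prod I a holomorphic_on - cut"
proof -
  let ?A = "{z. Re z > - cos h * cmod z}" and ?B = "{z. Re z < - cos h * cmod z}"
  have "piecewise_prod I a holomorphic_on ?A"
  proof (rule holomorphic_transform[of "\<lambda>z. \<Prod>i\<in>I. factor_out (a i) z"])
    show "(\<lambda>z. \<Prod>i\<in>I. factor_out (a i) z) holomorphic_on ?A"
      by (intro holomorphic_on_prod factor_out_holomorphic)
  qed (simp add: piecewise_prod_def)
  moreover have "piecewise_prod I a holomorphic_on ?B"
  proof (rule holomorphic_transform[of "\<lambda>z. \<Prod>i\<in>I. factor_in (a i) z"])
    show "(\<lambda>z. \<Prod>i\<in>I. factor_in (a i) z) holomorphic_on ?B"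
      by (intro holomorphic_on_prod factor_in_holomorphic)
  qed (simp add: piecewise_prod_def)
  ultimately have "piecewise_prod I a holomorphic_on ?A \<union> ?B"
    using open_sides by (intro holomorphic_on_Un)
  moreover have "- cut = ?A \<union> ?B" by (auto simp: cut_def)
  ultimately show ?thesis by simp
qed

text \<open>\<open>E1\<close> mends the upper ray. \<open>E2\<close> belongs to the conjugated
  points, and its reflection mends the lower ray.\<close>

definition glued :: "'i set \<Rightarrow> ('i \<Rightarrow> complex) \<Rightarrow> (complex \<Rightarrow> complex) \<Rightarrow> (complex \<Rightarrow> complex) \<Rightarrow> complex \<Rightarrow> complex" where
  "glued I a E1 E2 z = piecewise_prod I a z * E1 (z * cnj upper) * cnj (E2 (cnj z * cnj upper))"

text \<open>The slit of \<open>E\<close> is turned onto the upper ray, so this factor does not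
  disturb the lower one.\<close>

lemma upper_factor_holomorphic:
  assumes "glue_data I a T E"
  shows "(\<lambda>z. E (z * cnj upper)) holomorphic_on (- cut \<union> {z. Im z < 0})"
proof -
  have s: "sin h > 0" using h_pos h_less by (intro sin_gt_zero) auto
  have "z * cnj upper \<in> - complex_of_real ` {0..T}" if "z \<in> - cut \<union> {z. Im z < 0}" for z
  proof
    assume "z * cnj upper \<in> complex_of_real ` {0..T}"
    then obtain t where t: "t \<ge> 0" "z * cnj upper = of_real t" by auto
    have "z = (z * cnj upper) * upper" using mult_cnj_upper by (simp add: mult_ac)
    then have z: "z = of_real t * upper" by (simp only: t)
    then have "Im z \<ge> 0" using t s by (simp add: upper_eq)
    then show False using ray_in_cut(1)[OF t(1)] that z by auto
  qed
  then have "E \<circ> (\<lambda>z. z * cnj upper) holomorphic_on (- cut \<union> {z. Im z < 0})"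
    using assms by (intro holomorphic_on_compose_gen[where t = "- complex_of_real ` {0..T}"])
      (auto intro!: holomorphic_intros simp: glue_data_def)
  then show ?thesis by (simp add: o_def)
qed

lemma lower_factor_holomorphic:
  assumes "glue_data I a T E"
  shows "(\<lambda>z. cnj (E (cnj z * cnj upper))) holomorphic_on (- cut \<union> {z. Im z > 0})"
proof -
  have op: "open (- cut \<union> {z. Im z > 0})"
    using cut_closed by (intro open_Un open_Compl open_Collect_less continuous_intros)
  have "cnj ` (- cut \<union> {z. Im z > 0}) \<subseteq> - cut \<union> {z. Im z < 0}" by (auto simp: cnj_in_cut)
  then have "(\<lambda>z. E (z * cnj upper)) holomorphic_on cnj ` (- cut \<union> {z. Im z > 0})"
    by (rule holomorphic_on_subset[OF upper_factor_holomorphic[OF assms]])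
  from holomorphic_on_compose_cnj_cnj[OF this op] show ?thesis by (simp add: o_def)
qed

lemma glued_near_upper:
  assumes E: "glue_data I a T E1" "glue_data I a' T E2" and t: "0 < t" "t < T"
  shows "\<exists>\<rho>>0. \<exists>\<Phi>. \<Phi> holomorphic_on ball (of_real t * upper) \<rho> \<and>
    (\<forall>w\<in>ball (of_real t * upper) \<rho> - cut. glued I a E1 E2 w = \<Phi> w)"
proof -
  have s: "sin h > 0" using h_pos h_less by (intro sin_gt_zero) auto
  obtain \<rho>1 \<Phi> where 1: "\<rho>1 > 0" "\<Phi> holomorphic_on ball (of_real t * upper) \<rho>1"
    "\<And>z. z \<in> ball (of_real t * upper) \<rho>1 - cut \<Longrightarrow> piecewise_prod I a z * E1 (z * cnj upper) = \<Phi> z"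
    using E(1) t unfolding glue_data_def by blast
  have "of_real t * upper \<in> {z. Im z > 0}" using t s by (simp add: upper_eq)
  moreover have "open {z. Im z > 0}" by (intro open_Collect_less continuous_intros)
  ultimately obtain \<rho>2 where 2: "\<rho>2 > 0" "ball (of_real t * upper) \<rho>2 \<subseteq> {z. Im z > 0}" using openE by blast
  define \<rho> where "\<rho> = min \<rho>1 \<rho>2"
  have sub: "ball (of_real t * upper) \<rho> \<subseteq> ball (of_real t * upper) \<rho>1"
    "ball (of_real t * upper) \<rho> \<subseteq> - cut \<union> {z. Im z > 0}" using 2 by (auto simp: \<rho>_def)
  have "(\<lambda>z. \<Phi> z * cnj (E2 (cnj z * cnj upper))) holomorphic_on ball (of_real t * upper) \<rho>"
    by (intro holomorphic_on_mult holomorphic_on_subset[OF 1(2) sub(1)]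
        holomorphic_on_subset[OF lower_factor_holomorphic[OF E(2)] sub(2)])
  moreover have "\<forall>w\<in>ball (of_real t * upper) \<rho> - cut. glued I a E1 E2 w = \<Phi> w * cnj (E2 (cnj w * cnj upper))"
    using 1(3) sub(1) by (auto simp: glued_def)
  moreover have "\<rho> > 0" using 1(1) 2(1) by (simp add: \<rho>_def)
  ultimately show ?thesis by blast
qed

lemma glued_cnj:
  assumes "\<And>i. i \<in> I \<Longrightarrow> a i \<noteq> 0 \<and> \<bar>Arg (a i)\<bar> \<le> h" "z \<notin> cut"
  shows "glued I a E1 E2 z = cnj (glued I (\<lambda>i. cnj (a i)) E2 E1 (cnj z))"
  using piecewise_prod_cnj[of I a z] assms by (simp add: glued_def mult_ac)

text \<open>Off the cut all factors are holomorphic, and on the upper ray \<open>E1\<close> mends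
  the product. Near the lower ray the reflected function has the same form, with conjugated points
  and with \<open>E1\<close> and \<open>E2\<close> exchanged.\<close>

lemma glued_local:
  assumes a: "\<And>i. i \<in> I \<Longrightarrow> a i \<noteq> 0 \<and> \<bar>Arg (a i)\<bar> \<le> h"
    and E: "glue_data I a T E1" "glue_data I (\<lambda>i. cnj (a i)) T E2" and z: "z \<noteq> 0" "cmod z < T"
  shows "\<exists>\<rho>>0. \<exists>\<Phi>. \<Phi> holomorphic_on ball z \<rho> \<and> (\<forall>w\<in>ball z \<rho> - cut. glued I a E1 E2 w = \<Phi> w)"
proof (cases "z \<in> cut")
  case False
  obtain \<rho> where \<rho>: "\<rho> > 0" "ball z \<rho> \<subseteq> - cut" using False cut_closed openE[of "- cut" z] by auto
  have "glued I a E1 E2 holomorphic_on - cut"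
    unfolding glued_def
    by (intro holomorphic_on_mult piecewise_prod_holomorphic
        holomorphic_on_subset[OF upper_factor_holomorphic[OF E(1)]]
        holomorphic_on_subset[OF lower_factor_holomorphic[OF E(2)]]) auto
  then show ?thesis using \<rho> holomorphic_on_subset by blast
next
  case True
  define t where "t = cmod z"
  have t: "0 < t" "t < T" using z by (auto simp: t_def)
  consider "z = of_real t * upper" | "z = of_real t * cnj upper"
    using cut_cases[OF True] by (auto simp: t_def)
  then show ?thesis
  proof cases
    case 1
    then show ?thesis using glued_near_upper[OF E t] by simp
  next
    case 2
    obtain \<rho> \<Phi> where \<rho>: "\<rho> > 0" "\<Phi> holomorphic_on ball (of_real t * upper) \<rho>"
      "\<And>w. w \<in> ball (of_real t * upper) \<rho> - cut \<Longrightarrow> glued I (\<lambda>i. cnj (a i)) E2 E1 w = \<Phi> w"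
      using glued_near_upper[OF E(2,1) t] by blast
    have im: "cnj w \<in> ball (of_real t * upper) \<rho>" if "w \<in> ball z \<rho>" for w
    proof -
      have "of_real t * upper - cnj w = cnj (z - w)" by (simp add: 2)
      then have "dist (of_real t * upper) (cnj w) = dist z w" by (metis complex_mod_cnj dist_norm)
      then show ?thesis using that by simp
    qed
    then have "\<Phi> holomorphic_on cnj ` ball z \<rho>" by (intro holomorphic_on_subset[OF \<rho>(2)]) auto
    from holomorphic_on_compose_cnj_cnj[OF this open_ball]
    have "(\<lambda>w. cnj (\<Phi> (cnj w))) holomorphic_on ball z \<rho>" by (simp add: o_def)
    moreover have "glued I a E1 E2 w = cnj (\<Phi> (cnj w))" if "w \<in> ball z \<rho> - cut" for w
      using glued_cnj[of I a w E1 E2] a \<rho>(3)[of "cnj w"] im[of w] that by (simp add: cnj_in_cut)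
    ultimately show ?thesis using \<rho>(1) by blast
  qed
qed

text \<open>Each gluing factor is bounded by |z| divided by the distance of z to the line of its
  ray; multiplied by both distances, the two factors cost |z|^2.\<close>

lemma glued_bound:
  assumes a: "\<And>i. i \<in> I \<Longrightarrow> a i \<noteq> 0"
    and E: "glue_data I a T E1" "glue_data I a' T E2" and z: "z \<noteq> 0"
  shows "cmod (glued I a E1 E2 z) * \<bar>Im (z * cnj upper)\<bar> * \<bar>Im (z * upper)\<bar>
    \<le> (cmod z)\<^sup>2 * (\<Prod>i\<in>I. 1 + (cmod z / cmod (a i)) powr p)"
proof -
  have 1: "cmod (E1 (z * cnj upper)) * \<bar>Im (z * cnj upper)\<bar> \<le> cmod z"
  proof (cases "Im (z * cnj upper) = 0")
    case False
    then have "cmod (E1 (z * cnj upper)) * \<bar>Im (z * cnj upper)\<bar> \<le> cmod (z * cnj upper)"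
      using E(1) unfolding glue_data_def by blast
    then show ?thesis by (simp add: norm_mult norm_upper)
  qed simp
  have im: "\<bar>Im (cnj z * cnj upper)\<bar> = \<bar>Im (z * upper)\<bar>" by simp
  have 2: "cmod (E2 (cnj z * cnj upper)) * \<bar>Im (z * upper)\<bar> \<le> cmod z"
  proof (cases "Im (cnj z * cnj upper) = 0")
    case False
    then have "cmod (E2 (cnj z * cnj upper)) * \<bar>Im (cnj z * cnj upper)\<bar> \<le> cmod (cnj z * cnj upper)"
      using E(2) unfolding glue_data_def by blast
    then show ?thesis unfolding im by (simp add: norm_mult norm_upper)
  next
    case True
    then have "\<bar>Im (z * upper)\<bar> = 0" using im by simp
    then show ?thesis by (simp only: mult_zero_right norm_ge_zero)
  qed
  have "cmod (glued I a E1 E2 z) * \<bar>Im (z * cnj upper)\<bar> * \<bar>Im (z * upper)\<bar> =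
    cmod (piecewise_prod I a z) * ((cmod (E1 (z * cnj upper)) * \<bar>Im (z * cnj upper)\<bar>) *
      (cmod (E2 (cnj z * cnj upper)) * \<bar>Im (z * upper)\<bar>))"
    by (simp only: glued_def norm_mult complex_mod_cnj mult_ac)
  also have "\<dots> \<le> (\<Prod>i\<in>I. 1 + (cmod z / cmod (a i)) powr p) * (cmod z * cmod z)"
    using z a by (intro mult_mono norm_piecewise_prod_le 1 2 prod_nonneg ballI mult_nonneg_nonneg add_nonneg_nonneg) auto
  finally show ?thesis by (simp add: power2_eq_square mult.commute)
qed

lemma glued_limit:
  assumes I: "finite I" and a: "\<And>i. i \<in> I \<Longrightarrow> a i \<noteq> 0"
    and E: "glue_data I a T E1" "glue_data I a' T E2"
  shows "(\<lambda>n. glued I a E1 E2 (of_real (inverse (real (Suc n))))) \<longlonglongrightarrow> 1"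
proof -
  define x where "x = (\<lambda>n. inverse (real (Suc n)))"
  have x: "x n > 0" for n by (simp add: x_def)
  have xlim: "x \<longlonglongrightarrow> 0" unfolding x_def by (rule LIMSEQ_inverse_real_of_nat)
  have fac: "(\<lambda>n. factor_out (a i) (of_real (x n))) \<longlonglongrightarrow> 1" if i: "i \<in> I" for i
  proof -
    have "(\<lambda>n. (-1) ^ q * exp (of_real p * (Ln (of_real (x n)) - Ln (a i)))) \<longlonglongrightarrow> 0"
    proof (rule Lim_null_comparison)
      show "\<forall>\<^sub>F n in sequentially. cmod ((-1) ^ q * exp (of_real p * (Ln (of_real (x n)) - Ln (a i)))) \<le> (x n / cmod (a i)) powr p"
      proof (intro always_eventually allI)
        fix n
        show "cmod ((-1) ^ q * exp (of_real p * (Ln (of_real (x n)) - Ln (a i)))) \<le> (x n / cmod (a i)) powr p"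
          using norm_exp_Ln_quotient[of "of_real (x n)" "a i"] a[OF i] x[of n] by (simp add: norm_mult norm_power)
      qed
      have "continuous_on {0..} (\<lambda>t. (t / cmod (a i)) powr p)"
        using a[OF i] p by (intro powr_quotient_continuous) auto
      then have "((\<lambda>t. (t / cmod (a i)) powr p) \<longlongrightarrow> (0 / cmod (a i)) powr p) (at 0 within {0..})"
        unfolding continuous_on_def by (rule bspec) simp
      moreover have "filterlim x (at 0 within {0..}) sequentially"
        using xlim x by (auto simp: filterlim_at less_imp_le less_imp_neq[symmetric])
      ultimately have "(\<lambda>n. (x n / cmod (a i)) powr p) \<longlonglongrightarrow> (0 / cmod (a i)) powr p"
        by (rule filterlim_compose)
      then show "(\<lambda>n. (x n / cmod (a i)) powr p) \<longlonglongrightarrow> 0" using p by simp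
    qed
    from tendsto_add[OF tendsto_const this, of 1] show ?thesis by (simp add: factor_out_def)
  qed
  have "piecewise_prod I a (of_real (x n)) = (\<Prod>i\<in>I. factor_out (a i) (of_real (x n)))" for n
    using x[of n] cos_h by (simp add: piecewise_prod_def) (smt (verit) mult_pos_pos)
  moreover have "(\<lambda>n. \<Prod>i\<in>I. factor_out (a i) (of_real (x n))) \<longlonglongrightarrow> (\<Prod>i\<in>I. 1)"
    by (intro tendsto_prod fac)
  ultimately have "(\<lambda>n. piecewise_prod I a (of_real (x n))) \<longlonglongrightarrow> 1" by simp
  moreover have "(\<lambda>n. E1 (of_real (x n) * cnj upper)) \<longlonglongrightarrow> 1" "(\<lambda>n. E2 (of_real (x n) * cnj upper)) \<longlonglongrightarrow> 1"
    using E unfolding glue_data_def x_def by blast+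
  ultimately have "(\<lambda>n. piecewise_prod I a (of_real (x n)) * E1 (of_real (x n) * cnj upper) *
      cnj (E2 (of_real (x n) * cnj upper))) \<longlonglongrightarrow> 1 * 1 * cnj 1"
    by (intro tendsto_mult tendsto_cnj)
  then show ?thesis by (simp add: glued_def x_def)
qed

text \<open>The solution \<theta> of (-1)^q exp (\<i> p \<theta>) = - 1 given by p \<theta> = \<pi>
  - q \<pi>. For q = 1 the factor vanishes at the point itself.\<close>

definition zero_angle :: real where "zero_angle = - (real q - 1) * pi / p"

text \<open>By the choice of h, \<open>zero_angle\<close> equals - (\<pi> - 2 h - \<pi>/p). So for
  |Arg a| \<le> h the rotated point has its argument strictly between - (\<pi> - h) and \<pi> - h,
  where the outer branch is the one in force and the logarithm is additive.\<close>

lemma sector_zero: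
  assumes a: "a \<noteq> 0" "\<bar>Arg a\<bar> \<le> h"
  shows "factor_out a (a * cis zero_angle) = 0"
    and "Re (a * cis zero_angle) > - cos h * cmod (a * cis zero_angle)"
proof -
  have "real q * pi = pi * p - 2 * p * h" using h by (simp add: algebra_simps)
  moreover have za1: "zero_angle = (pi - real q * pi) / p" by (simp add: zero_angle_def algebra_simps)
  ultimately have "zero_angle = (pi - (pi * p - 2 * p * h)) / p" by simp
  also have "\<dots> = - (pi - 2 * h - pi / p)" using p by (simp add: field_simps)
  finally have za: "zero_angle = - (pi - 2 * h - pi / p)" .
  have pip: "0 < pi / p" using p by simp
  have "- (real q - 1) * pi \<le> 0" using q_pos by (intro mult_nonpos_nonneg) auto
  then have za0: "zero_angle \<le> 0" unfolding zero_angle_def using p by (intro divide_nonpos_pos) auto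
  have range: "- (pi - h) < Arg a + zero_angle" "Arg a + zero_angle < pi - h"
    using a za za0 pip h_less h_pos by linarith+
  have "Ln (exp (Ln a + \<i> * of_real zero_angle)) = Ln a + \<i> * of_real zero_angle"
    using range a h_pos by (intro Ln_exp) (auto simp: Arg_def)
  then have L: "Ln (a * cis zero_angle) = Ln a + \<i> * of_real zero_angle"
    using a by (simp add: exp_add cis_conv_exp)
  have "exp (of_real p * (Ln (a * cis zero_angle) - Ln a)) = cis (p * zero_angle)"
    unfolding L by (simp add: cis_conv_exp mult_ac)
  also have "p * zero_angle = pi - real q * pi" using p by (simp add: za1)
  also have "cis (pi - real q * pi) = - ((-1) ^ q)"
    using cis_pi DeMoivre[of pi q] by (simp add: complex_eq_iff)
  finally have "exp (of_real p * (Ln (a * cis zero_angle) - Ln a)) = - ((-1) ^ q)" .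
  then show "factor_out a (a * cis zero_angle) = 0"
    by (simp add: factor_out_def flip: power_mult_distrib)
  have "a * cis zero_angle = of_real (cmod a) * cis (Arg a + zero_angle)"
    using rcis_cmod_Arg[of a] by (simp add: rcis_def flip: cis_mult)
  then have "Re (a * cis zero_angle) = cmod a * cos \<bar>Arg a + zero_angle\<bar>" by simp
  moreover have "cos \<bar>Arg a + zero_angle\<bar> > cos (pi - h)"
    using range h_pos h_less by (intro cos_monotone_0_pi) auto
  then have "cmod a * cos \<bar>Arg a + zero_angle\<bar> > cmod a * cos (pi - h)"
    using a by (intro mult_strict_left_mono) auto
  ultimately show "Re (a * cis zero_angle) > - cos h * cmod (a * cis zero_angle)"
    by (simp add: norm_mult mult.commute)
qed

text \<open>The gluing works at every point except 0, where the rays meet. There the estimate from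
  two lines, on circles of radius |z|/2, shows boundedness, because its loss is invariant under
  scaling; Riemann's theorem on removable singularities does the rest.\<close>

lemma class_function_exists:
  assumes I: "finite I" and a: "\<And>i. i \<in> I \<Longrightarrow> a i \<noteq> 0 \<and> \<bar>Arg (a i)\<bar> \<le> h" and T: "T > 0"
  obtains f where "f holomorphic_on ball 0 T" "f 0 = 1"
    "\<And>z \<rho>. \<rho> > 0 \<Longrightarrow> cmod z + \<rho> < T \<Longrightarrow>
      cmod (f z) \<le> 4 * ((cmod z + \<rho>) / \<rho>)\<^sup>2 * (\<Prod>i\<in>I. 1 + ((cmod z + \<rho>) / cmod (a i)) powr p)"
    "\<And>w. w \<noteq> 0 \<Longrightarrow> cmod w < T \<Longrightarrow> has_zero f w (card {i\<in>I. a i * cis zero_angle = w})"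
proof -
  have a0: "\<And>i. i \<in> I \<Longrightarrow> a i \<noteq> 0" using a by blast
  have ca: "\<And>i. i \<in> I \<Longrightarrow> cnj (a i) \<noteq> 0 \<and> \<bar>Arg (cnj (a i))\<bar> \<le> h"
    using a by (auto simp: Arg_cnj)
  obtain E1 where E1: "glue_data I a T E1" using glue_data_exists[where a = a, OF I a T] by blast
  obtain E2 where E2: "glue_data I (\<lambda>i. cnj (a i)) T E2" using glue_data_exists[where a = "\<lambda>i. cnj (a i)", OF I ca T] by blast
  define f0 where "f0 = glued I a E1 E2"
  define P where "P = (\<lambda>r. \<Prod>i\<in>I. 1 + (r / cmod (a i)) powr p)"
  have P_mono: "P r \<le> P s" if "0 \<le> r" "r \<le> s" for r s
    unfolding P_def using that p by (intro prod_mono conjI add_nonneg_nonneg add_left_mono powr_mono2 divide_right_mono) auto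
  have P0: "0 \<le> P r" for r unfolding P_def by (intro prod_nonneg ballI add_nonneg_nonneg) auto
  let ?S = "ball 0 T - {0 :: complex}"
  have "open ?S" by (intro open_Diff) auto
  then obtain f1 where f1: "f1 holomorphic_on ?S" "\<And>z. z \<in> ?S - cut \<Longrightarrow> f1 z = f0 z"
  proof (rule holomorphic_extension_across[of ?S cut f0])
    show "\<exists>\<rho>>0. \<exists>\<Phi>. \<Phi> holomorphic_on ball z \<rho> \<and> (\<forall>w\<in>ball z \<rho> - cut. f0 w = \<Phi> w)" if "z \<in> ?S" for z
      unfolding f0_def using that by (intro glued_local[OF a E1 E2]) auto
  qed (use cut_islimpt in auto)
  have bd1: "cmod (f1 w) * \<bar>Im (w * cnj upper)\<bar> * \<bar>Im (w * upper)\<bar> \<le> R\<^sup>2 * P R"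
    if w: "w \<noteq> 0" "cmod w \<le> R" "R < T" for w R
  proof (cases "w \<in> cut")
    case True
    have "w * cnj upper = of_real (cmod w) \<or> w * upper = of_real (cmod w)"
    proof (rule disjE[OF cut_cases[OF True]])
      assume *: "w = of_real (cmod w) * upper"
      have "w * cnj upper = of_real (cmod w) * (upper * cnj upper)" by (subst *) (simp only: mult_ac)
      then show ?thesis by (simp add: mult_cnj_upper)
    next
      assume *: "w = of_real (cmod w) * cnj upper"
      have "w * upper = of_real (cmod w) * (upper * cnj upper)" by (subst *) (simp only: mult_ac)
      then show ?thesis by (simp add: mult_cnj_upper)
    qed
    then have "\<bar>Im (w * cnj upper)\<bar> * \<bar>Im (w * upper)\<bar> = 0" by (metis Im_complex_of_real abs_zero mult_zero_left mult_zero_right)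
    then have "cmod (f1 w) * \<bar>Im (w * cnj upper)\<bar> * \<bar>Im (w * upper)\<bar> = 0" by (simp only: mult.assoc mult_zero_right)
    then show ?thesis using P0 by (simp only: mult_nonneg_nonneg zero_le_power2)
  next
    case False
    have "cmod (f0 w) * \<bar>Im (w * cnj upper)\<bar> * \<bar>Im (w * upper)\<bar> \<le> (cmod w)\<^sup>2 * P (cmod w)"
      unfolding f0_def P_def by (rule glued_bound[OF a0 E1 E2 w(1)])
    also have "\<dots> \<le> R\<^sup>2 * P R"
      using w by (intro mult_mono power_mono P_mono P0) auto
    finally show ?thesis using f1(2)[of w] w False by simp
  qed
  have nu: "cmod (cnj upper) = 1" "cmod upper = 1" by (simp_all add: norm_upper)
  have near0: "cmod (f1 z) \<le> 36 * P T" if z: "z \<noteq> 0" "cmod z < T / 2" for z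
  proof -
    \<comment> \<open>On this disc |w| \<le> 3 * \<rho>, so the constant 4 * (3 \<rho>)^2 / \<rho>^2
      = 36 does not depend on z.\<close>
    define \<rho> where "\<rho> = cmod z / 2"
    have \<rho>: "\<rho> > 0" using z by (simp add: \<rho>_def)
    have w: "w \<noteq> 0" "cmod w \<le> 3 * \<rho>" if "dist z w \<le> \<rho>" for w
      using that z norm_triangle_ineq2[of z w] norm_triangle_ineq2[of w z] \<rho>
      by (auto simp: \<rho>_def dist_norm norm_minus_commute)
    have T3: "3 * \<rho> < T" using z T unfolding \<rho>_def by linarith
    have "cmod (f1 z) \<le> 4 * ((3 * \<rho>)\<^sup>2 * P (3 * \<rho>)) / \<rho>\<^sup>2"
    proof (rule bound_from_two_lines[where f = f1 and ?z0.0 = z, OF _ \<rho> nu])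
      show "f1 holomorphic_on cball z \<rho>"
        by (rule holomorphic_on_subset[OF f1(1)]) (use w T3 in \<open>force simp: mem_cball\<close>)
      show "cmod (f1 w) * \<bar>Im (w * cnj upper)\<bar> * \<bar>Im (w * upper)\<bar> \<le> (3 * \<rho>)\<^sup>2 * P (3 * \<rho>)"
        if "dist z w = \<rho>" for w
        using w[of w] that T3 by (intro bd1) auto
    qed
    also have "\<dots> = 36 * P (3 * \<rho>)" using \<rho> by (simp add: power2_eq_square)
    also have "\<dots> \<le> 36 * P T" using \<rho> T3 by (intro mult_left_mono P_mono) auto
    finally show ?thesis .
  qed
  have "\<exists>f. f holomorphic_on ball 0 T \<and> (\<forall>z\<in>?S. f z = f1 z)"
  proof (rule holomorphic_on_extend_bounded[THEN iffD2, OF f1(1)])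
    show "0 \<in> interior (ball (0::complex) T)" using T by simp
    have "\<forall>\<^sub>F z in at 0. cmod (f1 z) \<le> 36 * P T"
      unfolding eventually_at using T near0 by (intro exI[of _ "T / 2"]) auto
    then show "\<exists>B. \<forall>\<^sub>F z in at 0. cmod (f1 z) \<le> B" ..
  qed
  then obtain f where f: "f holomorphic_on ball 0 T" "\<And>z. z \<in> ?S \<Longrightarrow> f z = f1 z" by blast
  have bd: "cmod (f w) * \<bar>Im (w * cnj upper)\<bar> * \<bar>Im (w * upper)\<bar> \<le> R\<^sup>2 * P R"
    if "cmod w \<le> R" "R < T" for w R
  proof (cases "w = 0")
    case True
    then show ?thesis using P0[of R] by simp
  next
    case False
    then show ?thesis using bd1[OF False that] f(2)[of w] that by simp
  qed
  show thesis
  proof (rule that[OF f(1)])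
    define x where "x = (\<lambda>n. inverse (real (Suc n)))"
    have xlim: "x \<longlonglongrightarrow> 0" unfolding x_def by (rule LIMSEQ_inverse_real_of_nat)
    have "\<forall>\<^sub>F n in sequentially. x n < T" by (rule order_tendstoD(2)[OF xlim T])
    then have "\<forall>\<^sub>F n in sequentially. f0 (of_real (x n)) = f (of_real (x n))"
    proof eventually_elim
      case (elim n)
      have xn: "x n > 0" by (simp add: x_def)
      then have "x n \<noteq> - (cos h * x n)" using mult_pos_pos[OF cos_h(1) xn] by linarith
      then have "complex_of_real (x n) \<notin> cut" using xn by (simp add: cut_def)
      then show ?case using f(2)[of "of_real (x n)"] f1(2)[of "of_real (x n)"] xn elim by simp
    qed
    moreover have "(\<lambda>n. f0 (of_real (x n))) \<longlonglongrightarrow> 1"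
      unfolding f0_def x_def by (rule glued_limit[OF I a0 E1 E2])
    ultimately have "(\<lambda>n. f (of_real (x n))) \<longlonglongrightarrow> 1" by (rule Lim_transform_eventually[rotated])
    moreover have "(\<lambda>n. f (of_real (x n))) \<longlonglongrightarrow> f (of_real 0)"
      using T by (intro isCont_tendsto_compose[OF holomorphic_on_imp_isCont[OF f(1)]] tendsto_of_real xlim) auto
    ultimately show "f 0 = 1" using LIMSEQ_unique by force
  next
    fix z :: complex and \<rho> :: real assume \<rho>: "\<rho> > 0" "cmod z + \<rho> < T"
    have w: "cmod w \<le> cmod z + \<rho>" if "dist z w \<le> \<rho>" for w
      using that norm_triangle_ineq2[of w z] by (simp add: dist_norm norm_minus_commute)
    have "cmod (f z) \<le> 4 * ((cmod z + \<rho>)\<^sup>2 * P (cmod z + \<rho>)) / \<rho>\<^sup>2"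
    proof (rule bound_from_two_lines[where f = f and ?z0.0 = z, OF _ \<rho>(1) nu])
      show "f holomorphic_on cball z \<rho>"
        by (rule holomorphic_on_subset[OF f(1)]) (use w \<rho> in \<open>force simp: mem_cball\<close>)
      show "cmod (f v) * \<bar>Im (v * cnj upper)\<bar> * \<bar>Im (v * upper)\<bar> \<le> (cmod z + \<rho>)\<^sup>2 * P (cmod z + \<rho>)"
        if "dist z v = \<rho>" for v
        using w[of v] that \<rho> by (intro bd) auto
    qed
    then show "cmod (f z) \<le> 4 * ((cmod z + \<rho>) / \<rho>)\<^sup>2 * (\<Prod>i\<in>I. 1 + ((cmod z + \<rho>) / cmod (a i)) powr p)"
      by (simp add: P_def power_divide)
  next
    fix w :: complex assume w: "w \<noteq> 0" "cmod w < T"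
    let ?J = "{i\<in>I. a i * cis zero_angle = w}"
    show "has_zero f w (card ?J)"
    proof (cases "?J = {}")
      case True
      have "isCont f w" using w by (intro holomorphic_on_imp_isCont[OF f(1)]) auto
      then have "has_zero f w 0" by (rule has_zero_0)
      then show ?thesis unfolding True by simp
    next
      case False
      let ?A = "{z. Re z > - cos h * cmod z}"
      obtain j where j: "j \<in> I" "a j * cis zero_angle = w" using False by blast
      have wA: "w \<in> ?A" using sector_zero(2)[of "a j"] a[OF j(1)] j(2) by simp
      have ev: "\<forall>\<^sub>F z in nhds w. z \<in> ?A \<inter> ?S"
        using w wA open_sides(1) \<open>open ?S\<close> by (intro eventually_nhds_in_open open_Int) auto
      define G where "G = (\<lambda>z. E1 (z * cnj upper) * cnj (E2 (cnj z * cnj upper)))"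
      have holG: "G holomorphic_on - cut"
        unfolding G_def
        by (intro holomorphic_on_mult holomorphic_on_subset[OF upper_factor_holomorphic[OF E1]]
            holomorphic_on_subset[OF lower_factor_holomorphic[OF E2]]) auto
      have "w \<in> - cut" using wA by (auto simp: cut_def)
      then have G: "isCont G w"
        using cut_closed by (intro holomorphic_on_imp_isCont[OF holG]) (simp add: interior_open open_Compl)
      have zi: "has_zero (factor_out (a i)) w (if a i * cis zero_angle = w then 1 else 0)" if i: "i \<in> I" for i
      proof (cases "a i * cis zero_angle = w")
        case True
        have "factor_out (a i) analytic_on {w}"
          using factor_out_holomorphic open_sides(1) wA by (auto simp: analytic_at)
        then show ?thesis using True sector_zero(1)[of "a i"] a[OF i] has_zero_1 by auto
      next
        case False
        have "isCont (factor_out (a i)) w"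
          using wA open_sides(1) by (intro holomorphic_on_imp_isCont[OF factor_out_holomorphic]) (simp add: interior_open)
        then show ?thesis using False has_zero_0 by simp
      qed
      have "has_zero (\<lambda>z. (\<Prod>i\<in>I. factor_out (a i) z) * G z) w ((\<Sum>i\<in>I. if a i * cis zero_angle = w then 1 else 0) + 0)"
        by (intro has_zero_mult has_zero_prod zi has_zero_0 G)
      moreover have "(\<Sum>i\<in>I. if a i * cis zero_angle = w then 1 else 0) = card ?J"
        using sum.inter_filter[OF I, of "\<lambda>_. 1::nat" "\<lambda>i. a i * cis zero_angle = w"] by simp
      moreover have "\<forall>\<^sub>F z in nhds w. f z = (\<Prod>i\<in>I. factor_out (a i) z) * G z"
        using ev
      proof eventually_elim
        case (elim z)
        then have "z \<notin> cut" by (auto simp: cut_def)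
        then have "f z = f0 z" using f(2) f1(2) elim by auto
        then show ?case using elim by (simp add: f0_def glued_def piecewise_prod_def G_def mult.assoc)
      qed
      ultimately show ?thesis using has_zero_cong[of f "\<lambda>z. (\<Prod>i\<in>I. factor_out (a i) z) * G z" w] by simp
    qed
  qed
qed

text \<open>The radius \<rho> = (1 + |z|)^(1 - p) balances two losses: it is large enough for (|z| +
  \<rho>) / \<rho> \<le> (1 + |z|)^p and small enough for the product to change by a factor
  independent of z.\<close>

lemma class_function_bounded:
  assumes I: "finite I" and a: "\<And>i. i \<in> I \<Longrightarrow> a i \<noteq> 0 \<and> \<bar>Arg (a i)\<bar> \<le> h" and T: "T > 0"
  obtains f where "f holomorphic_on ball 0 T" "f 0 = 1"
    "\<And>z. cmod z < T \<Longrightarrow> cmod (f z) \<le> 4 * (1 + cmod z) powr (2 * p) *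
      exp (p * (\<Sum>i\<in>I. cmod (a i) powr - p)) * (\<Prod>i\<in>I. 1 + (cmod z / cmod (a i)) powr p)"
    "\<And>w. w \<noteq> 0 \<Longrightarrow> cmod w < T \<Longrightarrow> has_zero f w (card {i\<in>I. a i * cis zero_angle = w})"
proof -
  \<comment> \<open>The larger disc leaves room for circles of radius \<rho> \<le> 1 around all
    points of the disc of radius T.\<close>
  have T1: "T + 1 > 0" using T by simp
  show thesis
  proof (rule class_function_exists[where a = a, OF I a T1])
    fix f assume f: "f holomorphic_on ball 0 (T + 1)" "f 0 = 1"
      "\<And>z \<rho>. \<rho> > 0 \<Longrightarrow> cmod z + \<rho> < T + 1 \<Longrightarrow>
        cmod (f z) \<le> 4 * ((cmod z + \<rho>) / \<rho>)\<^sup>2 * (\<Prod>i\<in>I. 1 + ((cmod z + \<rho>) / cmod (a i)) powr p)"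
      "\<And>w. w \<noteq> 0 \<Longrightarrow> cmod w < T + 1 \<Longrightarrow> has_zero f w (card {i\<in>I. a i * cis zero_angle = w})"
    show thesis
    proof (rule that)
      show "f holomorphic_on ball 0 T" by (rule holomorphic_on_subset[OF f(1)]) auto
      show "f 0 = 1" by (rule f(2))
      show "has_zero f w (card {i\<in>I. a i * cis zero_angle = w})" if "w \<noteq> 0" "cmod w < T" for w
        using that by (intro f(4)) auto
      fix z :: complex assume z: "cmod z < T"
      define r where "r = cmod z"
      define \<rho> where "\<rho> = (1 + r) powr (1 - p)"
      have r: "0 \<le> r" by (simp add: r_def)
      have "(1 + r) powr (1 - p) \<le> (1 + r) powr 0" using p r by (intro powr_mono) auto
      then have \<rho>: "0 < \<rho>" "\<rho> \<le> 1" using r by (auto simp: \<rho>_def)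
      have "cmod (f z) \<le> 4 * ((r + \<rho>) / \<rho>)\<^sup>2 * (\<Prod>i\<in>I. 1 + ((r + \<rho>) / cmod (a i)) powr p)"
        unfolding r_def using \<rho> z by (intro f(3)) auto
      also have "\<dots> \<le> 4 * (1 + r) powr (2 * p) * (\<Prod>i\<in>I. (1 + (r / cmod (a i)) powr p) * exp (p * cmod (a i) powr - p))"
      proof (intro mult_mono mult_left_mono prod_mono conjI)
        have "(r + \<rho>) / \<rho> \<le> (1 + r) / \<rho>" using \<rho> by (intro divide_right_mono) auto
        also have "\<dots> = (1 + r) powr p" using r by (simp add: \<rho>_def powr_diff)
        finally have "((r + \<rho>) / \<rho>)\<^sup>2 \<le> ((1 + r) powr p)\<^sup>2" using r \<rho> by (intro power_mono) auto
        also have "\<dots> = (1 + r) powr (2 * p)" by (simp add: power2_eq_square flip: powr_add)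
        finally show "((r + \<rho>) / \<rho>)\<^sup>2 \<le> (1 + r) powr (2 * p)" .
        fix i assume i: "i \<in> I"
        then have "0 < cmod (a i)" using a by simp
        then show "1 + ((r + \<rho>) / cmod (a i)) powr p \<le> (1 + (r / cmod (a i)) powr p) * exp (p * cmod (a i) powr - p)"
          unfolding \<rho>_def using p r by (intro powr_shift_bound)
      qed (auto intro!: prod_nonneg add_nonneg_nonneg)
      also have "\<dots> = 4 * (1 + r) powr (2 * p) * exp (p * (\<Sum>i\<in>I. cmod (a i) powr - p)) *
          (\<Prod>i\<in>I. 1 + (r / cmod (a i)) powr p)"
        by (simp add: prod.distrib exp_sum[OF I] sum_distrib_left)
      finally show "cmod (f z) \<le> 4 * (1 + cmod z) powr (2 * p) *
          exp (p * (\<Sum>i\<in>I. cmod (a i) powr - p)) * (\<Prod>i\<in>I. 1 + (cmod z / cmod (a i)) powr p)"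
        by (simp add: r_def)
    qed
  qed
qed

end

section \<open>From sectors to the plane\<close>

lemma has_zero_rotate:
  assumes "has_zero f (w * c) m" "cmod c = 1"
  shows "has_zero (\<lambda>z. f (z * c)) w m"
proof -
  obtain K where K: "K > 0" "\<forall>\<^sub>F x in nhds (w * c). norm (f x) \<le> K * norm ((x - w * c) ^ m)"
    using assms(1) unfolding has_zero_def by (elim landau_o.bigE)
  have "filterlim (\<lambda>z. z * c) (nhds (w * c)) (nhds w)"
    by (intro tendsto_mult filterlim_ident tendsto_const)
  then have "\<forall>\<^sub>F z in nhds w. norm (f (z * c)) \<le> K * norm ((z * c - w * c) ^ m)"
    by (rule eventually_compose_filterlim[OF K(2)])
  then have "\<forall>\<^sub>F z in nhds w. norm (f (z * c)) \<le> K * norm ((z - w) ^ m)"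
    by eventually_elim (use assms(2) in \<open>simp add: norm_power norm_mult flip: left_diff_distrib\<close>)
  then show ?thesis unfolding has_zero_def by (rule bigoI)
qed

text \<open>Rounding Arg w to the nearest multiple of 2 \<pi> / N leaves an error of at most \<pi> /
  N.\<close>

lemma rotation_into_window:
  assumes N: "0 < N" "pi / real N \<le> h" and h: "h < pi / 2" and w: "w \<noteq> 0"
  shows "\<exists>j\<in>{- int N..int N}. \<bar>Arg (w * cis (- (2 * pi * real_of_int j / real N)))\<bar> \<le> h"
proof -
  define x where "x = Arg w * real N / (2 * pi)"
  define j where "j = round x"
  have N0: "real N > 0" using N by simp
  have "\<bar>Arg w\<bar> \<le> pi" using Arg_bounded[of w] by auto
  then have "\<bar>Arg w\<bar> * real N \<le> pi * real N" by (intro mult_right_mono) auto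
  then have "\<bar>x\<bar> \<le> real N / 2" by (simp add: x_def abs_mult field_simps)
  then have "- real N \<le> x" "x \<le> real N" by auto
  then have "round (real_of_int (- int N)) \<le> j" "j \<le> round (real_of_int (int N))"
    unfolding j_def by (intro round_mono; simp)+
  then have j: "j \<in> {- int N..int N}" by (simp only: round_of_int atLeastAtMost_iff)
  define \<alpha> where "\<alpha> = Arg w - 2 * pi * real_of_int j / real N"
  have "\<bar>real_of_int j - x\<bar> \<le> 1 / 2" unfolding j_def by (rule of_int_round_abs_le)
  then have "\<bar>real_of_int j - x\<bar> * (2 * pi / real N) \<le> 1 / 2 * (2 * pi / real N)"
    using N0 by (intro mult_right_mono) auto
  moreover have "\<bar>\<alpha>\<bar> = \<bar>real_of_int j - x\<bar> * (2 * pi / real N)"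
  proof -
    have "\<alpha> = - ((real_of_int j - x) * (2 * pi / real N))"
      using N0 by (simp add: \<alpha>_def x_def field_simps)
    then show ?thesis by (simp add: abs_mult)
  qed
  ultimately have \<alpha>: "\<bar>\<alpha>\<bar> \<le> h" using N(2) by simp
  have "w * cis (- (2 * pi * real_of_int j / real N)) = rcis (cmod w) \<alpha>"
  proof -
    have "w * cis (- (2 * pi * real_of_int j / real N)) = rcis (cmod w) (Arg w) * cis (- (2 * pi * real_of_int j / real N))"
      by (simp add: rcis_cmod_Arg)
    also have "\<dots> = rcis (cmod w) \<alpha>" by (simp add: rcis_def mult.assoc cis_mult \<alpha>_def)
    finally show ?thesis .
  qed
  moreover have "Arg (rcis (cmod w) \<alpha>) = \<alpha>"
    using w \<alpha> h pi_gt_zero by (intro Arg_rcis) auto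
  ultimately show ?thesis using \<alpha> j by (intro bexI[of _ j]) auto
qed

text \<open>
  Distributing the points over finitely many windows of arguments costs a power of \<open>1 + cmod z\<close>
  that depends on \<open>p\<close> only.
\<close>
lemma noninteger_level:
  fixes p :: real
  assumes p: "1 < p" "p \<notin> \<nat>"
  obtains K e :: real where "K \<ge> 0" "e \<ge> 0"
    "\<And>(I :: 'i set) w S T. finite I \<Longrightarrow> (\<And>i. i \<in> I \<Longrightarrow> w i \<noteq> 0) \<Longrightarrow> (\<Sum>i\<in>I. cmod (w i) powr - p) \<le> S \<Longrightarrow> T > 0 \<Longrightarrow>
      \<exists>f. f holomorphic_on ball 0 T \<and> f 0 = 1 \<and>
        (\<forall>z. cmod z < T \<longrightarrow> cmod (f z) \<le> K * (1 + cmod z) powr e * exp (p * S) *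
          (\<Prod>i\<in>I. 1 + (cmod z / cmod (w i)) powr p)) \<and>
        (\<forall>v. v \<noteq> 0 \<and> cmod v < T \<longrightarrow> has_zero f v (card {i\<in>I. w i = v}))"
proof -
  define q where "q = nat \<lfloor>p\<rfloor>"
  have q1: "real q \<le> p" "p < real q + 1" using p unfolding q_def by linarith+
  moreover have "real q \<noteq> p" using p(2) by (metis of_nat_in_Nats)
  ultimately have q: "real q < p" "p < real q + 1" by auto
  define h where "h = pi * (p - real q) / (2 * p)"
  interpret sector_gluing p h q
    by standard (use p q in \<open>auto simp: h_def\<close>)
  obtain N :: nat where N: "real N > pi / h" using reals_Archimedean2 by blast
  then have N0: "0 < N" using h_pos pi_gt_zero by (metis divide_pos_pos gr0I less_asym of_nat_0)
  have Nh: "pi / real N \<le> h" using N N0 h_pos by (simp add: field_simps)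
  define J where "J = {- int N..int N}"
  define \<theta> where "\<theta> = (\<lambda>j. 2 * pi * real_of_int j / real N)"
  have "finite J" by (simp add: J_def)
  \<comment> \<open>Each of the \<open>card J\<close> windows costs a factor 4 (1 + |z|)^(2
    p).\<close>
  define K where "K = (4::real) ^ card J"
  define e where "e = 2 * p * real (card J)"
  show thesis
  proof (rule that[of K e])
    show "K \<ge> 0" "e \<ge> 0" using p by (auto simp: K_def e_def)
    fix I :: "'i set" and w S T
    assume I: "finite I" and w: "\<And>i. i \<in> I \<Longrightarrow> w i \<noteq> 0" and S: "(\<Sum>i\<in>I. cmod (w i) powr - p) \<le> S" and T: "(T::real) > 0"
    have "\<forall>i\<in>I. \<exists>j\<in>J. \<bar>Arg (w i * cis (- \<theta> j))\<bar> \<le> h"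
      using rotation_into_window[OF N0 Nh h_less] w unfolding J_def \<theta>_def by blast
    then obtain cls where cls: "\<And>i. i \<in> I \<Longrightarrow> cls i \<in> J \<and> \<bar>Arg (w i * cis (- \<theta> (cls i)))\<bar> \<le> h" by metis
    define Ij where "Ij = (\<lambda>j. {i \<in> I. cls i = j})"
    define a where "a = (\<lambda>j i. w i * cis (- \<theta> j))"
    have na: "cmod (a j i) = cmod (w i)" for j i by (simp add: a_def norm_mult)
    define \<Phi> where "\<Phi> = (\<lambda>j f. f holomorphic_on ball 0 T \<and> f 0 = 1 \<and>
      (\<forall>z. cmod z < T \<longrightarrow> cmod (f z) \<le> 4 * (1 + cmod z) powr (2 * p) *
        exp (p * (\<Sum>i\<in>Ij j. cmod (w i) powr - p)) * (\<Prod>i\<in>Ij j. 1 + (cmod z / cmod (w i)) powr p)) \<and>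
      (\<forall>v. v \<noteq> 0 \<and> cmod v < T \<longrightarrow> has_zero f v (card {i\<in>Ij j. a j i * cis zero_angle = v})))"
    have "\<exists>f. \<Phi> j f" for j
    proof (rule class_function_bounded[where I = "Ij j" and a = "a j" and T = T])
      show "finite (Ij j)" using I by (simp add: Ij_def)
      show "a j i \<noteq> 0 \<and> \<bar>Arg (a j i)\<bar> \<le> h" if "i \<in> Ij j" for i
        using that w cls by (auto simp: Ij_def a_def)
      show "0 < T" by (rule T)
      fix f assume f: "f holomorphic_on ball 0 T" "f 0 = 1"
        and bf: "\<And>z. cmod z < T \<Longrightarrow> cmod (f z) \<le> 4 * (1 + cmod z) powr (2 * p) *
          exp (p * (\<Sum>i\<in>Ij j. cmod (a j i) powr - p)) * (\<Prod>i\<in>Ij j. 1 + (cmod z / cmod (a j i)) powr p)"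
        and zf: "\<And>v. v \<noteq> 0 \<Longrightarrow> cmod v < T \<Longrightarrow> has_zero f v (card {i\<in>Ij j. a j i * cis zero_angle = v})"
      show ?thesis
        unfolding \<Phi>_def
        by (rule exI[of _ f], intro conjI allI impI f)
          (use bf[unfolded na] zf in blast)+
    qed
    then have "\<forall>j. \<exists>f. \<Phi> j f" by blast
    from choice[OF this] obtain f where \<Phi>: "\<forall>j. \<Phi> j (f j)" ..
    have f: "\<And>j. f j holomorphic_on ball 0 T" "\<And>j. f j 0 = 1"
      "\<And>j z. cmod z < T \<Longrightarrow> cmod (f j z) \<le> 4 * (1 + cmod z) powr (2 * p) *
        exp (p * (\<Sum>i\<in>Ij j. cmod (w i) powr - p)) * (\<Prod>i\<in>Ij j. 1 + (cmod z / cmod (w i)) powr p)"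
      "\<And>j v. v \<noteq> 0 \<Longrightarrow> cmod v < T \<Longrightarrow> has_zero (f j) v (card {i\<in>Ij j. a j i * cis zero_angle = v})"
      using \<Phi> unfolding \<Phi>_def by blast+
    \<comment> \<open>\<open>f j\<close> vanishes at w i * c j, so the substitution of z * c j for z
      moves this zero to w i.\<close>
    define c where "c = (\<lambda>j. cis (zero_angle - \<theta> j))"
    have nc: "cmod (c j) = 1" "c j \<noteq> 0" for j by (simp_all add: c_def)
    have group: "(\<Union>j\<in>J. Ij j) = I" using cls by (auto simp: Ij_def)
    have disj: "\<forall>i\<in>J. \<forall>j\<in>J. i \<noteq> j \<longrightarrow> Ij i \<inter> Ij j = {}" by (auto simp: Ij_def)
    have finIj: "\<forall>j\<in>J. finite (Ij j)" using I by (simp add: Ij_def)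
    define F where "F = (\<lambda>z. \<Prod>j\<in>J. f j (z * c j))"
    show "\<exists>f. f holomorphic_on ball 0 T \<and> f 0 = 1 \<and>
        (\<forall>z. cmod z < T \<longrightarrow> cmod (f z) \<le> K * (1 + cmod z) powr e * exp (p * S) *
          (\<Prod>i\<in>I. 1 + (cmod z / cmod (w i)) powr p)) \<and>
        (\<forall>v. v \<noteq> 0 \<and> cmod v < T \<longrightarrow> has_zero f v (card {i\<in>I. w i = v}))"
    proof (intro exI[of _ F] conjI allI impI)
      have "(f j \<circ> (\<lambda>z. z * c j)) holomorphic_on ball 0 T" for j
        by (rule holomorphic_on_compose_gen[OF _ f(1)]) (auto intro!: holomorphic_intros simp: norm_mult nc)
      then show "F holomorphic_on ball 0 T"
        unfolding F_def by (intro holomorphic_on_prod) (simp add: o_def)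
      show "F 0 = 1" by (simp add: F_def f(2))
    next
      fix z :: complex assume z: "cmod z < T"
      have nz: "cmod (z * c j) = cmod z" for j by (simp add: norm_mult nc)
      have "cmod (F z) = (\<Prod>j\<in>J. cmod (f j (z * c j)))" by (simp add: F_def prod_norm)
      also have "\<dots> \<le> (\<Prod>j\<in>J. 4 * (1 + cmod z) powr (2 * p) *
        exp (p * (\<Sum>i\<in>Ij j. cmod (w i) powr - p)) * (\<Prod>i\<in>Ij j. 1 + (cmod z / cmod (w i)) powr p))"
        using f(3)[of "z * c _"] z unfolding nz by (intro prod_mono) auto
      also have "\<dots> = K * ((1 + cmod z) powr (2 * p)) ^ card J * exp (\<Sum>j\<in>J. p * (\<Sum>i\<in>Ij j. cmod (w i) powr - p)) *
        (\<Prod>j\<in>J. \<Prod>i\<in>Ij j. 1 + (cmod z / cmod (w i)) powr p)"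
        by (simp add: prod.distrib K_def exp_sum[OF \<open>finite J\<close>])
      also have "(\<Prod>j\<in>J. \<Prod>i\<in>Ij j. 1 + (cmod z / cmod (w i)) powr p) = (\<Prod>i\<in>I. 1 + (cmod z / cmod (w i)) powr p)"
        unfolding group[symmetric] by (rule prod.UNION_disjoint[OF \<open>finite J\<close> finIj disj, symmetric])
      also have "(\<Sum>j\<in>J. p * (\<Sum>i\<in>Ij j. cmod (w i) powr - p)) = p * (\<Sum>i\<in>I. cmod (w i) powr - p)"
        unfolding group[symmetric] sum_distrib_left[symmetric]
        by (subst sum.UNION_disjoint[OF \<open>finite J\<close> finIj disj]) simp
      also have "((1 + cmod z) powr (2 * p)) ^ card J = (1 + cmod z) powr e"
      proof -
        have "0 < 1 + cmod z" by (simp add: add_pos_nonneg)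
        then have "0 < (1 + cmod z) powr (2 * p)" by simp
        from powr_realpow[OF this, of "card J"] show ?thesis by (simp add: e_def powr_powr)
      qed
      also have "K * (1 + cmod z) powr e * exp (p * (\<Sum>i\<in>I. cmod (w i) powr - p)) *
          (\<Prod>i\<in>I. 1 + (cmod z / cmod (w i)) powr p) \<le> K * (1 + cmod z) powr e * exp (p * S) *
          (\<Prod>i\<in>I. 1 + (cmod z / cmod (w i)) powr p)"
        using S p by (intro mult_right_mono mult_left_mono prod_nonneg) (auto simp: K_def add_nonneg_nonneg)
      finally show "cmod (F z) \<le> K * (1 + cmod z) powr e * exp (p * S) *
          (\<Prod>i\<in>I. 1 + (cmod z / cmod (w i)) powr p)" .
    next
      fix v :: complex assume v: "v \<noteq> 0 \<and> cmod v < T"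
      have "has_zero F v (\<Sum>j\<in>J. card {i\<in>Ij j. a j i * cis zero_angle = v * c j})"
        unfolding F_def
        by (intro has_zero_prod has_zero_rotate f(4)) (use v nc in \<open>auto simp: norm_mult\<close>)
      also have "(\<Sum>j\<in>J. card {i\<in>Ij j. a j i * cis zero_angle = v * c j}) = (\<Sum>j\<in>J. card {i\<in>Ij j. w i = v})"
      proof (intro sum.cong refl arg_cong[where f = card] Collect_cong conj_cong)
        fix j i
        have "a j i * cis zero_angle = w i * c j" by (simp add: a_def c_def mult.assoc cis_mult)
        then show "a j i * cis zero_angle = v * c j \<longleftrightarrow> w i = v" using nc by simp
      qed
      also have "\<dots> = card (\<Union>j\<in>J. {i\<in>Ij j. w i = v})"
        using finIj disj \<open>finite J\<close> by (subst card_UN_disjoint) auto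
      also have "(\<Union>j\<in>J. {i\<in>Ij j. w i = v}) = {i\<in>I. w i = v}" using group by blast
      finally show "has_zero F v (card {i\<in>I. w i = v})" .
    qed
  qed
qed

section \<open>Passage to the limit\<close>

text \<open>f n lives on the disc of radius n only. Montel's theorem is therefore applied on each
  disc to a tail of the sequence, and a diagonal subsequence serves all discs.\<close>

lemma Montel_exhausting:
  fixes f :: "nat \<Rightarrow> complex \<Rightarrow> complex" and B :: "real \<Rightarrow> real"
  assumes hol: "\<And>n. f n holomorphic_on ball 0 (real n)"
    and bd: "\<And>r n z. cmod z \<le> r \<Longrightarrow> r < real n \<Longrightarrow> cmod (f n z) \<le> B r"
  obtains g d where "g holomorphic_on UNIV" "strict_mono (d :: nat \<Rightarrow> nat)" "\<And>z. (\<lambda>n. f (d n) z) \<longlonglongrightarrow> g z"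
proof -
  define P where "P = (\<lambda>k s. \<exists>g. g holomorphic_on ball 0 (real k) \<and> (\<forall>z\<in>ball 0 (real k). (\<lambda>n. f (s n) z) \<longlonglongrightarrow> g z))"
  interpret subseqs P
  proof
    fix k :: nat and s :: "nat \<Rightarrow> nat" assume s: "strict_mono s"
    let ?F = "\<lambda>n. f (s (n + k))"
    have sk: "real k \<le> real (s (n + k))" for n
      using seq_suble[OF s, of "n + k"] by simp
    have holF: "?F n holomorphic_on ball 0 (real k)" for n
      by (rule holomorphic_on_subset[OF hol]) (use sk[of n] in auto)
    show "\<exists>r'. strict_mono r' \<and> P k (s \<circ> r')"
    proof (rule Montel[where S = "ball 0 (real k)" and \<H> = "range ?F" and \<F> = ?F])
      show "h holomorphic_on ball 0 (real k)" if "h \<in> range ?F" for h using that holF by auto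
      show "\<exists>B. \<forall>h\<in>range ?F. \<forall>z\<in>K. cmod (h z) \<le> B" if K: "compact K" "K \<subseteq> ball 0 (real k)" for K
      proof (cases "K = {}")
        case False
        obtain x where x: "x \<in> K" "\<And>y. y \<in> K \<Longrightarrow> cmod y \<le> cmod x"
          using continuous_attains_sup[OF K(1) False, of cmod] by (auto intro: continuous_intros)
        have "cmod x < real k" using x(1) K(2) by auto
        then have "cmod (?F n z) \<le> B (cmod x)" if "z \<in> K" for n z
          using x(2)[OF that] sk[of n] by (intro bd) auto
        then show ?thesis by blast
      qed auto
      fix g r assume g: "g holomorphic_on ball 0 (real k)" and r: "strict_mono (r :: nat \<Rightarrow> nat)"
        and lim: "\<And>x. x \<in> ball 0 (real k) \<Longrightarrow> (\<lambda>n. ?F (r n) x) \<longlonglongrightarrow> g x"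
      have "strict_mono (\<lambda>n. r n + k)" using r by (simp add: strict_mono_def)
      moreover have "P k (s \<circ> (\<lambda>n. r n + k))"
        unfolding P_def o_def using g lim by blast
      ultimately show "\<exists>r'. strict_mono r' \<and> P k (s \<circ> r')" by blast
    qed auto
  qed
  have stable: "P k (s \<circ> r)" if "strict_mono r" "P k s" for r s k
  proof -
    obtain g where g: "g holomorphic_on ball 0 (real k)" "\<And>z. z \<in> ball 0 (real k) \<Longrightarrow> (\<lambda>n. f (s n) z) \<longlonglongrightarrow> g z"
      using \<open>P k s\<close> unfolding P_def by blast
    have "(\<lambda>n. f ((s \<circ> r) n) z) \<longlonglongrightarrow> g z" if "z \<in> ball 0 (real k)" for z
      using LIMSEQ_subseq_LIMSEQ[OF g(2)[OF that] \<open>strict_mono r\<close>] by (simp add: o_def)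
    then show ?thesis unfolding P_def using g(1) by blast
  qed
  have holds: "P k (diagseq \<circ> (+) (Suc k))" for k by (rule diagseq_holds[OF stable])
  define g where "g = (\<lambda>z. lim (\<lambda>n. f (diagseq n) z))"
  have loc: "\<exists>G. G holomorphic_on ball 0 (real k) \<and> (\<forall>z\<in>ball 0 (real k). (\<lambda>n. f (diagseq n) z) \<longlonglongrightarrow> G z)" for k
  proof -
    obtain G where G: "G holomorphic_on ball 0 (real k)"
      "\<And>z. z \<in> ball 0 (real k) \<Longrightarrow> (\<lambda>n. f (diagseq (Suc k + n)) z) \<longlonglongrightarrow> G z"
      using holds[of k] unfolding P_def by auto
    have "(\<lambda>n. f (diagseq n) z) \<longlonglongrightarrow> G z" if "z \<in> ball 0 (real k)" for z
      using G(2)[OF that] LIMSEQ_ignore_initial_segment LIMSEQ_offset[of "\<lambda>n. f (diagseq n) z" "Suc k" "G z"]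
      by (simp add: add.commute)
    then show ?thesis using G(1) by blast
  qed
  have lim: "(\<lambda>n. f (diagseq n) z) \<longlonglongrightarrow> g z" for z
  proof -
    obtain k where "cmod z < real k" using reals_Archimedean2 by blast
    then have "z \<in> ball 0 (real k)" by simp
    then obtain y where y: "(\<lambda>n. f (diagseq n) z) \<longlonglongrightarrow> y" using loc[of k] by blast
    then show ?thesis using limI[OF y] by (simp add: g_def)
  qed
  have "g analytic_on UNIV"
    unfolding analytic_on_def
  proof
    fix z :: complex
    obtain k where k: "cmod z + 1 < real k" using reals_Archimedean2 by blast
    obtain G where G: "G holomorphic_on ball 0 (real k)" "\<And>z. z \<in> ball 0 (real k) \<Longrightarrow> (\<lambda>n. f (diagseq n) z) \<longlonglongrightarrow> G z"
      using loc[of k] by blast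
    have sub: "ball z 1 \<subseteq> ball 0 (real k)"
    proof
      fix x assume "x \<in> ball z 1"
      then show "x \<in> ball 0 (real k)" using k norm_triangle_ineq2[of x z] by (simp add: dist_norm norm_minus_commute)
    qed
    have "g holomorphic_on ball z 1"
      by (rule holomorphic_transform[OF holomorphic_on_subset[OF G(1) sub]])
         (use G(2) lim sub LIMSEQ_unique in blast)
    then show "\<exists>\<epsilon>>0. g holomorphic_on ball z \<epsilon>" by (intro exI[of _ 1]) simp
  qed
  then have "g holomorphic_on UNIV" by (rule analytic_imp_holomorphic)
  then show thesis using that subseq_diagseq lim by blast
qed

text \<open>The maximum principle for the quotient of f n by (z - v)^m on the closed unit disc
  around v gives |f n z| \<le> K |z - v|^m with K independent of n; so pointwise convergence is
  enough.\<close>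

lemma has_zero_limit:
  assumes hol: "\<And>n. f n holomorphic_on ball v 2" and z: "\<And>n. has_zero (f n) v m"
    and bd: "\<And>n z. dist v z = 1 \<Longrightarrow> cmod (f n z) \<le> K" and lim: "\<And>z. dist v z < 1 \<Longrightarrow> (\<lambda>n. f n z) \<longlonglongrightarrow> g z"
  shows "has_zero g v m"
proof -
  have le: "cmod (f n z) \<le> K * cmod ((z - v) ^ m)" if zv: "dist v z < 1" for n z
  proof -
    obtain F where F: "F holomorphic_on ball v 2" "\<And>z. z \<in> ball v 2 \<Longrightarrow> f n z = (z - v) ^ m * F z"
      using has_zero_factor[OF hol open_ball _ z, of n] by auto
    have sub: "cball v 1 \<subseteq> ball v (2::real)" by auto
    have "cmod (F z) \<le> K"
    proof (rule maximum_modulus_frontier[where f = F and \<xi> = z and S = "cball v 1"])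
      show "F holomorphic_on interior (cball v 1)"
        by (rule holomorphic_on_subset[OF F(1)]) (use sub interior_subset in blast)
      show "continuous_on (closure (cball v 1)) F"
        using holomorphic_on_imp_continuous_on[OF F(1)] sub by (auto intro: continuous_on_subset)
      fix x assume "x \<in> frontier (cball v 1)"
      then have x: "dist v x = 1" by simp
      then have "cmod (f n x) = cmod (F x)"
        using F(2)[of x] by (simp add: norm_mult norm_power dist_norm norm_minus_commute)
      then show "cmod (F x) \<le> K" using bd[OF x, of n] by simp
    qed (use zv in auto)
    then have "cmod ((z - v) ^ m) * cmod (F z) \<le> cmod ((z - v) ^ m) * K" by (intro mult_left_mono) auto
    then show ?thesis using F(2)[of z] zv by (simp add: norm_mult mult.commute)
  qed
  have "cmod (g z) \<le> K * cmod ((z - v) ^ m)" if "dist v z < 1" for z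
    using tendsto_norm[OF lim[OF that]] le[OF that] by (intro LIMSEQ_le_const2) auto
  moreover have "\<forall>\<^sub>F z in nhds v. z \<in> ball v 1" by (intro eventually_nhds_in_open) auto
  ultimately have "\<forall>\<^sub>F z in nhds v. cmod (g z) \<le> K * cmod ((z - v) ^ m)" by (auto elim: eventually_mono)
  then show ?thesis unfolding has_zero_def by (rule bigoI)
qed

section \<open>Zeros listed with multiplicity and functions on discs\<close>

text \<open>A point of multiplicity k occurs in k pairs, which makes products over zeros ordinary
  products over a finite set.\<close>

definition zero_index :: "(complex \<Rightarrow> enat) \<Rightarrow> nat \<Rightarrow> (complex \<times> nat) set" where
  "zero_index Z n = (SIGMA w:local_support Z (real n). {..<the_enat (Z w)})"

context
  fixes Z :: "complex \<Rightarrow> enat"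
  assumes fin: "\<And>r. r \<ge> 0 \<Longrightarrow> radial_count Z r < \<infinity>" and Z0: "Z 0 = 0"
begin

lemma finite_zero_index: "finite (zero_index Z n)"
  unfolding zero_index_def using local_support_facts(1)[OF fin] by (intro finite_SigmaI) auto

lemma zero_index_mono: "m \<le> n \<Longrightarrow> zero_index Z m \<subseteq> zero_index Z n"
  by (fastforce simp: zero_index_def local_support_def)

lemma zero_index_nonzero: "i \<in> zero_index Z n \<Longrightarrow> fst i \<noteq> 0"
  using Z0 by (auto simp: zero_index_def local_support_def)

lemma Z_finite: "Z w = enat (the_enat (Z w))"
  using local_support_facts(2)[OF fin[of "cmod w"], of w] by (cases "Z w") auto

lemma card_zero_index:
  assumes "cmod v \<le> real n"
  shows "card {i \<in> zero_index Z n. fst i = v} = the_enat (Z v)"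
proof (cases "Z v = 0")
  case True
  then have e: "{i \<in> zero_index Z n. fst i = v} = {}" by (auto simp: zero_index_def local_support_def)
  show ?thesis unfolding e using True by (simp add: zero_enat_def)
next
  case False
  then have "{i \<in> zero_index Z n. fst i = v} = {v} \<times> {..<the_enat (Z v)}"
    using assms by (auto simp: zero_index_def local_support_def)
  then show ?thesis by simp
qed

lemma sum_zero_index:
  fixes g :: "complex \<Rightarrow> real"
  shows "(\<Sum>i\<in>zero_index Z n. g (fst i)) = (\<Sum>w\<in>local_support Z (real n). real (the_enat (Z w)) * g w)"
proof -
  have "(\<Sum>i\<in>zero_index Z n. g (fst i)) = (\<Sum>w\<in>local_support Z (real n). \<Sum>k<the_enat (Z w). g w)"
    unfolding zero_index_def
    by (subst sum.Sigma) (use local_support_facts(1)[OF fin] in \<open>auto simp: case_prod_unfold\<close>)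
  then show ?thesis by simp
qed

lemma one_plus_le_powr:
  fixes p x :: real
  assumes "1 \<le> p" "0 \<le> x"
  shows "(1 + x) powr p \<le> 2 powr p * (1 + x powr p)"
proof (cases "x \<le> 1")
  case True
  then have "(1 + x) powr p \<le> 2 powr p" using assms by (intro powr_mono2) auto
  also have "\<dots> \<le> 2 powr p * (1 + x powr p)" by simp
  finally show ?thesis .
next
  case False
  then have "(1 + x) powr p \<le> (2 * x) powr p" using assms by (intro powr_mono2) auto
  also have "\<dots> = 2 powr p * x powr p" by (rule powr_mult)
  also have "\<dots> \<le> 2 powr p * (1 + x powr p)" by (intro mult_left_mono) auto
  finally show ?thesis .
qed

text \<open>Serves with exponent p itself when p is an integer, and with exponent 1 for the linear
  factors that compensate the loss in the other case.\<close>

lemma power_product: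
  fixes w :: "'i \<Rightarrow> complex"
  assumes "finite I" "\<And>i. i \<in> I \<Longrightarrow> w i \<noteq> 0" and q: "1 \<le> q"
  defines "f \<equiv> \<lambda>z. \<Prod>i\<in>I. 1 - (z / w i) ^ q"
  shows "f holomorphic_on S" "f 0 = 1" "cmod (f z) \<le> (\<Prod>i\<in>I. 1 + (cmod z / cmod (w i)) ^ q)"
    "has_zero f v (card {i\<in>I. w i = v})"
proof -
  show "f holomorphic_on S" unfolding f_def using assms(2) by (intro holomorphic_intros) auto
  show "f 0 = 1" using q by (simp add: f_def power_0_left)
  have "cmod (1 - (z / w i) ^ q) \<le> 1 + (cmod z / cmod (w i)) ^ q" for i
    using norm_triangle_ineq4[of 1 "(z / w i) ^ q"] by (simp add: norm_divide norm_power)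
  then show "cmod (f z) \<le> (\<Prod>i\<in>I. 1 + (cmod z / cmod (w i)) ^ q)"
    unfolding f_def prod_norm[symmetric] by (intro prod_mono) auto
  have "has_zero (\<lambda>z. 1 - (z / w i) ^ q) v (if w i = v then 1 else 0)" if "i \<in> I" for i
  proof (cases "w i = v")
    case True
    have "(\<lambda>z. 1 - (z / w i) ^ q) analytic_on {v}" using assms(2)[OF that] by (intro analytic_intros) auto
    then show ?thesis using True assms(2)[OF that] has_zero_1[of "\<lambda>z. 1 - (z / w i) ^ q" v] by auto
  next
    case False
    have "isCont (\<lambda>z. 1 - (z / w i) ^ q) v" using assms(2)[OF that] by (intro continuous_intros) auto
    then show ?thesis using False has_zero_0 by simp
  qed
  then have "has_zero f v (\<Sum>i\<in>I. if w i = v then 1 else 0)" unfolding f_def by (rule has_zero_prod)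
  moreover have "(\<Sum>i\<in>I. if w i = v then 1 else 0) = card {i\<in>I. w i = v}"
    using sum.inter_filter[OF assms(1), of "\<lambda>_. 1::nat" "\<lambda>i. w i = v"] by simp
  ultimately show "has_zero f v (card {i\<in>I. w i = v})" by simp
qed

text \<open>The constant is a parameter because it has to be the same for all n in the passage to
  the limit.\<close>

definition level_function :: "real \<Rightarrow> real \<Rightarrow> nat \<Rightarrow> (complex \<Rightarrow> complex) \<Rightarrow> bool" where
  "level_function p C n f \<longleftrightarrow> f holomorphic_on ball 0 (real n) \<and> f 0 = 1 \<and>
    (\<forall>z. cmod z < real n \<longrightarrow> cmod (f z) \<le> C * (\<Prod>i\<in>zero_index Z n. 1 + (cmod z / cmod (fst i)) powr p)) \<and>
    (\<forall>v. v \<noteq> 0 \<and> cmod v < real n \<longrightarrow> has_zero f v (the_enat (Z v)))"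

lemma level_function_nat:
  assumes p: "p \<in> \<nat>" "1 \<le> p"
  shows "\<exists>f. level_function p 1 n f"
proof -
  obtain q where q: "p = real q" using p(1) by (auto simp: Nats_def)
  then have q1: "1 \<le> q" using p(2) by simp
  have nz: "fst i \<noteq> 0" if "i \<in> zero_index Z n" for i using that by (rule zero_index_nonzero)
  note f = power_product[where w = fst, OF finite_zero_index[of n] nz q1]
  have "(cmod z / cmod (fst i)) powr p = (cmod z / cmod (fst i)) ^ q" for z and i :: "complex \<times> nat"
    using q q1 powr_realpow'[of "cmod z / cmod (fst i)" q] by simp
  then have "level_function p 1 n (\<lambda>z. \<Prod>i\<in>zero_index Z n. 1 - (z / fst i) ^ q)"
    unfolding level_function_def using f(1-3)
  proof (intro conjI allI impI)
    fix v :: complex assume "v \<noteq> 0 \<and> cmod v < real n"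
    then show "has_zero (\<lambda>z. \<Prod>i\<in>zero_index Z n. 1 - (z / fst i) ^ q) v (the_enat (Z v))"
      using f(4)[of v] card_zero_index[of v n] by simp
  qed auto
  then show ?thesis by blast
qed

text \<open>
  The power of \<open>1 + cmod z\<close> lost in \<open>noninteger_level\<close> is recovered: finitely many points are
  removed and taken care of by linear factors, each of which gains a factor \<open>(1 + cmod z) powr (p - 1)\<close>.
\<close>
lemma level_function_noninteger:
  assumes p: "1 < p" "p \<notin> \<nat>" and S: "\<And>n. (\<Sum>i\<in>zero_index Z n. cmod (fst i) powr - p) \<le> S"
  shows "\<exists>C n0. \<forall>n\<ge>n0. \<exists>f. level_function p C n f"
proof -
  obtain K e :: real where Ke: "K \<ge> 0" "e \<ge> 0"
    and lev: "\<And>(I :: (complex \<times> nat) set) w S T. finite I \<Longrightarrow> (\<And>i. i \<in> I \<Longrightarrow> w i \<noteq> 0) \<Longrightarrow>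
      (\<Sum>i\<in>I. cmod (w i) powr - p) \<le> S \<Longrightarrow> T > 0 \<Longrightarrow>
      \<exists>f. f holomorphic_on ball 0 T \<and> f 0 = 1 \<and>
        (\<forall>z. cmod z < T \<longrightarrow> cmod (f z) \<le> K * (1 + cmod z) powr e * exp (p * S) *
          (\<Prod>i\<in>I. 1 + (cmod z / cmod (w i)) powr p)) \<and>
        (\<forall>v. v \<noteq> 0 \<and> cmod v < T \<longrightarrow> has_zero f v (card {i\<in>I. w i = v}))"
    using noninteger_level[OF p] by blast
  show ?thesis
  proof (cases "\<exists>n0. e \<le> (p - 1) * real (card (zero_index Z n0))")
    case True
    then obtain n0 where n0: "e \<le> (p - 1) * real (card (zero_index Z n0))" ..
    define F where "F = zero_index Z n0"
    have F: "finite F" "\<And>i. i \<in> F \<Longrightarrow> fst i \<noteq> 0" unfolding F_def using finite_zero_index zero_index_nonzero by blast+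
    \<comment> \<open>With s the modulus of the point, this comes from 1 + r \<le> max 1 s * (1 +
      r/s) and (1 + x)^p \<le> 2^p (1 + x^p).\<close>
    define c where "c = (\<lambda>i :: complex \<times> nat. (max 1 (cmod (fst i))) powr (p - 1) * 2 powr p)"
    have c0: "c i \<ge> 0" for i by (simp add: c_def)
    define C where "C = K * exp (p * S) * (\<Prod>i\<in>F. c i)"
    have factor: "(1 + r) powr (p - 1) * (1 + r / cmod (fst i)) \<le> c i * (1 + (r / cmod (fst i)) powr p)"
      if i: "i \<in> F" and r: "0 \<le> r" for i r
    proof -
      define s x where "s = cmod (fst i)" and "x = r / s"
      have s: "s > 0" using F(2)[OF i] by (simp add: s_def)
      have x: "0 \<le> x" using r s by (simp add: x_def)
      have "1 + r \<le> max 1 s * (1 + x)"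
      proof -
        have "r = s * x" using s by (simp add: x_def)
        also have "\<dots> \<le> max 1 s * x" using x by (intro mult_right_mono) auto
        finally show ?thesis by (simp add: distrib_left)
      qed
      then have "(1 + r) powr (p - 1) \<le> (max 1 s * (1 + x)) powr (p - 1)" using p r by (intro powr_mono2) auto
      also have "\<dots> = max 1 s powr (p - 1) * (1 + x) powr (p - 1)" by (rule powr_mult)
      finally have "(1 + r) powr (p - 1) * (1 + x) \<le> max 1 s powr (p - 1) * (1 + x) powr (p - 1) * (1 + x)"
        using x by (intro mult_right_mono) auto
      also have "\<dots> = max 1 s powr (p - 1) * (1 + x) powr p"
        using x by (simp add: powr_diff)
      also have "\<dots> \<le> max 1 s powr (p - 1) * (2 powr p * (1 + x powr p))"
        using p x by (intro mult_left_mono one_plus_le_powr) auto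
      finally show ?thesis by (simp add: c_def s_def[symmetric] x_def mult.assoc)
    qed
    have "\<exists>f. level_function p C n f" if n: "n \<ge> max 1 n0" for n
    proof -
      define I where "I = zero_index Z n - F"
      have I: "finite I" "\<And>i. i \<in> I \<Longrightarrow> fst i \<noteq> 0"
        unfolding I_def using finite_zero_index zero_index_nonzero by blast+
      have sub: "F \<subseteq> zero_index Z n" unfolding F_def using n by (intro zero_index_mono) auto
      then have split: "zero_index Z n = F \<union> I" "F \<inter> I = {}" by (auto simp: I_def)
      have "(\<Sum>i\<in>I. cmod (fst i) powr - p) \<le> (\<Sum>i\<in>zero_index Z n. cmod (fst i) powr - p)"
        unfolding I_def by (intro sum_mono2 finite_zero_index) auto
      also have "\<dots> \<le> S" by (rule S)
      finally have SI: "(\<Sum>i\<in>I. cmod (fst i) powr - p) \<le> S" .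
      have Tn: "0 < real n" using n by simp
      obtain f where f: "f holomorphic_on ball 0 (real n)" "f 0 = 1"
        "\<And>z. cmod z < real n \<Longrightarrow> cmod (f z) \<le> K * (1 + cmod z) powr e * exp (p * S) *
          (\<Prod>i\<in>I. 1 + (cmod z / cmod (fst i)) powr p)"
        "\<And>v. v \<noteq> 0 \<Longrightarrow> cmod v < real n \<Longrightarrow> has_zero f v (card {i\<in>I. fst i = v})"
        using lev[where w = fst, OF I SI Tn] by blast
      note g = power_product[where w = fst, OF F order_refl, unfolded power_one_right]
      let ?g = "\<lambda>z. \<Prod>i\<in>F. 1 - z / fst i"
      have "level_function p C n (\<lambda>z. ?g z * f z)"
        unfolding level_function_def
      proof (intro conjI allI impI)
        show "(\<lambda>z. ?g z * f z) holomorphic_on ball 0 (real n)" by (intro holomorphic_on_mult g(1) f(1))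
        show "?g 0 * f 0 = 1" using g(2) f(2) by simp
      next
        fix z :: complex assume z: "cmod z < real n"
        define r where "r = cmod z"
        have r: "0 \<le> r" by (simp add: r_def)
        let ?P = "\<lambda>A. \<Prod>i\<in>A. 1 + (r / cmod (fst i)) powr p"
        have P0: "?P A \<ge> 0" for A :: "(complex \<times> nat) set" by (intro prod_nonneg ballI add_nonneg_nonneg) auto
        have "cmod (?g z * f z) \<le> (\<Prod>i\<in>F. 1 + r / cmod (fst i)) * (K * (1 + r) powr e * exp (p * S) * ?P I)"
          unfolding norm_mult r_def using g(3)[of z] f(3)[OF z]
          by (intro mult_mono prod_nonneg ballI add_nonneg_nonneg) auto
        also have "\<dots> = (K * exp (p * S) * ?P I) * ((1 + r) powr e * (\<Prod>i\<in>F. 1 + r / cmod (fst i)))"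
          by (simp only: mult_ac)
        also have "\<dots> \<le> (K * exp (p * S) * ?P I) * ((\<Prod>i\<in>F. c i) * ?P F)"
        proof (intro mult_left_mono)
          have "(1 + r) powr e \<le> (1 + r) powr ((p - 1) * real (card F))"
            using n0 r unfolding F_def by (intro powr_mono) auto
          also have "\<dots> = (\<Prod>i\<in>F. (1 + r) powr (p - 1))"
          proof -
            have "0 < (1 + r) powr (p - 1)" using r by simp
            from powr_realpow[OF this, of "card F"] show ?thesis by (simp add: powr_powr)
          qed
          finally have "(1 + r) powr e * (\<Prod>i\<in>F. 1 + r / cmod (fst i)) \<le>
              (\<Prod>i\<in>F. (1 + r) powr (p - 1)) * (\<Prod>i\<in>F. 1 + r / cmod (fst i))"
            using r by (intro mult_right_mono prod_nonneg) auto
          also have "\<dots> \<le> (\<Prod>i\<in>F. c i * (1 + (r / cmod (fst i)) powr p))"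
            unfolding prod.distrib[symmetric] using r factor by (intro prod_mono) auto
          finally show "(1 + r) powr e * (\<Prod>i\<in>F. 1 + r / cmod (fst i)) \<le> (\<Prod>i\<in>F. c i) * ?P F"
            by (simp add: prod.distrib)
          show "0 \<le> K * exp (p * S) * ?P I" using Ke P0 by simp
        qed
        also have "\<dots> = C * (?P F * ?P I)" by (simp add: C_def mult_ac)
        also have "?P F * ?P I = ?P (zero_index Z n)"
          unfolding split(1) using F I split(2) by (intro prod.union_disjoint[symmetric]) auto
        finally show "cmod (?g z * f z) \<le> C * (\<Prod>i\<in>zero_index Z n. 1 + (cmod z / cmod (fst i)) powr p)"
          by (simp add: r_def)
      next
        fix v :: complex assume v: "v \<noteq> 0 \<and> cmod v < real n"
        have "has_zero (\<lambda>z. ?g z * f z) v (card {i\<in>F. fst i = v} + card {i\<in>I. fst i = v})"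
          using v by (intro has_zero_mult g(4) f(4)) auto
        also have "card {i\<in>F. fst i = v} + card {i\<in>I. fst i = v} = card ({i\<in>F. fst i = v} \<union> {i\<in>I. fst i = v})"
          using F I split(2) by (intro card_Un_disjoint[symmetric]) auto
        also have "{i\<in>F. fst i = v} \<union> {i\<in>I. fst i = v} = {i\<in>zero_index Z n. fst i = v}"
          using split(1) by blast
        also have "card \<dots> = the_enat (Z v)" using v by (intro card_zero_index) auto
        finally show "has_zero (\<lambda>z. ?g z * f z) v (the_enat (Z v))" .
      qed
      then show ?thesis by blast
    qed
    then show ?thesis by blast
  next
    case False
    \<comment> \<open>In this case the number of points is bounded, so \<open>zero_index\<close> is
      constant from some level on. Linear factors alone then do, each at the price of a constant
      2^p.\<close>
    then have small: "real (card (zero_index Z n)) \<le> e / (p - 1)" for n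
      using p by (auto simp: field_simps not_le intro: less_imp_le)
    have "card (zero_index Z n) \<le> nat \<lfloor>e / (p - 1)\<rfloor>" for n
      using small[of n] by (simp add: le_nat_floor)
    then have "\<exists>n0. \<forall>n. card (zero_index Z n) \<le> card (zero_index Z n0)"
      using ex_has_greatest_nat[of "\<lambda>_. True" 0 "\<lambda>n. card (zero_index Z n)" "Suc (nat \<lfloor>e / (p - 1)\<rfloor>)"]
      by (auto simp: le_imp_less_Suc)
    then obtain n0 where n0: "\<And>n. card (zero_index Z n) \<le> card (zero_index Z n0)" by blast
    define F where "F = zero_index Z n0"
    have F: "finite F" "\<And>i. i \<in> F \<Longrightarrow> fst i \<noteq> 0" unfolding F_def using finite_zero_index zero_index_nonzero by blast+
    note g = power_product[where w = fst, OF F order_refl, unfolded power_one_right]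
    let ?g = "\<lambda>z. \<Prod>i\<in>F. 1 - z / fst i"
    have "level_function p ((2 powr p) ^ card F) n ?g" if n: "n \<ge> n0" for n
    proof -
      have "F \<subseteq> zero_index Z n" unfolding F_def by (rule zero_index_mono[OF n])
      then have FI: "zero_index Z n = F"
        using card_seteq[OF finite_zero_index[of n], of F] n0[of n] by (simp add: F_def)
      show ?thesis
        unfolding level_function_def FI
      proof (intro conjI allI impI g(1,2))
        fix z :: complex
        have "1 + cmod z / cmod (fst i) \<le> 2 powr p * (1 + (cmod z / cmod (fst i)) powr p)" for i :: "complex \<times> nat"
        proof -
          define x where "x = cmod z / cmod (fst i)"
          have x: "0 \<le> x" by (simp add: x_def)
          have "(1 + x) powr 1 \<le> (1 + x) powr p" using p x by (intro powr_mono) auto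
          also have "\<dots> \<le> 2 powr p * (1 + x powr p)" using p x by (intro one_plus_le_powr) auto
          finally show ?thesis using x by (simp add: x_def)
        qed
        then have "(\<Prod>i\<in>F. 1 + cmod z / cmod (fst i)) \<le> (\<Prod>i\<in>F. 2 powr p * (1 + (cmod z / cmod (fst i)) powr p))"
          by (intro prod_mono) auto
        then show "cmod (?g z) \<le> (2 powr p) ^ card F * (\<Prod>i\<in>F. 1 + (cmod z / cmod (fst i)) powr p)"
          using g(3)[of z] by (simp add: prod.distrib)
      next
        fix v :: complex assume v: "v \<noteq> 0 \<and> cmod v < real n"
        then show "has_zero ?g v (the_enat (Z v))"
          using g(4)[of v] card_zero_index[of v n] FI by simp
      qed
    qed
    then show ?thesis by blast
  qed
qed

text \<open>ln (1 + x) \<le> x bounds the functions on the disc of radius r by C exp (r^p S),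
  uniformly in the level, as Montel's theorem requires. The final estimate keeps the sharper
  logarithmic sums: any common bound \<open>B\<close> of them passes to the limit.\<close>

lemma bounded_function_exists:
  assumes p: "1 \<le> p" and S: "\<And>n. (\<Sum>i\<in>zero_index Z n. cmod (fst i) powr - p) \<le> S"
  obtains C f where "C \<ge> 1" "f holomorphic_on UNIV" "f 0 = 1"
    "\<And>z B. (\<And>n. (\<Sum>i\<in>zero_index Z n. ln (1 + (cmod z / cmod (fst i)) powr p)) \<le> B) \<Longrightarrow> cmod (f z) \<le> C * exp B"
    "\<And>v. has_zero f v (the_enat (Z v))"
proof -
  have "\<exists>C n0. \<forall>n\<ge>n0. \<exists>f. level_function p C n f"
  proof (cases "p \<in> \<nat>")
    case True
    then show ?thesis using level_function_nat p by blast
  next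
    case False
    then have "1 < p" using p by (metis Nats_1 less_eq_real_def)
    then show ?thesis using level_function_noninteger False S by blast
  qed
  then obtain C0 n0 where lev0: "\<forall>n\<ge>n0. \<exists>f. level_function p C0 n f" by blast
  \<comment> \<open>The maximum makes the constant positive, so that f can later be divided by
    it.\<close>
  define C where "C = max 1 C0"
  have P_exp: "(\<Prod>i\<in>zero_index Z n. 1 + (r / cmod (fst i)) powr p) =
      exp (\<Sum>i\<in>zero_index Z n. ln (1 + (r / cmod (fst i)) powr p))" for n r
    unfolding exp_sum[OF finite_zero_index] by (intro prod.cong refl) (simp add: add_pos_nonneg)
  have "\<forall>n. \<exists>f. level_function p C0 (n0 + n) f" using lev0 by simp
  from choice[OF this] obtain F where F: "\<forall>n. level_function p C0 (n0 + n) (F n)" ..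
  have F1: "F n holomorphic_on ball 0 (real (n0 + n))" and F2: "F n 0 = 1"
    and F4: "v \<noteq> 0 \<Longrightarrow> cmod v < real (n0 + n) \<Longrightarrow> has_zero (F n) v (the_enat (Z v))" for n v
    using F unfolding level_function_def by blast+
  have F3: "cmod (F n z) \<le> C * exp (\<Sum>i\<in>zero_index Z (n0 + n). ln (1 + (cmod z / cmod (fst i)) powr p))"
    if "cmod z < real (n0 + n)" for n z
  proof -
    have "cmod (F n z) \<le> C0 * (\<Prod>i\<in>zero_index Z (n0 + n). 1 + (cmod z / cmod (fst i)) powr p)"
      using F that unfolding level_function_def by blast
    also have "\<dots> \<le> C * exp (\<Sum>i\<in>zero_index Z (n0 + n). ln (1 + (cmod z / cmod (fst i)) powr p))"
      unfolding P_exp by (intro mult_right_mono) (auto simp: C_def)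
    finally show ?thesis .
  qed
  have V: "(\<Sum>i\<in>zero_index Z n. ln (1 + (s / cmod (fst i)) powr p)) \<le> r powr p * S"
    if "0 \<le> s" "s \<le> r" for s r n
  proof -
    have "(\<Sum>i\<in>zero_index Z n. ln (1 + (s / cmod (fst i)) powr p)) \<le> (\<Sum>i\<in>zero_index Z n. r powr p * cmod (fst i) powr - p)"
    proof (intro sum_mono)
      fix i
      have "ln (1 + (s / cmod (fst i)) powr p) \<le> (s / cmod (fst i)) powr p" by (intro ln_add_one_self_le_self) simp
      also have "\<dots> \<le> (r / cmod (fst i)) powr p" using that p by (intro powr_mono2 divide_right_mono) auto
      also have "\<dots> = r powr p * cmod (fst i) powr - p" proof -
        have "(r / cmod (fst i)) powr p = r powr p / cmod (fst i) powr p" using that by (simp add: powr_divide)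
        then show ?thesis by (simp add: powr_minus divide_inverse)
      qed
      finally show "ln (1 + (s / cmod (fst i)) powr p) \<le> r powr p * cmod (fst i) powr - p" .
    qed
    also have "\<dots> = r powr p * (\<Sum>i\<in>zero_index Z n. cmod (fst i) powr - p)" by (simp add: sum_distrib_left)
    also have "\<dots> \<le> r powr p * S" by (intro mult_left_mono S) auto
    finally show ?thesis .
  qed
  define M where "M = (\<lambda>r. C * exp (r powr p * S))"
  have FM: "cmod (F n z) \<le> M r" if "cmod z \<le> r" "r < real n" for r n z
  proof -
    have "cmod (F n z) \<le> C * exp (\<Sum>i\<in>zero_index Z (n0 + n). ln (1 + (cmod z / cmod (fst i)) powr p))"
      using that by (intro F3) auto
    also have "\<dots> \<le> M r" unfolding M_def using that by (intro mult_left_mono) (auto simp: C_def intro: V)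
    finally show ?thesis .
  qed
  have holF: "F n holomorphic_on ball 0 (real n)" for n
    by (rule holomorphic_on_subset[OF F1]) auto
  obtain f d where f: "f holomorphic_on UNIV" and d: "strict_mono (d :: nat \<Rightarrow> nat)" and lim: "\<And>z. (\<lambda>n. F (d n) z) \<longlonglongrightarrow> f z"
    using Montel_exhausting[where B = M, OF holF FM] by blast
  have dn: "n \<le> d n" for n by (rule seq_suble[OF d])
  show thesis
  proof (rule that[of C f])
    show "C \<ge> 1" by (simp add: C_def)
    show "f holomorphic_on UNIV" by (rule f)
    show "f 0 = 1" using lim[of 0] F2 LIMSEQ_unique[of "\<lambda>n. F (d n) 0" "f 0" 1] by simp
  next
    fix z B assume B: "\<And>n. (\<Sum>i\<in>zero_index Z n. ln (1 + (cmod z / cmod (fst i)) powr p)) \<le> B"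
    obtain N where N: "cmod z < real N" using reals_Archimedean2 by blast
    have "cmod (F (d n) z) \<le> C * exp B" if "n \<ge> N" for n
    proof -
      have "N \<le> n0 + d n" using that dn[of n] by simp
      then have "cmod (F (d n) z) \<le> C * exp (\<Sum>i\<in>zero_index Z (n0 + d n). ln (1 + (cmod z / cmod (fst i)) powr p))"
        using N by (intro F3) linarith
      also have "\<dots> \<le> C * exp B" using B by (intro mult_left_mono) (auto simp: C_def)
      finally show ?thesis .
    qed
    then show "cmod (f z) \<le> C * exp B"
      by (intro LIMSEQ_le_const2[OF tendsto_norm[OF lim]]) blast
  next
    fix v
    show "has_zero f v (the_enat (Z v))"
    proof (cases "v = 0")
      case True
      have "has_zero f 0 0" by (intro has_zero_0 holomorphic_on_imp_isCont[OF f]) simp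
      then show ?thesis using True Z0 by (simp add: zero_enat_def)
    next
      case False
      obtain N where N: "cmod v + 2 < real N" using reals_Archimedean2 by blast
      have big: "cmod v + 2 < real (d (n + N))" for n using N dn[of "n + N"] by linarith
      have sub: "cmod x < cmod v + 2" if "dist v x < 2" for x
        using that norm_triangle_ineq2[of x v] by (simp add: dist_norm norm_minus_commute)
      show ?thesis
      proof (rule has_zero_limit[where f = "\<lambda>n. F (d (n + N))" and K = "M (cmod v + 1)"])
        show "F (d (n + N)) holomorphic_on ball v 2" for n
        proof (rule holomorphic_on_subset[OF holF])
          show "ball v 2 \<subseteq> ball 0 (real (d (n + N)))" using sub big[of n] by fastforce
        qed
        show "has_zero (F (d (n + N))) v (the_enat (Z v))" for n
          using big[of n] False by (intro F4) auto
        show "cmod (F (d (n + N)) x) \<le> M (cmod v + 1)" if "dist v x = 1" for n x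
          using that big[of n] norm_triangle_ineq2[of x v] by (intro FM) (auto simp: dist_norm norm_minus_commute)
        show "(\<lambda>n. F (d (n + N)) x) \<longlonglongrightarrow> f x" for x
          using LIMSEQ_ignore_initial_segment[OF lim] .
      qed
    qed
  qed
qed

section \<open>The divergent case and the conclusion\<close>

text \<open>Meant for the case where the integral is infinite for every r > 0. The set is infinite
  because the product runs over a sequence indexed by all natural numbers whose range is this
  set.\<close>

lemma weierstrass_function_exists:
  assumes "infinite {w. Z w \<noteq> 0}"
  obtains f where "f holomorphic_on UNIV" "f 0 = 1" "\<And>v. has_zero f v (the_enat (Z v))"
proof -
  let ?A = "{w. Z w \<noteq> 0}"
  have finA: "finite (?A \<inter> cball 0 r)" if "r \<ge> 0" for r
  proof -
    have "?A \<inter> cball 0 r = local_support Z r" by (auto simp: local_support_def)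
    then show ?thesis using local_support_facts(1)[OF fin[OF that]] by simp
  qed
  have cl: "closed ?A"
    unfolding closed_limpt
  proof (intro allI impI)
    fix x assume x: "x islimpt ?A"
    have "x islimpt (?A \<inter> cball 0 (cmod x + 1))"
    proof (rule islimptI)
      fix U assume U: "x \<in> U" "open U"
      have "x \<in> U \<inter> ball 0 (cmod x + 1)" using U by simp
      moreover have "open (U \<inter> ball 0 (cmod x + 1))" using U by blast
      ultimately obtain y where "y \<in> ?A" "y \<in> U \<inter> ball 0 (cmod x + 1)" "y \<noteq> x"
        using x unfolding islimpt_def by blast
      then show "\<exists>y\<in>?A \<inter> cball 0 (cmod x + 1). y \<in> U \<and> y \<noteq> x" by force
    qed
    moreover have "finite (?A \<inter> cball 0 (cmod x + 1))" by (rule finA) simp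
    ultimately show "x \<in> ?A" using islimpt_finite by blast
  qed
  have pos: "the_enat (Z w) > 0" if "w \<in> ?A" for w
  proof (rule ccontr)
    assume "\<not> the_enat (Z w) > 0"
    then have "Z w = 0" using Z_finite[of w] by (simp add: zero_enat_def)
    then show False using that by simp
  qed
  obtain s :: "nat \<Rightarrow> complex" where s: "range s = ?A" "filterlim s at_infinity at_top"
    "\<And>z. z \<in> ?A \<Longrightarrow> finite (s -` {z}) \<and> card (s -` {z}) = the_enat (Z z)"
  proof (rule sequence_of_sparse_set_exists'[where c = "\<lambda>w. the_enat (Z w)", OF assms cl finA pos])
    fix f :: "nat \<Rightarrow> complex"
    assume "range f = ?A" "filterlim f at_infinity at_top"
      "\<And>z. z \<in> ?A \<Longrightarrow> finite (f -` {z}) \<and> card (f -` {z}) = the_enat (Z z)"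
    then show thesis by (rule that)
  qed
  interpret W: weierstrass_product' s
  proof
    show "s n \<noteq> 0" for n
    proof -
      have "s n \<in> ?A" using s(1) by blast
      then show ?thesis using Z0 by auto
    qed
    show "finite (s -` {z})" if "z \<in> range s" for z using s that by blast
  qed (rule s(2))
  have W0: "W.f 0 \<noteq> 0" using W.zero[of 0] W.a_nonzero by force
  have hol: "W.f holomorphic_on UNIV" by (rule W.holomorphic)
  have Wz: "has_zero W.f v (the_enat (Z v))" for v
  proof (cases "Z v = 0")
    case True
    have "has_zero W.f v 0" by (intro has_zero_0 holomorphic_on_imp_isCont[OF hol]) simp
    then show ?thesis using True by (simp add: zero_enat_def)
  next
    case False
    then have "W.f v = 0" using W.zero[of v] s(1) by blast
    moreover have "zorder W.f v = int (the_enat (Z v))" using W.zorder[of v] s(3)[of v] False by simp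
    ultimately have "enat (the_enat (Z v)) \<le> zero_mult W.f v" using W0 by (auto simp: zero_mult_def)
    then show ?thesis using zero_mult_ge_iff[OF hol] W0 by blast
  qed
  show thesis
  proof (rule that[of "\<lambda>z. inverse (W.f 0) * W.f z"])
    show "(\<lambda>z. inverse (W.f 0) * W.f z) holomorphic_on UNIV" by (intro holomorphic_on_mult hol) auto
    show "inverse (W.f 0) * W.f 0 = 1" using W0 by simp
    show "has_zero (\<lambda>z. inverse (W.f 0) * W.f z) v (the_enat (Z v))" for v
      using has_zero_mult[OF has_zero_0[where f = "\<lambda>_. inverse (W.f 0)" and w = v] Wz[of v]] by simp
  qed
qed

lemma vanishes_onI:
  assumes "f holomorphic_on UNIV" "\<exists>z. f z \<noteq> 0" "\<And>v. has_zero f v (the_enat (Z v))"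
  shows "vanishes_on f Z"
  unfolding vanishes_on_def
  using zero_mult_ge_iff[OF assms(1,2)] assms(3) Z_finite by metis

text \<open>ln (1 + x) \<ge> x / (1 + x), and x = (r/|w|)^p stays bounded because the points keep a
  positive distance from 0. So a single r > 0 with finite integral bounds the sums of
  |w|^(-p).\<close>

lemma summable_from_integral:
  assumes p: "1 \<le> p" and r: "0 < r" and B: "\<And>n. (\<Sum>i\<in>zero_index Z n. ln (1 + (r / cmod (fst i)) powr p)) \<le> B"
  obtains S where "\<And>n. (\<Sum>i\<in>zero_index Z n. cmod (fst i) powr - p) \<le> S"
proof -
  have "finite (local_support Z 1)" using local_support_facts(1)[OF fin] by simp
  moreover have "0 \<notin> local_support Z 1" using Z0 by (simp add: local_support_def)
  ultimately obtain d where d: "d > 0" "\<And>w. w \<in> local_support Z 1 \<Longrightarrow> d \<le> cmod w"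
    using finite_set_avoid[of "local_support Z 1" 0] by (metis dist_0_norm)
  \<comment> \<open>\<open>d\<close> takes care of the finitely many points of the unit disc, 1 of
    all others.\<close>
  define \<delta> where "\<delta> = min d 1"
  have \<delta>: "\<delta> > 0" using d by (simp add: \<delta>_def)
  have ge: "\<delta> \<le> cmod (fst i)" if "i \<in> zero_index Z n" for i n
    using d(2)[of "fst i"] that by (cases "cmod (fst i) \<le> 1") (auto simp: \<delta>_def zero_index_def local_support_def)
  define X where "X = 1 + (r / \<delta>) powr p"
  have X: "X > 0" unfolding X_def by (simp add: add_pos_nonneg)
  show thesis
  proof (rule that)
    fix n
    have "(\<Sum>i\<in>zero_index Z n. cmod (fst i) powr - p) \<le>
      (\<Sum>i\<in>zero_index Z n. X * r powr - p * ln (1 + (r / cmod (fst i)) powr p))"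
    proof (intro sum_mono)
      fix i assume i: "i \<in> zero_index Z n"
      define x where "x = (r / cmod (fst i)) powr p"
      have s: "cmod (fst i) > 0" using ge[OF i] \<delta> by linarith
      have x: "x > 0" using r s by (simp add: x_def)
      have "x \<le> (r / \<delta>) powr p"
        unfolding x_def using ge[OF i] \<delta> r p s by (intro powr_mono2 divide_left_mono mult_pos_pos) auto
      then have xX: "1 + x \<le> X" by (simp add: X_def)
      have "ln (1 / (1 + x)) \<le> 1 / (1 + x) - 1" using x by (intro ln_le_minus_one) simp
      then have "x / (1 + x) \<le> ln (1 + x)" using x by (simp add: ln_div field_simps)
      then have "x \<le> (1 + x) * ln (1 + x)" using x by (simp add: field_simps)
      also have "\<dots> \<le> X * ln (1 + x)" using xX x by (intro mult_right_mono) auto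
      finally have "r powr - p * x \<le> r powr - p * (X * ln (1 + x))" by (intro mult_left_mono) auto
      moreover have "r powr - p * x = cmod (fst i) powr - p"
        using r s by (simp add: x_def powr_divide powr_minus divide_simps)
      ultimately show "cmod (fst i) powr - p \<le> X * r powr - p * ln (1 + (r / cmod (fst i)) powr p)"
        by (simp add: x_def mult_ac)
    qed
    also have "\<dots> = X * r powr - p * (\<Sum>i\<in>zero_index Z n. ln (1 + (r / cmod (fst i)) powr p))"
      by (simp add: sum_distrib_left)
    also have "\<dots> \<le> X * r powr - p * B" using X B by (intro mult_left_mono) auto
    finally show "(\<Sum>i\<in>zero_index Z n. cmod (fst i) powr - p) \<le> X * r powr - p * B" .
  qed
qed

text \<open>If the sums of |w|^(-p) are bounded, dividing by \<open>C\<close> turns the estimate up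
  to a constant into the exact one. Otherwise the integral is infinite for every r > 0, and only r =
  0 has content: there f 0 = 1 is enough, since \<open>exp_ennreal\<close> is at least 1.\<close>

lemma entire_function_with_growth:
  fixes p :: real
  assumes p: "1 \<le> p"
  defines "J \<equiv> \<lambda>r. \<integral>\<^sup>+t\<in>{0<..}. radial_integral_count Z (r * t) *
    ennreal (p\<^sup>2 * t powr (p - 1) / (1 + t powr p)\<^sup>2) \<partial>lborel"
  shows "\<exists>f. f holomorphic_on UNIV \<and> (\<exists>z. f z \<noteq> 0) \<and> vanishes_on f Z \<and>
    (\<forall>r\<ge>0. ennreal (max_modulus f r) \<le> exp_ennreal (J r))"
proof -
  have Jbound: "(\<Sum>i\<in>zero_index Z n. ln (1 + (r / cmod (fst i)) powr p)) \<le> B"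
    if "r > 0" "J r \<le> ennreal B" "B \<ge> 0" for r n B
  proof -
    have "ennreal (\<Sum>i\<in>zero_index Z n. ln (1 + (r / cmod (fst i)) powr p)) \<le> J r"
      unfolding J_def sum_zero_index[where g = "\<lambda>w. ln (1 + (r / cmod w) powr p)"]
      by (rule growth_integral_lower_bound[OF p fin Z0 that(1)])
    also have "\<dots> \<le> ennreal B" by (rule that(2))
    finally show ?thesis using that(3) by simp
  qed
  have exp1: "1 \<le> exp_ennreal x" for x
    by (auto simp: exp_ennreal_def simp flip: ennreal_1 intro!: ennreal_leI)
  show ?thesis
  proof (cases "\<exists>S. \<forall>n. (\<Sum>i\<in>zero_index Z n. cmod (fst i) powr - p) \<le> S")
    case True
    then obtain S where S: "\<And>n. (\<Sum>i\<in>zero_index Z n. cmod (fst i) powr - p) \<le> S" by blast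
    obtain C f where C: "C \<ge> 1" and f: "f holomorphic_on UNIV" "f 0 = 1"
      and bd: "\<And>z B. (\<And>n. (\<Sum>i\<in>zero_index Z n. ln (1 + (cmod z / cmod (fst i)) powr p)) \<le> B) \<Longrightarrow> cmod (f z) \<le> C * exp B"
      and fz: "\<And>v. has_zero f v (the_enat (Z v))"
      using bounded_function_exists[OF p S] by blast
    define g where "g = (\<lambda>z. of_real (1 / C) * f z)"
    have g: "g holomorphic_on UNIV" unfolding g_def by (intro holomorphic_on_mult f) auto
    have g0: "g 0 \<noteq> 0" using C f(2) by (simp add: g_def)
    have gz: "has_zero g v (the_enat (Z v))" for v
      unfolding g_def using has_zero_mult[OF has_zero_0[where f = "\<lambda>_. of_real (1 / C)" and w = v] fz[of v]] by simp
    have "ennreal (max_modulus g r) \<le> exp_ennreal (J r)" if r: "r \<ge> 0" for r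
    proof (cases "J r = \<infinity>")
      case True
      then show ?thesis by (simp add: exp_ennreal_def)
    next
      case False
      define B where "B = enn2real (J r)"
      have JB: "J r = ennreal B" "B \<ge> 0" using False by (auto simp: B_def less_top)
      have "max_modulus g r \<le> exp B"
      proof (rule max_modulus_least[OF r])
        fix z assume z: "cmod z = r"
        have "cmod (f z) \<le> C * exp B"
        proof (rule bd)
          fix n
          show "(\<Sum>i\<in>zero_index Z n. ln (1 + (cmod z / cmod (fst i)) powr p)) \<le> B"
          proof (cases "r = 0")
            case True
            then show ?thesis using z JB p by simp
          next
            case False
            then show ?thesis using z JB r by (intro Jbound) auto
          qed
        qed
        then show "cmod (g z) \<le> exp B" using C by (simp add: g_def norm_mult norm_divide field_simps)
      qed
      then have "ennreal (max_modulus g r) \<le> ennreal (exp B)" by (rule ennreal_leI)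
      also have "\<dots> = exp_ennreal (J r)" using JB by (simp add: exp_ennreal_def)
      finally show ?thesis .
    qed
    moreover have "vanishes_on g Z" using g g0 gz by (intro vanishes_onI) auto
    ultimately show ?thesis using g g0 by blast
  next
    case False
    have "infinite {w. Z w \<noteq> 0}"
    proof
      assume A: "finite {w. Z w \<noteq> 0}"
      define I where "I = (SIGMA w:{w. Z w \<noteq> 0}. {..<the_enat (Z w)})"
      have "finite I" unfolding I_def using A by (intro finite_SigmaI) auto
      moreover have "zero_index Z n \<subseteq> I" for n by (auto simp: zero_index_def I_def local_support_def)
      ultimately have "(\<Sum>i\<in>zero_index Z n. cmod (fst i) powr - p) \<le> (\<Sum>i\<in>I. cmod (fst i) powr - p)" for n
        by (intro sum_mono2) auto
      then show False using False by blast
    qed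
    then obtain f where f: "f holomorphic_on UNIV" "f 0 = 1" "\<And>v. has_zero f v (the_enat (Z v))"
      using weierstrass_function_exists by blast
    have "ennreal (max_modulus f r) \<le> exp_ennreal (J r)" if r: "r \<ge> 0" for r
    proof (cases "r = 0")
      case True
      have "max_modulus f 0 \<le> 1" using f(2) by (intro max_modulus_least) auto
      then have "ennreal (max_modulus f 0) \<le> 1" by (simp flip: ennreal_1 add: ennreal_leI)
      then show ?thesis using True exp1 order_trans by blast
    next
      case r0: False
      have "J r = \<infinity>"
      proof (rule ccontr)
        assume "J r \<noteq> \<infinity>"
        then have JB: "J r \<le> ennreal (enn2real (J r))" by (simp add: less_top)
        have rp: "0 < r" using r r0 by simp
        obtain S where "\<And>n. (\<Sum>i\<in>zero_index Z n. cmod (fst i) powr - p) \<le> S"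
          using summable_from_integral[OF p rp Jbound[OF rp JB enn2real_nonneg]] by blast
        then show False using False by blast
      qed
      then show ?thesis by (simp add: exp_ennreal_def)
    qed
    moreover have nz: "\<exists>z. f z \<noteq> 0" using f(2) by (intro exI[of _ 0]) simp
    moreover have "vanishes_on f Z" using f nz by (intro vanishes_onI) auto
    ultimately show ?thesis using f by blast
  qed
qed

lemma no_entire_function_of_slower_growth:
  "\<not> (\<exists>f. f holomorphic_on UNIV \<and> (\<exists>z. f z \<noteq> 0) \<and> vanishes_on f Z \<and>
    Liminf at_top (\<lambda>r::real. ennreal (max_modulus f r) / exp_ennreal (radial_integral_count Z r)) = 0)"
proof
  assume "\<exists>f. f holomorphic_on UNIV \<and> (\<exists>z. f z \<noteq> 0) \<and> vanishes_on f Z \<and>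
    Liminf at_top (\<lambda>r::real. ennreal (max_modulus f r) / exp_ennreal (radial_integral_count Z r)) = 0"
  then obtain f where f: "f holomorphic_on UNIV" "\<exists>z. f z \<noteq> 0" "vanishes_on f Z"
    and L: "Liminf at_top (\<lambda>r::real. ennreal (max_modulus f r) / exp_ennreal (radial_integral_count Z r)) = 0"
    by blast
  obtain c where c: "c > 0"
    "\<And>r. r \<ge> 1 \<Longrightarrow> ennreal c \<le> ennreal (max_modulus f r) / exp_ennreal (radial_integral_count Z r)"
    using max_modulus_lower_bound[OF fin Z0 f] by blast
  have "ennreal c \<le> Liminf at_top (\<lambda>r::real. ennreal (max_modulus f r) / exp_ennreal (radial_integral_count Z r))"
    using c(2) by (intro Liminf_bounded) (auto intro: eventually_mono[OF eventually_ge_at_top[of 1]])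
  then show False using L c(1) by simp
qed

end

theorem theorem2:
  fixes Z :: "complex \<Rightarrow> enat"
  assumes "\<And>r. r \<ge> 0 \<Longrightarrow> radial_count Z r < \<infinity>"
    and "Z 0 = 0"
  shows "(\<forall>p::real. p \<ge> 1 \<longrightarrow>
           (\<exists>f. f holomorphic_on UNIV \<and> (\<exists>z. f z \<noteq> 0) \<and> vanishes_on f Z \<and>
             (\<forall>r\<ge>0. ennreal (max_modulus f r) \<le>
                exp_ennreal (\<integral>\<^sup>+t\<in>{0<..}. radial_integral_count Z (r * t) *
                  ennreal (p\<^sup>2 * t powr (p - 1) / (1 + t powr p)\<^sup>2) \<partial>lborel))))
       \<and> \<not> (\<exists>f. f holomorphic_on UNIV \<and> (\<exists>z. f z \<noteq> 0) \<and> vanishes_on f Z \<and>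
             Liminf at_top (\<lambda>r::real. ennreal (max_modulus f r) /
               exp_ennreal (radial_integral_count Z r)) = 0)"
  using entire_function_with_growth[OF assms] no_entire_function_of_slower_growth[OF assms] by blast

end
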